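(* Let $M$ be a smooth finite dimensional manifold, $X$ an $\alpha$-Hölder geometric rough path in $G^{(\kappa)}_{\mathrm{geo}}(\mathbb{R}^d)$ on $[0,T]$, $\theta=\alpha(\kappa+1)>1$, $V:\mathbb{R}^d\to\Gamma(TM)$ a dynamical system and $g$ a complete Riemannian metric on $M$ with $|V^{(\kappa)}|_M+|\nabla V^{(\kappa)}|_M<\infty$. Let $\mu_{t,s}:=e^{V_{\log(X_{s,t})}}$ and let $\varphi\in C([0,T]^2\times M,M)$ be the unique function such that $\varphi_{t,t}=\mathrm{Id}$, $\varphi_{t,s}\circ\varphi_{s,r}=\varphi_{t,r}$ for all $r,s,t\in[0,T]$, and $\sup_{m\in M}d(\varphi_{t,s}(m),\mu_{t,s}(m))\le C|t-s|^\theta$ for some $C<\infty$ and all $(s,t)\in[0,T]^2$. Fix $m_0\in M$ and let $y_t:=\varphi_{t,0}(m_0)$. Then for every smooth function $f$ on $M$, $$\big|f(y_t)-(V_{X_{s,t}}f)(y_s)\big|\le C(f)|t-s|^\theta\qquad\forall\, s,t\in[0,T],$$ where $C(f)<\infty$ depends on the bounds on $f$ and its derivatives to order $2\kappa$ over a compact neighborhood of $y_{[0,T]}$.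
   Context: Fix $d,\kappa\in\mathbb{N}$, $T\in(0,\infty)$, $\alpha\in(\frac1{\kappa+1},\frac1\kappa]$. Algebra: $T^{(\kappa)}(\mathbb{R}^d)=\oplus_{k=0}^{\kappa}(\mathbb{R}^d)^{\otimes k}$ with product $AB$ the tensor product with all terms of degree $>\kappa$ dropped, and $[A,B]=AB-BA$. $|\cdot|$ is the norm induced from the dot product on $\mathbb{R}^d$ (different degrees orthogonal), $N(A)=\max_{1\le k\le\kappa}|A_k|^{1/k}$ with $A_k$ the degree $k$ component. $F^{(\kappa)}(\mathbb{R}^d)$ is the Lie subalgebra generated by $\mathbb{R}^d$, $G^{(\kappa)}_{\mathrm{geo}}(\mathbb{R}^d)=\exp(F^{(\kappa)}(\mathbb{R}^d))$ with $e^\xi=\sum_{k=0}^\kappa\xi^k/k!$, and $\log$ is the inverse of this exponential diffeomorphism. Rough paths: an $\alpha$-Hölder geometric rough path is a continuous $X:\{0\le s\le t\le T\}\to G^{(\kappa)}_{\mathrm{geo}}(\mathbb{R}^d)$ with $X_{s,s}=1$, $X_{s,t}X_{t,u}=X_{s,u}$ for $s\le t\le u$, and $N(X_{s,t})\le c|t-s|^{\alpha}$ for some $c<\infty$; extended by $X_{s,t}:=X_{t,s}^{-1}$ for $t\le s$. Dynamical systems: linear maps $V:\mathbb{R}^d\to\Gamma(TM)$. $V^{(\kappa)}:F^{(\kappa)}(\mathbb{R}^d)\to\Gamma(TM)$, $A\mapsto V_A$, is the unique linear map with $V_A=L_{V_{w_1}}\cdots L_{V_{w_{j-1}}}V_{w_j}$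 whenever $A=\mathrm{ad}_{w_1}\cdots\mathrm{ad}_{w_{j-1}}w_j$, $1\le j\le\kappa$. More generally, for $A\in T^{(\kappa)}(\mathbb{R}^d)$, $V_A$ is the differential operator on $C^\infty(M)$ depending linearly on $A$ with $V_{1}=\mathrm{Id}$ and $V_{a_1\otimes\cdots\otimes a_k}=V_{a_1}\cdots V_{a_k}$. With $\nabla$, $d$ the Levi-Civita derivative and distance of $g$: $|V^{(\kappa)}|_M=\sup\{\sup_m|V_A(m)|_g:A\in F^{(\kappa)},|A|=1\}$, $|\nabla V^{(\kappa)}|_M=\sup\{\sup_{|v|=1}|\nabla_vV_A|_g:A\in F^{(\kappa)},|A|=1\}$. $e^Y$ is the time-one flow of a complete vector field $Y$ (the hypotheses imply all $V_A$, $A\in F^{(\kappa)}(\mathbb{R}^d)$, are complete, and that $\varphi$ exists and is unique). *)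

theory Defs
  imports "HOL-Analysis.Analysis"
begin

section \<open>The truncated tensor algebra\<close>

text \<open>
  An element of the truncated tensor algebra over the Euclidean space \<open>real ^ 'd\<close> is given by its
  coordinates: \<open>A w\<close> is the coefficient of \<open>e\<^bsub>i\<^sub>1\<^esub> \<otimes> \<dots> \<otimes> e\<^bsub>i\<^sub>k\<^esub>\<close> for the word \<open>w = [i\<^sub>1, \<dots>, i\<^sub>k]\<close>, where
  \<open>e\<^sub>i\<close> is the standard basis. The degree of a basis tensor is the length of the word.
\<close>

type_synonym 'd tensor = "'d list \<Rightarrow> real"

definition tensor_alg :: "nat \<Rightarrow> 'd tensor set" where
  "tensor_alg \<kappa> = {A. \<forall>w. length w > \<kappa> \<longrightarrow> A w = 0}"

definition tone :: "'d tensor" where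
  "tone = (\<lambda>w. if w = [] then 1 else 0)"

definition tmult :: "nat \<Rightarrow> 'd tensor \<Rightarrow> 'd tensor \<Rightarrow> 'd tensor" where
  "tmult \<kappa> A B =
     (\<lambda>w. if length w \<le> \<kappa> then \<Sum>i\<le>length w. A (take i w) * B (drop i w) else 0)"

definition tbracket :: "nat \<Rightarrow> 'd tensor \<Rightarrow> 'd tensor \<Rightarrow> 'd tensor" where
  "tbracket \<kappa> A B = (\<lambda>w. tmult \<kappa> A B w - tmult \<kappa> B A w)"

definition tdeg :: "nat \<Rightarrow> 'd tensor \<Rightarrow> 'd tensor" where
  "tdeg k A = (\<lambda>w. if length w = k then A w else 0)"

definition tnorm :: "nat \<Rightarrow> ('d::finite) tensor \<Rightarrow> real" where
  "tnorm \<kappa> A = sqrt (\<Sum>w\<in>{w. length w \<le> \<kappa>}. (A w)\<^sup>2)"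

definition hom_norm :: "nat \<Rightarrow> ('d::finite) tensor \<Rightarrow> real" where
  "hom_norm \<kappa> A = Max ((\<lambda>k. root k (tnorm \<kappa> (tdeg k A))) ` {1..\<kappa>})"

definition tvector :: "real ^ 'd \<Rightarrow> 'd tensor" where
  "tvector a = (\<lambda>w. case w of [i] \<Rightarrow> a $ i | _ \<Rightarrow> 0)"

inductive_set lie_alg :: "nat \<Rightarrow> ('d::finite) tensor set" for \<kappa> where
  vector: "tvector a \<in> lie_alg \<kappa>"
| add: "A \<in> lie_alg \<kappa> \<Longrightarrow> B \<in> lie_alg \<kappa> \<Longrightarrow> (\<lambda>w. A w + B w) \<in> lie_alg \<kappa>"
| scale: "A \<in> lie_alg \<kappa> \<Longrightarrow> (\<lambda>w. r * A w) \<in> lie_alg \<kappa>"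
| bracket: "A \<in> lie_alg \<kappa> \<Longrightarrow> B \<in> lie_alg \<kappa> \<Longrightarrow> tbracket \<kappa> A B \<in> lie_alg \<kappa>"

primrec tpower :: "nat \<Rightarrow> 'd tensor \<Rightarrow> nat \<Rightarrow> 'd tensor" where
  "tpower \<kappa> A 0 = tone"
| "tpower \<kappa> A (Suc n) = tmult \<kappa> A (tpower \<kappa> A n)"

definition texp :: "nat \<Rightarrow> 'd tensor \<Rightarrow> 'd tensor" where
  "texp \<kappa> A = (\<lambda>w. \<Sum>k\<le>\<kappa>. tpower \<kappa> A k w / fact k)"

definition geo_group :: "nat \<Rightarrow> ('d::finite) tensor set" where
  "geo_group \<kappa> = texp \<kappa> ` lie_alg \<kappa>"

definition tlog :: "nat \<Rightarrow> ('d::finite) tensor \<Rightarrow> 'd tensor" where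
  "tlog \<kappa> = the_inv_into (lie_alg \<kappa>) (texp \<kappa>)"

definition tinverse :: "nat \<Rightarrow> 'd tensor \<Rightarrow> 'd tensor" where
  "tinverse \<kappa> A =
     (THE B. B \<in> tensor_alg \<kappa> \<and> tmult \<kappa> A B = tone \<and> tmult \<kappa> B A = tone)"

section \<open>Rough paths\<close>

text \<open>
  Continuity refers to the product topology on \<open>'d list \<Rightarrow> real\<close>, which on the finite dimensional
  subspace \<^term>\<open>tensor_alg \<kappa>\<close> is the usual topology. Only the values \<open>X s t\<close> with
  \<open>0 \<le> s \<le> t \<le> T\<close> matter.
\<close>

definition geometric_rough_path ::
    "nat \<Rightarrow> real \<Rightarrow> real \<Rightarrow> (real \<Rightarrow> real \<Rightarrow> ('d::finite) tensor) \<Rightarrow> bool" where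
  "geometric_rough_path \<kappa> \<alpha> T X \<longleftrightarrow>
     (\<forall>s t. 0 \<le> s \<and> s \<le> t \<and> t \<le> T \<longrightarrow> X s t \<in> geo_group \<kappa>) \<and>
     continuous_on {(s, t). 0 \<le> s \<and> s \<le> t \<and> t \<le> T} (\<lambda>(s, t). X s t) \<and>
     (\<forall>s\<in>{0..T}. X s s = tone) \<and>
     (\<forall>s t u. 0 \<le> s \<and> s \<le> t \<and> t \<le> u \<and> u \<le> T \<longrightarrow> tmult \<kappa> (X s t) (X t u) = X s u) \<and>
     (\<exists>c. \<forall>s t. 0 \<le> s \<and> s \<le> t \<and> t \<le> T \<longrightarrow> hom_norm \<kappa> (X s t) \<le> c * \<bar>t - s\<bar> powr \<alpha>)"

definition rp_extend ::
    "nat \<Rightarrow> (real \<Rightarrow> real \<Rightarrow> 'd tensor) \<Rightarrow> real \<Rightarrow> real \<Rightarrow> 'd tensor" where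
  "rp_extend \<kappa> X s t = (if s \<le> t then X s t else tinverse \<kappa> (X t s))"

section \<open>Smooth manifolds, functions and vector fields\<close>

primrec k_smooth_on ::
    "nat \<Rightarrow> 'a set \<Rightarrow> ('a::real_normed_vector \<Rightarrow> 'b::real_normed_vector) \<Rightarrow> bool" where
  "k_smooth_on 0 S f = continuous_on S f"
| "k_smooth_on (Suc n) S f =
     ((\<forall>x\<in>S. f differentiable (at x)) \<and>
      (\<forall>v. k_smooth_on n S (\<lambda>x. frechet_derivative f (at x) v)))"

text \<open>Only used for open \<open>S\<close>.\<close>

definition smooth_on ::
    "'a set \<Rightarrow> ('a::real_normed_vector \<Rightarrow> 'b::real_normed_vector) \<Rightarrow> bool" where
  "smooth_on S f \<longleftrightarrow> (\<forall>n. k_smooth_on n S f)"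

text \<open>
  The manifold is the whole type \<open>'m\<close>, modelled on the Euclidean space \<open>'e\<close>. A chart is a pair of
  its domain and its coordinate map.
\<close>

type_synonym ('m, 'e) chart = "'m set \<times> ('m \<Rightarrow> 'e)"

abbreviation cdom :: "('m, 'e) chart \<Rightarrow> 'm set" where
  "cdom c \<equiv> fst c"

abbreviation cmap :: "('m, 'e) chart \<Rightarrow> 'm \<Rightarrow> 'e" where
  "cmap c \<equiv> snd c"

definition cinv :: "('m, 'e) chart \<Rightarrow> 'e \<Rightarrow> 'm" where
  "cinv c = inv_into (cdom c) (cmap c)"

definition smooth_atlas ::
    "('m::{t2_space,second_countable_topology}, 'e::euclidean_space) chart set \<Rightarrow> bool" where
  "smooth_atlas \<A> \<longleftrightarrow>
     (\<Union>c\<in>\<A>. cdom c) = UNIV \<and>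
     (\<forall>c\<in>\<A>. open (cdom c) \<and> open (cmap c ` cdom c) \<and>
        homeomorphism (cdom c) (cmap c ` cdom c) (cmap c) (cinv c)) \<and>
     (\<forall>c\<in>\<A>. \<forall>c'\<in>\<A>. smooth_on (cmap c ` (cdom c \<inter> cdom c')) (cmap c' \<circ> cinv c))"

definition smooth_fun ::
    "('m, 'e::euclidean_space) chart set \<Rightarrow> ('m \<Rightarrow> real) \<Rightarrow> bool" where
  "smooth_fun \<A> f \<longleftrightarrow> (\<forall>c\<in>\<A>. smooth_on (cmap c ` cdom c) (f \<circ> cinv c))"

text \<open>
  A tangent vector at \<open>p\<close> is the family of its coordinate representations in all charts around \<open>p\<close>,
  subject to the transformation law under changes of charts. For the other indices the family is \<open>0\<close>.
\<close>

type_synonym ('m, 'e) tvec = "('m, 'e) chart \<Rightarrow> 'e"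
type_synonym ('m, 'e) vfield = "'m \<Rightarrow> ('m, 'e) tvec"

definition tangent_space ::
    "('m, 'e::euclidean_space) chart set \<Rightarrow> 'm \<Rightarrow> ('m, 'e) tvec set" where
  "tangent_space \<A> p = {v.
     (\<forall>c. c \<notin> \<A> \<or> p \<notin> cdom c \<longrightarrow> v c = 0) \<and>
     (\<forall>c\<in>\<A>. \<forall>c'\<in>\<A>. p \<in> cdom c \<inter> cdom c' \<longrightarrow>
        v c' = frechet_derivative (cmap c' \<circ> cinv c) (at (cmap c p)) (v c))}"

definition tv_lin :: "real \<Rightarrow> ('m, 'e::real_vector) tvec \<Rightarrow> real \<Rightarrow> ('m, 'e) tvec \<Rightarrow> ('m, 'e) tvec"
  where "tv_lin a v b w = (\<lambda>c. a *\<^sub>R v c + b *\<^sub>R w c)"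

definition coord_vector ::
    "('m, 'e::euclidean_space) chart set \<Rightarrow> ('m, 'e) chart \<Rightarrow> 'e \<Rightarrow> ('m, 'e) vfield" where
  "coord_vector \<A> c u p = (\<lambda>c'. if c' \<in> \<A> \<and> p \<in> cdom c'
     then frechet_derivative (cmap c' \<circ> cinv c) (at (cmap c p)) u else 0)"

definition smooth_vfield ::
    "('m, 'e::euclidean_space) chart set \<Rightarrow> ('m, 'e) vfield \<Rightarrow> bool" where
  "smooth_vfield \<A> Y \<longleftrightarrow>
     (\<forall>p. Y p \<in> tangent_space \<A> p) \<and>
     (\<forall>c\<in>\<A>. smooth_on (cmap c ` cdom c) (\<lambda>x. Y (cinv c x) c))"

text \<open>The differential of \<open>f\<close> at \<open>p\<close>; its value does not depend on the selected chart.\<close>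

definition mdiff ::
    "('m, 'e::euclidean_space) chart set \<Rightarrow> ('m \<Rightarrow> real) \<Rightarrow> 'm \<Rightarrow> ('m, 'e) tvec \<Rightarrow> real" where
  "mdiff \<A> f p v =
     (let c = (SOME c. c \<in> \<A> \<and> p \<in> cdom c)
      in frechet_derivative (f \<circ> cinv c) (at (cmap c p)) (v c))"

definition vf_apply ::
    "('m, 'e::euclidean_space) chart set \<Rightarrow> ('m, 'e) vfield \<Rightarrow> ('m \<Rightarrow> real) \<Rightarrow> 'm \<Rightarrow> real" where
  "vf_apply \<A> Y f = (\<lambda>p. mdiff \<A> f p (Y p))"

text \<open>The Lie derivative \<open>L\<^sub>X Y = [X, Y]\<close>, in coordinates \<open>DY \<cdot> X - DX \<cdot> Y\<close>.\<close>

definition lie_deriv ::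
    "('m, 'e::euclidean_space) chart set \<Rightarrow> ('m, 'e) vfield \<Rightarrow> ('m, 'e) vfield \<Rightarrow> ('m, 'e) vfield" where
  "lie_deriv \<A> X Y = (\<lambda>p c. if c \<in> \<A> \<and> p \<in> cdom c
     then frechet_derivative (\<lambda>x. Y (cinv c x) c) (at (cmap c p)) (X p c)
        - frechet_derivative (\<lambda>x. X (cinv c x) c) (at (cmap c p)) (Y p c)
     else 0)"

definition integral_curve ::
    "('m::topological_space, 'e::euclidean_space) chart set \<Rightarrow> ('m, 'e) vfield \<Rightarrow> (real \<Rightarrow> 'm) \<Rightarrow> bool"
  where
  "integral_curve \<A> Y \<gamma> \<longleftrightarrow>
     continuous_on UNIV \<gamma> \<and>
     (\<forall>t. \<forall>c\<in>\<A>. \<gamma> t \<in> cdom c \<longrightarrow> ((cmap c \<circ> \<gamma>) has_vector_derivative Y (\<gamma> t) c) (at t))"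

text \<open>
  The time-one flow of a complete vector field. For a complete smooth vector field the integral curve
  exists and is unique.
\<close>

definition vf_exp ::
    "('m::topological_space, 'e::euclidean_space) chart set \<Rightarrow> ('m, 'e) vfield \<Rightarrow> 'm \<Rightarrow> 'm" where
  "vf_exp \<A> Y p = (SOME \<gamma>. integral_curve \<A> Y \<gamma> \<and> \<gamma> 0 = p) 1"

section \<open>Riemannian metrics\<close>

type_synonym ('m, 'e) metric = "'m \<Rightarrow> ('m, 'e) tvec \<Rightarrow> ('m, 'e) tvec \<Rightarrow> real"

definition riemannian_metric ::
    "('m, 'e::euclidean_space) chart set \<Rightarrow> ('m, 'e) metric \<Rightarrow> bool" where
  "riemannian_metric \<A> g \<longleftrightarrow>
     (\<forall>p. \<forall>v\<in>tangent_space \<A> p. \<forall>w\<in>tangent_space \<A> p. g p v w = g p w v) \<and>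
     (\<forall>p. \<forall>u\<in>tangent_space \<A> p. \<forall>v\<in>tangent_space \<A> p. \<forall>w\<in>tangent_space \<A> p. \<forall>a b.
        g p (tv_lin a u b v) w = a * g p u w + b * g p v w) \<and>
     (\<forall>p. \<forall>v\<in>tangent_space \<A> p. v \<noteq> (\<lambda>_. 0) \<longrightarrow> g p v v > 0) \<and>
     (\<forall>c\<in>\<A>. \<forall>u w. smooth_on (cmap c ` cdom c)
        (\<lambda>x. g (cinv c x) (coord_vector \<A> c u (cinv c x)) (coord_vector \<A> c w (cinv c x))))"

definition gnorm :: "('m, 'e) metric \<Rightarrow> 'm \<Rightarrow> ('m, 'e) tvec \<Rightarrow> real" where
  "gnorm g p v = sqrt (g p v v)"

definition pw_C1_curve ::
    "('m::topological_space, 'e::euclidean_space) chart set \<Rightarrow> (real \<Rightarrow> 'm) \<Rightarrow> bool" where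
  "pw_C1_curve \<A> \<gamma> \<longleftrightarrow>
     continuous_on {0..1} \<gamma> \<and>
     (\<exists>S. finite S \<and>
        (\<forall>c\<in>\<A>. (cmap c \<circ> \<gamma>) C1_differentiable_on {t \<in> {0..1} - S. \<gamma> t \<in> cdom c}))"

definition velocity ::
    "('m, 'e::euclidean_space) chart set \<Rightarrow> (real \<Rightarrow> 'm) \<Rightarrow> real \<Rightarrow> ('m, 'e) tvec" where
  "velocity \<A> \<gamma> t = (\<lambda>c. if c \<in> \<A> \<and> \<gamma> t \<in> cdom c
     then vector_derivative (cmap c \<circ> \<gamma>) (at t) else 0)"

text \<open>
  The distance is \<open>\<infinity>\<close> between points of different connected components, hence the values in
  \<^typ>\<open>ennreal\<close>.
\<close>

definition gdist ::
    "('m::topological_space, 'e::euclidean_space) chart set \<Rightarrow> ('m, 'e) metric \<Rightarrow> 'm \<Rightarrow> 'm \<Rightarrow> ennreal"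
  where
  "gdist \<A> g p q = (INF \<gamma> \<in> {\<gamma>. pw_C1_curve \<A> \<gamma> \<and> \<gamma> 0 = p \<and> \<gamma> 1 = q}.
     \<integral>\<^sup>+ t \<in> {0..1}. ennreal (gnorm g (\<gamma> t) (velocity \<A> \<gamma> t)) \<partial>lborel)"

definition complete_metric ::
    "('m::topological_space, 'e::euclidean_space) chart set \<Rightarrow> ('m, 'e) metric \<Rightarrow> bool" where
  "complete_metric \<A> g \<longleftrightarrow>
     (\<forall>\<sigma>::nat \<Rightarrow> 'm.
        (\<forall>\<epsilon>>0. \<exists>N. \<forall>m\<ge>N. \<forall>n\<ge>N. gdist \<A> g (\<sigma> m) (\<sigma> n) < ennreal \<epsilon>) \<longrightarrow>
        (\<exists>p. (\<lambda>n. gdist \<A> g (\<sigma> n) p) \<longlonglongrightarrow> 0))"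

text \<open>
  \<open>nabla p v Y\<close> is the covariant derivative of \<open>Y\<close> in the direction \<open>v\<close> at \<open>p\<close>. The Levi-Civita
  derivative is characterised as the torsion-free metric connection.
\<close>

definition levi_civita ::
    "('m, 'e::euclidean_space) chart set \<Rightarrow> ('m, 'e) metric \<Rightarrow>
     ('m \<Rightarrow> ('m, 'e) tvec \<Rightarrow> ('m, 'e) vfield \<Rightarrow> ('m, 'e) tvec) \<Rightarrow> bool" where
  "levi_civita \<A> g nabla \<longleftrightarrow>
     (\<forall>p Y. smooth_vfield \<A> Y \<longrightarrow> (\<forall>v\<in>tangent_space \<A> p. nabla p v Y \<in> tangent_space \<A> p)) \<and>
     (\<forall>X Y. smooth_vfield \<A> X \<and> smooth_vfield \<A> Y \<longrightarrow> smooth_vfield \<A> (\<lambda>p. nabla p (X p) Y)) \<and>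
     (\<forall>p Y a b. smooth_vfield \<A> Y \<longrightarrow> (\<forall>v\<in>tangent_space \<A> p. \<forall>w\<in>tangent_space \<A> p.
        nabla p (tv_lin a v b w) Y = tv_lin a (nabla p v Y) b (nabla p w Y))) \<and>
     (\<forall>p Y Z. smooth_vfield \<A> Y \<and> smooth_vfield \<A> Z \<longrightarrow> (\<forall>v\<in>tangent_space \<A> p.
        nabla p v (\<lambda>q. tv_lin 1 (Y q) 1 (Z q)) = tv_lin 1 (nabla p v Y) 1 (nabla p v Z))) \<and>
     (\<forall>p Y f. smooth_vfield \<A> Y \<and> smooth_fun \<A> f \<longrightarrow> (\<forall>v\<in>tangent_space \<A> p.
        nabla p v (\<lambda>q c. f q *\<^sub>R Y q c) = tv_lin (mdiff \<A> f p v) (Y p) (f p) (nabla p v Y))) \<and>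
     (\<forall>X Y p. smooth_vfield \<A> X \<and> smooth_vfield \<A> Y \<longrightarrow>
        tv_lin 1 (nabla p (X p) Y) (- 1) (nabla p (Y p) X) = lie_deriv \<A> X Y p) \<and>
     (\<forall>Y Z p. smooth_vfield \<A> Y \<and> smooth_vfield \<A> Z \<longrightarrow> (\<forall>v\<in>tangent_space \<A> p.
        mdiff \<A> (\<lambda>q. g q (Y q) (Z q)) p v = g p (nabla p v Y) (Z p) + g p (Y p) (nabla p v Z)))"

section \<open>Dynamical systems\<close>

definition dynamical_system ::
    "('m, 'e::euclidean_space) chart set \<Rightarrow> (real ^ ('d::finite) \<Rightarrow> ('m, 'e) vfield) \<Rightarrow> bool" where
  "dynamical_system \<A> V \<longleftrightarrow>
     (\<forall>a. smooth_vfield \<A> (V a)) \<and>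
     (\<forall>r a s b p. V (r *\<^sub>R a + s *\<^sub>R b) p = tv_lin r (V a p) s (V b p))"

text \<open>\<open>ad_word \<kappa> [w\<^sub>1, \<dots>, w\<^sub>j]\<close> is \<open>ad w\<^sub>1 (\<dots> (ad w\<^bsub>j-1\<^esub> w\<^sub>j))\<close>; the empty list is never used.\<close>

fun ad_word :: "nat \<Rightarrow> (real ^ 'd) list \<Rightarrow> 'd tensor" where
  "ad_word \<kappa> [] = (\<lambda>_. 0)"
| "ad_word \<kappa> [a] = tvector a"
| "ad_word \<kappa> (a # as) = tbracket \<kappa> (tvector a) (ad_word \<kappa> as)"

fun lie_word ::
    "('m, 'e::euclidean_space) chart set \<Rightarrow> (real ^ 'd \<Rightarrow> ('m, 'e) vfield) \<Rightarrow>
     (real ^ 'd) list \<Rightarrow> ('m, 'e) vfield" where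
  "lie_word \<A> V [] = (\<lambda>_ _. 0)"
| "lie_word \<A> V [a] = V a"
| "lie_word \<A> V (a # as) = lie_deriv \<A> (V a) (lie_word \<A> V as)"

text \<open>
  \<open>W\<close> is the linear map \<open>A \<mapsto> V\<^sub>A\<close> from the Lie algebra to vector fields. It is determined
  uniquely on \<^term>\<open>lie_alg \<kappa>\<close>, which is spanned by the elements \<^term>\<open>ad_word \<kappa> as\<close>.
\<close>

definition lie_extension ::
    "('m, 'e::euclidean_space) chart set \<Rightarrow> nat \<Rightarrow> (real ^ ('d::finite) \<Rightarrow> ('m, 'e) vfield) \<Rightarrow>
     ('d tensor \<Rightarrow> ('m, 'e) vfield) \<Rightarrow> bool" where
  "lie_extension \<A> \<kappa> V W \<longleftrightarrow>
     (\<forall>A\<in>lie_alg \<kappa>. smooth_vfield \<A> (W A)) \<and>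
     (\<forall>A\<in>lie_alg \<kappa>. \<forall>B\<in>lie_alg \<kappa>. \<forall>r s p.
        W (\<lambda>w. r * A w + s * B w) p = tv_lin r (W A p) s (W B p)) \<and>
     (\<forall>as. 1 \<le> length as \<and> length as \<le> \<kappa> \<longrightarrow> W (ad_word \<kappa> as) = lie_word \<A> V as)"

fun word_op ::
    "('m, 'e::euclidean_space) chart set \<Rightarrow> (real ^ ('d::finite) \<Rightarrow> ('m, 'e) vfield) \<Rightarrow>
     'd list \<Rightarrow> ('m \<Rightarrow> real) \<Rightarrow> 'm \<Rightarrow> real" where
  "word_op \<A> V [] f = f"
| "word_op \<A> V (i # w) f = vf_apply \<A> (V (axis i 1)) (word_op \<A> V w f)"

text \<open>
  The differential operator \<open>V\<^sub>A\<close> for \<open>A\<close> in the tensor algebra, expanded linearly in the basis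
  tensors \<open>e\<^bsub>i\<^sub>1\<^esub> \<otimes> \<dots> \<otimes> e\<^bsub>i\<^sub>k\<^esub>\<close>.
\<close>

definition diff_op ::
    "('m, 'e::euclidean_space) chart set \<Rightarrow> nat \<Rightarrow> (real ^ ('d::finite) \<Rightarrow> ('m, 'e) vfield) \<Rightarrow>
     'd tensor \<Rightarrow> ('m \<Rightarrow> real) \<Rightarrow> 'm \<Rightarrow> real" where
  "diff_op \<A> \<kappa> V A f p = (\<Sum>w\<in>{w. length w \<le> \<kappa>}. A w * word_op \<A> V w f p)"

definition sup_norm_V ::
    "('m, 'e) metric \<Rightarrow> nat \<Rightarrow> (('d::finite) tensor \<Rightarrow> ('m, 'e) vfield) \<Rightarrow> ennreal" where
  "sup_norm_V g \<kappa> W =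
     (SUP A \<in> {A \<in> lie_alg \<kappa>. tnorm \<kappa> A = 1}. SUP p. ennreal (gnorm g p (W A p)))"

definition sup_norm_nabla_V ::
    "('m, 'e::euclidean_space) chart set \<Rightarrow> ('m, 'e) metric \<Rightarrow>
     ('m \<Rightarrow> ('m, 'e) tvec \<Rightarrow> ('m, 'e) vfield \<Rightarrow> ('m, 'e) tvec) \<Rightarrow>
     nat \<Rightarrow> (('d::finite) tensor \<Rightarrow> ('m, 'e) vfield) \<Rightarrow> ennreal" where
  "sup_norm_nabla_V \<A> g nabla \<kappa> W =
     (SUP A \<in> {A \<in> lie_alg \<kappa>. tnorm \<kappa> A = 1}.
        SUP p. SUP v \<in> {v \<in> tangent_space \<A> p. gnorm g p v = 1}.
          ennreal (gnorm g p (nabla p v (W A))))"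

section \<open>Bounds on derivatives over compact sets\<close>

text \<open>
  A compact neighborhood of a set \<open>S\<close>, presented as a finite union of compact sets that each lie in
  the domain of a chart. Every compact set of the manifold has such a presentation.
\<close>

definition compact_nhd ::
    "('m::topological_space, 'e) chart set \<Rightarrow> 'm set \<Rightarrow> (('m, 'e) chart \<times> 'm set) set \<Rightarrow> bool" where
  "compact_nhd \<A> S P \<longleftrightarrow>
     finite P \<and> (\<forall>(c, L)\<in>P. c \<in> \<A> \<and> compact L \<and> L \<subseteq> cdom c) \<and>
     S \<subseteq> interior (\<Union>(c, L)\<in>P. L)"

primrec iter_partial :: "'e list \<Rightarrow> ('e::euclidean_space \<Rightarrow> real) \<Rightarrow> 'e \<Rightarrow> real" where
  "iter_partial [] h = h"
| "iter_partial (b # bs) h = (\<lambda>x. frechet_derivative (iter_partial bs h) (at x) b)"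

definition Ck_norm ::
    "nat \<Rightarrow> (('m, 'e::euclidean_space) chart \<times> 'm set) set \<Rightarrow> ('m \<Rightarrow> real) \<Rightarrow> real" where
  "Ck_norm n P f = Sup {\<bar>iter_partial bs (f \<circ> cinv c) (cmap c p)\<bar> | c L p bs.
     (c, L) \<in> P \<and> p \<in> L \<and> set bs \<subseteq> Basis \<and> length bs \<le> n}"

end

theory Submission
  imports Defs
begin

text \<open>
  Fix \<open>s\<close> and \<open>t\<close>, put \<open>\<rho> = \<bar>t - s\<bar> powr \<alpha>\<close>, let \<open>\<xi>\<close> be the logarithm of the increment \<open>X\<^sub>s\<^sub>t\<close>, and let \<open>\<gamma>\<close>
  be the integral curve of the vector field \<open>V\<^sub>\<xi>\<close> with \<open>\<gamma> 0 = y s\<close>, so that \<open>\<mu> t s (y s) = \<gamma> 1\<close>. The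
  function

    \<open>h u = diff_op \<A> \<kappa> V (E u) f (\<gamma> (1 - u))\<close>, where \<open>E u\<close> is the truncated exponential of \<open>u \<xi>\<close>,

  runs from \<open>h 0 = f (\<gamma> 1)\<close> to the expansion \<open>h 1\<close> of the theorem. Its derivative consists of the
  operator of the truncated product of \<open>\<xi>\<close> and \<open>E u\<close>, from \<open>E' = \<xi> E\<close>, minus the composition of the
  operators of \<open>\<xi>\<close> and of \<open>E u\<close>, from the motion along \<open>\<gamma>\<close>. On basis tensors the composition of
  operators is the concatenation of words, so the two contributions cancel except for the pairs of
  words that the truncation cuts off: these have total length more than \<open>\<kappa>\<close>, and at most \<open>2 \<kappa>\<close>, which
  is the order of the derivatives of \<open>f\<close> in the bound. Since the coefficients of \<open>\<xi>\<close> and of \<open>E u\<close> at a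
  word of length \<open>j\<close> are of order \<open>\<rho>\<^sup>j\<close>, the derivative of \<open>h\<close> is of order \<open>\<rho>\<close> to the power \<open>\<kappa> + 1\<close>, that
  is \<open>\<bar>t - s\<bar> powr \<theta>\<close>. This is \<open>taylor_along_flow\<close>. What remains is \<open>f (y t) - f (\<gamma> 1)\<close>, where the distance
  of \<open>y t = \<phi> t s (y s)\<close> and \<open>\<gamma> 1\<close> is of order \<open>\<bar>t - s\<bar> powr \<theta>\<close> by assumption, and a smooth function is
  Lipschitz for the Riemannian distance near a compact set (\<open>metric_tube\<close>).

  Four ingredients support this argument.

  The coefficients of the logarithm inherit the scaling of the increment, because the equation
  between \<open>\<xi>\<close> and its exponential is triangular with respect to the degree (\<open>hom_bound_log\<close>,
  \<open>rough_path_log\<close>).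

  The derivative along the vector field \<open>V\<^sub>\<xi>\<close> is the differential operator of the tensor \<open>\<xi>\<close>
  (\<open>vf_apply_lie_extension\<close>): a Lie derivative of vector fields acts on functions as a commutator, by
  the symmetry of second derivatives, and the Lie algebra is spanned by nested brackets of vectors,
  by the Jacobi identity.

  The integral curve \<open>\<gamma>\<close> exists for all times because a bounded smooth vector field on a complete
  Riemannian manifold is complete (\<open>complete_if_bounded\<close>). Picard's theorem gives solutions in a chart
  for a time that is locally bounded below. Concatenated solutions that stop at a finite time would
  converge, as their speed is bounded, and could then be continued beyond that time.

  The estimate has to be uniform on a compact set. For small \<open>\<rho>\<close> the curve \<open>\<gamma>\<close> stays in a fixed compact
  neighbourhood of the curve \<open>y\<close>, because its speed is of order \<open>\<rho>\<close> and because small Riemannian distance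
  means small distance in a chart (\<open>gdist_bounds_chart_distance\<close>). When \<open>\<rho>\<close> is bounded below, both terms
  of the difference are bounded separately.
\<close>

section \<open>The truncated tensor algebra\<close>

lemma finite_words [simp]: "finite {w :: ('d::finite) list. length w \<le> n}"
  using finite_lists_length_le[of "UNIV :: 'd set" n] by simp

text \<open>
  The product of the tensor algebra without truncation. It obeys a recursion on the word in which no
  degree of truncation has to be tracked.
\<close>

definition conv :: "'d tensor \<Rightarrow> 'd tensor \<Rightarrow> 'd tensor" where
  "conv A B w = (\<Sum>i\<le>length w. A (take i w) * B (drop i w))"

lemma tmult_conv: "tmult \<kappa> A B w = (if length w \<le> \<kappa> then conv A B w else 0)"
  by (simp add: tmult_def conv_def)

lemma conv_Nil [simp]: "conv A B [] = A [] * B []"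
  by (simp add: conv_def)

lemma conv_Cons: "conv A B (x # w) = A [] * B (x # w) + conv (\<lambda>u. A (x # u)) B w"
  unfolding conv_def length_Cons by (subst sum.atMost_Suc_shift) simp

lemma conv_cong:
  assumes "\<And>u v. u @ v = w \<Longrightarrow> A u = A' u" "\<And>u v. u @ v = w \<Longrightarrow> B v = B' v"
  shows "conv A B w = conv A' B' w"
  unfolding conv_def
proof (rule sum.cong[OF refl])
  fix i
  show "A (take i w) * B (drop i w) = A' (take i w) * B' (drop i w)"
    using assms(1)[of "take i w" "drop i w"] assms(2)[of "take i w" "drop i w"] by simp
qed

lemma conv_lin_left: "conv (\<lambda>w. a * A w + b * A' w) B w = a * conv A B w + b * conv A' B w"
  by (simp add: conv_def sum_distrib_left sum.distrib algebra_simps)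

lemma conv_lin_right: "conv A (\<lambda>w. a * B w + b * B' w) w = a * conv A B w + b * conv A B' w"
  by (simp add: conv_def sum_distrib_left sum.distrib algebra_simps)

text \<open>
  The recursion \<open>conv_Cons\<close> splits off the first letter of the word and is linear in the left
  factor, so induction on the word with an arbitrary left factor applies.
\<close>

lemma conv_assoc: "conv (conv A B) C w = conv A (conv B C) w"
proof (induction w arbitrary: A)
  case (Cons x w)
  have "conv (\<lambda>u. conv A B (x # u)) C w
      = conv (\<lambda>u. A [] * B (x # u) + 1 * conv (\<lambda>u. A (x # u)) B u) C w"
    by (simp add: conv_Cons)
  also have "\<dots> = A [] * conv (\<lambda>u. B (x # u)) C w + 1 * conv (conv (\<lambda>u. A (x # u)) B) C w"
    by (rule conv_lin_left)
  finally show ?case by (simp add: conv_Cons Cons.IH algebra_simps)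
qed simp

lemma tmult_assoc: "tmult \<kappa> (tmult \<kappa> A B) C = tmult \<kappa> A (tmult \<kappa> B C)"
proof
  fix w :: "'a list"
  show "tmult \<kappa> (tmult \<kappa> A B) C w = tmult \<kappa> A (tmult \<kappa> B C) w"
  proof (cases "length w \<le> \<kappa>")
    case True
    have "conv (tmult \<kappa> A B) C w = conv (conv A B) C w"
      by (rule conv_cong) (use True in \<open>auto simp: tmult_conv\<close>)
    moreover have "conv A (tmult \<kappa> B C) w = conv A (conv B C) w"
      by (rule conv_cong) (use True in \<open>auto simp: tmult_conv\<close>)
    ultimately show ?thesis using True by (simp add: tmult_conv conv_assoc)
  qed (simp add: tmult_conv)
qed

lemma tmult_lin_left:
  "tmult \<kappa> (\<lambda>w. a * A w + b * A' w) B = (\<lambda>w. a * tmult \<kappa> A B w + b * tmult \<kappa> A' B w)"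
  by (auto simp: tmult_conv conv_lin_left)

lemma tmult_lin_right:
  "tmult \<kappa> A (\<lambda>w. a * B w + b * B' w) = (\<lambda>w. a * tmult \<kappa> A B w + b * tmult \<kappa> A B' w)"
  by (auto simp: tmult_conv conv_lin_right)

lemma tmult_in_tensor_alg [simp]: "tmult \<kappa> A B \<in> tensor_alg \<kappa>"
  by (simp add: tensor_alg_def tmult_conv)

lemma tone_in_tensor_alg [simp]: "tone \<in> tensor_alg \<kappa>"
  by (auto simp: tensor_alg_def tone_def)

lemma conv_tone_left: "conv tone A w = A w"
proof -
  have "conv tone A w = (\<Sum>i\<le>length w. if i = 0 then A w else 0)"
    unfolding conv_def by (rule sum.cong) (auto simp: tone_def)
  then show ?thesis by simp
qed

lemma conv_tone_right: "conv A tone w = A w"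
proof -
  have "conv A tone w = (\<Sum>i\<le>length w. if i = length w then A w else 0)"
    unfolding conv_def by (rule sum.cong) (auto simp: tone_def)
  then show ?thesis by simp
qed

lemma tmult_tone_left: "A \<in> tensor_alg \<kappa> \<Longrightarrow> tmult \<kappa> tone A = A"
  by (force simp: tensor_alg_def tmult_conv conv_tone_left)

lemma tmult_tone_right: "A \<in> tensor_alg \<kappa> \<Longrightarrow> tmult \<kappa> A tone = A"
  by (force simp: tensor_alg_def tmult_conv conv_tone_right)

lemma tmult_Nil [simp]: "tmult \<kappa> A B [] = A [] * B []"
  by (simp add: tmult_conv)

lemma tmult_sum_right: "tmult \<kappa> A (\<lambda>w. \<Sum>k\<in>S. c k * F k w) w = (\<Sum>k\<in>S. c k * tmult \<kappa> A (F k) w)"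
  by (simp add: tmult_conv conv_def sum_distrib_left) (subst sum.swap, simp add: algebra_simps)

lemma tmult_sum_left: "tmult \<kappa> (\<lambda>w. \<Sum>k\<in>S. c k * F k w) A w = (\<Sum>k\<in>S. c k * tmult \<kappa> (F k) A w)"
  by (simp add: tmult_conv conv_def sum_distrib_left sum_distrib_right)
    (subst sum.swap, simp add: algebra_simps)

section \<open>The truncated exponential and its inverse\<close>

lemma tpower_in_tensor_alg [simp]: "tpower \<kappa> A n \<in> tensor_alg \<kappa>"
  by (cases n) auto

lemma tpower_commute: "A \<in> tensor_alg \<kappa> \<Longrightarrow> tmult \<kappa> (tpower \<kappa> A n) A = tmult \<kappa> A (tpower \<kappa> A n)"
  by (induction n) (auto simp: tmult_tone_left tmult_tone_right tmult_assoc)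

lemma tpower_scale: "tpower \<kappa> (\<lambda>w. r * A w) n = (\<lambda>w. r ^ n * tpower \<kappa> A n w)"
proof (induction n)
  case (Suc n)
  show ?case
    using tmult_lin_left[of \<kappa> r A 0 A] tmult_lin_right[of \<kappa> A "r ^ n" "tpower \<kappa> A n" 0 A]
    by (simp add: Suc fun_eq_iff mult.assoc)
qed simp

text \<open>
  A factor without constant term uses up at least one letter of the word.
\<close>

lemma tpower_eq_0:
  assumes "A [] = 0" "length w < n"
  shows "tpower \<kappa> A n w = 0"
  using assms(2)
proof (induction n arbitrary: w)
  case (Suc n)
  have "A (take i w) * tpower \<kappa> A n (drop i w) = 0" if "i \<le> length w" for i
  proof (cases "i = 0")
    case False
    then show ?thesis using Suc that by (cases "w = []") auto
  qed (use assms in auto)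
  then show ?case by (auto simp: tmult_conv conv_def intro!: sum.neutral)
qed simp

lemma texp_in_tensor_alg [simp]: "texp \<kappa> A \<in> tensor_alg \<kappa>"
  using tpower_in_tensor_alg[of \<kappa> A] by (auto simp: tensor_alg_def texp_def)

lemma texp_Nil [simp]: assumes "A [] = 0" shows "texp \<kappa> A [] = 1"
proof -
  have "texp \<kappa> A [] = (\<Sum>k\<le>\<kappa>. if k = 0 then 1 else 0)"
    unfolding texp_def by (rule sum.cong) (use tpower_eq_0[of A "[]" _ \<kappa>] assms in \<open>auto simp: tone_def\<close>)
  then show ?thesis by simp
qed

lemma texp_zero: "texp \<kappa> (\<lambda>_. 0) = tone"
proof
  fix w :: "'a list"
  have "tpower \<kappa> (\<lambda>_. 0) k w = (if k = 0 then tone w else 0)" for k :: nat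
    by (cases k) (auto simp: tmult_conv conv_def)
  then show "texp \<kappa> (\<lambda>_. 0) w = tone w" by (simp add: texp_def if_distrib[of "\<lambda>x. x / _"] cong: if_cong)
qed

lemma texp_scale: "texp \<kappa> (\<lambda>w. r * A w) w = (\<Sum>k\<le>\<kappa>. (r ^ k / fact k) * tpower \<kappa> A k w)"
  by (simp add: texp_def tpower_scale)

lemma texp_commute:
  assumes "A \<in> tensor_alg \<kappa>"
  shows "tmult \<kappa> (texp \<kappa> (\<lambda>w. r * A w)) A = tmult \<kappa> A (texp \<kappa> (\<lambda>w. r * A w))"
proof -
  have eq: "texp \<kappa> (\<lambda>w. r * A w) = (\<lambda>w. \<Sum>k\<le>\<kappa>. (r ^ k / fact k) * tpower \<kappa> A k w)"
    by (rule ext) (rule texp_scale)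
  show ?thesis
    unfolding eq fun_eq_iff tmult_sum_left tmult_sum_right tpower_commute[OF assms] by simp
qed

text \<open>
  Differentiation turns the truncated exponential series into \<open>A\<close> times the series without its
  last term. That last term contributes the power \<open>\<kappa> + 1\<close> of \<open>A\<close>, which is zero because \<open>A\<close> has no
  constant term.
\<close>

lemma has_derivative_texp:
  assumes "A [] = 0"
  shows "((\<lambda>r. texp \<kappa> (\<lambda>w. r * A w) w) has_real_derivative tmult \<kappa> A (texp \<kappa> (\<lambda>w. r * A w)) w) (at r)"
proof (cases "length w \<le> \<kappa>")
  case True
  have "((\<lambda>r. \<Sum>k\<le>\<kappa>. (r ^ k / fact k) * tpower \<kappa> A k w) has_real_derivative
      (\<Sum>k\<le>\<kappa>. (real k * r ^ (k - 1) / fact k) * tpower \<kappa> A k w)) (at r)"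
    by (auto intro!: derivative_eq_intros sum.cong)
  moreover have "(\<Sum>k\<le>\<kappa>. (real k * r ^ (k - 1) / fact k) * tpower \<kappa> A k w)
      = (\<Sum>k<\<kappa>. (r ^ k / fact k) * tpower \<kappa> A (Suc k) w)"
    unfolding atLeast0AtMost[symmetric] sum.atLeast0_atMost_Suc_shift
  proof (cases \<kappa>)
    case (Suc n)
    have "(\<Sum>k\<le>\<kappa>. (real k * r ^ (k - 1) / fact k) * tpower \<kappa> A k w)
        = (\<Sum>k\<le>n. (real (Suc k) * r ^ k / fact (Suc k)) * tpower \<kappa> A (Suc k) w)"
      unfolding Suc by (subst sum.atMost_Suc_shift) simp
    also have "\<dots> = (\<Sum>k\<le>n. (r ^ k / fact k) * tpower \<kappa> A (Suc k) w)"
    proof (rule sum.cong[OF refl])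
      fix k
      have "real (Suc k) * r ^ k / fact (Suc k) = r ^ k / fact k" by (simp del: of_nat_Suc)
      then show "real (Suc k) * r ^ k / fact (Suc k) * tpower \<kappa> A (Suc k) w
        = r ^ k / fact k * tpower \<kappa> A (Suc k) w" by metis
    qed
    finally show "(\<Sum>k=0..\<kappa>. (real k * r ^ (k - 1) / fact k) * tpower \<kappa> A k w)
      = (\<Sum>k<\<kappa>. (r ^ k / fact k) * tpower \<kappa> A (Suc k) w)"
      by (simp only: Suc lessThan_Suc_atMost atLeast0AtMost)
  qed simp
  moreover have "tmult \<kappa> A (texp \<kappa> (\<lambda>w. r * A w)) w = (\<Sum>k<\<kappa>. (r ^ k / fact k) * tpower \<kappa> A (Suc k) w)"
  proof -
    have eq: "texp \<kappa> (\<lambda>w. r * A w) = (\<lambda>w. \<Sum>k\<le>\<kappa>. (r ^ k / fact k) * tpower \<kappa> A k w)"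
      by (rule ext) (rule texp_scale)
    show ?thesis
      using tpower_eq_0[of A w "Suc \<kappa>" \<kappa>] assms True
      unfolding eq tmult_sum_right by (simp add: lessThan_Suc_atMost[symmetric])
  qed
  ultimately show ?thesis by (simp add: texp_scale)
qed (use texp_in_tensor_alg[of \<kappa> "\<lambda>w. _ * A w"] in \<open>simp add: tensor_alg_def tmult_conv\<close>)

text \<open>
  The product of the exponentials of \<open>- r A\<close> and \<open>r A\<close> has derivative zero in \<open>r\<close>, since \<open>A\<close> commutes
  with its exponentials, and it is the unit for \<open>r = 0\<close>.
\<close>

lemma texp_inverse:
  assumes A: "A \<in> tensor_alg \<kappa>" "A [] = 0"
  shows "tmult \<kappa> (texp \<kappa> (\<lambda>w. - A w)) (texp \<kappa> A) = tone"
proof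
  fix w :: "'a list"
  define F where "F r = tmult \<kappa> (texp \<kappa> (\<lambda>w. - r * A w)) (texp \<kappa> (\<lambda>w. r * A w)) w" for r
  show "tmult \<kappa> (texp \<kappa> (\<lambda>w. - A w)) (texp \<kappa> A) w = tone w"
  proof (cases "length w \<le> \<kappa>")
    case True
    have "(F has_real_derivative 0) (at r)" for r
    proof -
      have d: "((\<lambda>r. texp \<kappa> (\<lambda>w. - r * A w) u) has_real_derivative
          - tmult \<kappa> A (texp \<kappa> (\<lambda>w. - r * A w)) u) (at r)" for u
        using has_derivative_texp[of A \<kappa> u "- r"] A(2) by (simp add: DERIV_mirror)
      have "(F has_real_derivative (\<Sum>i\<le>length w. - tmult \<kappa> A (texp \<kappa> (\<lambda>w. - r * A w)) (take i w)
            * texp \<kappa> (\<lambda>w. r * A w) (drop i w)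
          + tmult \<kappa> A (texp \<kappa> (\<lambda>w. r * A w)) (drop i w) * texp \<kappa> (\<lambda>w. - r * A w) (take i w))) (at r)"
        using True unfolding F_def tmult_def[of \<kappa> "texp _ _"]
        using DERIV_mult[OF d has_derivative_texp[of A, OF A(2)]]
        by (simp only: if_True) (intro DERIV_sum)
      also have "(\<Sum>i\<le>length w. - tmult \<kappa> A (texp \<kappa> (\<lambda>w. - r * A w)) (take i w)
            * texp \<kappa> (\<lambda>w. r * A w) (drop i w)
          + tmult \<kappa> A (texp \<kappa> (\<lambda>w. r * A w)) (drop i w) * texp \<kappa> (\<lambda>w. - r * A w) (take i w))
        = - tmult \<kappa> (tmult \<kappa> A (texp \<kappa> (\<lambda>w. - r * A w))) (texp \<kappa> (\<lambda>w. r * A w)) w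
          + tmult \<kappa> (texp \<kappa> (\<lambda>w. - r * A w)) (tmult \<kappa> A (texp \<kappa> (\<lambda>w. r * A w))) w"
        using True by (simp add: tmult_conv[of _ _ _ w] conv_def sum.distrib sum_negf sum_subtractf mult.commute)
      also have "\<dots> = 0"
        using texp_commute[OF A(1), of "- r"] by (simp add: tmult_assoc[symmetric])
      finally show ?thesis .
    qed
    then have "F 1 = F 0" by (metis DERIV_isconst_all)
    then show ?thesis by (simp add: F_def texp_zero tmult_tone_left)
  qed (auto simp: tmult_conv tone_def)
qed

lemma tinverse_texp:
  assumes A: "A \<in> tensor_alg \<kappa>" "A [] = 0"
  shows "tinverse \<kappa> (texp \<kappa> A) = texp \<kappa> (\<lambda>w. - A w)"
  unfolding tinverse_def
proof (rule the_equality)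
  have m: "(\<lambda>w. - A w) \<in> tensor_alg \<kappa>" using A by (simp add: tensor_alg_def)
  show *: "texp \<kappa> (\<lambda>w. - A w) \<in> tensor_alg \<kappa> \<and> tmult \<kappa> (texp \<kappa> A) (texp \<kappa> (\<lambda>w. - A w)) = tone
      \<and> tmult \<kappa> (texp \<kappa> (\<lambda>w. - A w)) (texp \<kappa> A) = tone"
    using texp_inverse[OF A] texp_inverse[OF m] A by simp
  fix B assume "B \<in> tensor_alg \<kappa> \<and> tmult \<kappa> (texp \<kappa> A) B = tone \<and> tmult \<kappa> B (texp \<kappa> A) = tone"
  then show "B = texp \<kappa> (\<lambda>w. - A w)"
    using * tmult_assoc by (metis tmult_tone_left tmult_tone_right)
qed

text \<open>
  In a product of two or more factors without constant term every factor is evaluated at proper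
  subwords only. Hence the exponential is triangular: up to higher powers, which depend on lower
  degrees, it is the identity. Injectivity of the exponential and bounds for the logarithm both
  follow by induction on the degree.
\<close>

lemma tpower_local:
  assumes nil: "A [] = 0" "B [] = 0" and eq: "\<And>u. length u < n \<Longrightarrow> A u = B u"
    and "k \<ge> 2" "length w \<le> n"
  shows "tpower \<kappa> A k w = tpower \<kappa> B k w"
proof -
  have short: "tpower \<kappa> A k u = tpower \<kappa> B k u" if "length u < n" for k u
    using that
  proof (induction k arbitrary: u)
    case (Suc k)
    have "conv A (tpower \<kappa> A k) u = conv B (tpower \<kappa> B k) u"
      by (rule conv_cong) (use Suc in \<open>auto intro: eq\<close>)
    then show ?case by (simp add: tmult_conv)
  qed simp
  obtain j where k: "k = Suc (Suc j)" using le_Suc_ex[OF \<open>k \<ge> 2\<close>] by auto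
  have "A (take i w) * tpower \<kappa> A (Suc j) (drop i w) = B (take i w) * tpower \<kappa> B (Suc j) (drop i w)"
    if "i \<le> length w" for i
  proof (cases "0 < i \<and> i < length w")
    case True
    then have "length (take i w) < n" "length (drop i w) < n" using \<open>length w \<le> n\<close> by auto
    then show ?thesis using eq[of "take i w"] short[of "drop i w" "Suc j"] by metis
  next
    case False
    then show ?thesis using that nil by auto
  qed
  then show ?thesis unfolding k tpower.simps(2)[of _ _ "Suc j"] tmult_conv conv_def by simp
qed

lemma texp_split:
  assumes "length w \<ge> 1" "length w \<le> \<kappa>"
  shows "texp \<kappa> A w = A w + (\<Sum>k\<in>{2..\<kappa>}. tpower \<kappa> A k w / fact k)"
proof -
  have "{..\<kappa>} = insert 0 (insert 1 {2..\<kappa>})" using assms by auto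
  moreover have "tmult \<kappa> A tone w = A w" using assms by (simp add: tmult_conv conv_tone_right)
  moreover have "tone w = 0" using assms by (auto simp: tone_def)
  ultimately show ?thesis by (simp add: texp_def)
qed

lemma texp_inj:
  assumes "A \<in> tensor_alg \<kappa>" "B \<in> tensor_alg \<kappa>" "A [] = 0" "B [] = 0" "texp \<kappa> A = texp \<kappa> B"
  shows "A = B"
proof
  fix w
  show "A w = B w"
  proof (induction "length w" arbitrary: w rule: less_induct)
    case less
    show ?case
    proof (cases "1 \<le> length w \<and> length w \<le> \<kappa>")
      case True
      have "tpower \<kappa> A k w = tpower \<kappa> B k w" if "k \<ge> 2" for k
        by (rule tpower_local[where n = "length w"]) (use assms less that in auto)
      then have "(\<Sum>k\<in>{2..\<kappa>}. tpower \<kappa> A k w / fact k) = (\<Sum>k\<in>{2..\<kappa>}. tpower \<kappa> B k w / fact k)"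
        by (intro sum.cong) auto
      then show ?thesis using True assms(5) texp_split[of w \<kappa> A] texp_split[of w \<kappa> B] by simp
    qed (use assms in \<open>cases w; auto simp: tensor_alg_def\<close>)
  qed
qed

section \<open>Homogeneous bounds\<close>

text \<open>
  The scaling of rough path increments: a coefficient of degree \<open>j\<close> is of order \<open>\<rho>\<^sup>j\<close>, where \<open>\<rho>\<close> stands
  for \<open>\<bar>t - s\<bar> powr \<alpha>\<close>.
\<close>

definition hom_bound :: "nat \<Rightarrow> real \<Rightarrow> real \<Rightarrow> 'd tensor \<Rightarrow> bool" where
  "hom_bound \<kappa> \<rho> a A \<longleftrightarrow> (\<forall>w. length w \<le> \<kappa> \<longrightarrow> \<bar>A w\<bar> \<le> a * \<rho> ^ length w)"

lemma hom_bound_nonneg: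
  fixes A :: "'d tensor"
  assumes "hom_bound \<kappa> \<rho> a A"
  shows "0 \<le> a"
proof -
  have "\<bar>A []\<bar> \<le> a * \<rho> ^ length ([] :: 'd list)"
    by (rule assms[unfolded hom_bound_def, rule_format]) simp
  then show ?thesis by simp
qed

lemma hom_bound_tmult:
  assumes A: "hom_bound \<kappa> \<rho> a A" and B: "hom_bound \<kappa> \<rho> b B" and "\<rho> \<ge> 0"
  shows "hom_bound \<kappa> \<rho> (real (\<kappa> + 1) * a * b) (tmult \<kappa> A B)"
  unfolding hom_bound_def
proof (intro allI impI)
  fix w :: "'a list" assume w: "length w \<le> \<kappa>"
  have pos: "0 \<le> a" "0 \<le> b" using A B hom_bound_nonneg by auto
  have "\<bar>A (take i w) * B (drop i w)\<bar> \<le> a * b * \<rho> ^ length w" if "i \<le> length w" for i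
  proof -
    have "\<bar>A (take i w)\<bar> \<le> a * \<rho> ^ i"
      using A w that unfolding hom_bound_def by (metis (no_types, lifting) length_take min.absorb2 order_trans)
    moreover have "\<bar>B (drop i w)\<bar> \<le> b * \<rho> ^ (length w - i)"
      using B w that unfolding hom_bound_def by (metis (no_types, lifting) diff_le_self length_drop order_trans)
    ultimately have "\<bar>A (take i w) * B (drop i w)\<bar> \<le> (a * \<rho> ^ i) * (b * \<rho> ^ (length w - i))"
      unfolding abs_mult using pos \<open>\<rho> \<ge> 0\<close> by (intro mult_mono) auto
    also have "\<dots> = a * b * \<rho> ^ length w"
      using that by (simp add: power_add[symmetric])
    finally show ?thesis .
  qed
  then have "\<bar>conv A B w\<bar> \<le> (\<Sum>i\<le>length w. a * b * \<rho> ^ length w)"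
    unfolding conv_def by (intro order_trans[OF sum_abs] sum_mono) auto
  also have "\<dots> = real (length w + 1) * (a * b * \<rho> ^ length w)" by simp
  also have "\<dots> \<le> real (\<kappa> + 1) * (a * b * \<rho> ^ length w)"
    using w pos \<open>\<rho> \<ge> 0\<close> by (intro mult_right_mono) auto
  finally show "\<bar>tmult \<kappa> A B w\<bar> \<le> real (\<kappa> + 1) * a * b * \<rho> ^ length w"
    using w by (simp add: tmult_conv mult.assoc)
qed

lemma hom_bound_tpower:
  assumes A: "hom_bound \<kappa> \<rho> a A" and "\<rho> \<ge> 0"
  shows "hom_bound \<kappa> \<rho> ((real (\<kappa> + 1) * a) ^ k) (tpower \<kappa> A k)"
proof (induction k)
  case (Suc k)
  show ?case using hom_bound_tmult[OF A Suc \<open>\<rho> \<ge> 0\<close>] by (simp add: mult.assoc)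
qed (auto simp: hom_bound_def tone_def \<open>\<rho> \<ge> 0\<close>)

lemma hom_bound_texp:
  assumes A: "hom_bound \<kappa> \<rho> a A" and "\<rho> \<ge> 0" and "\<bar>r\<bar> \<le> 1"
  shows "hom_bound \<kappa> \<rho> (\<Sum>k\<le>\<kappa>. (real (\<kappa> + 1) * a) ^ k) (texp \<kappa> (\<lambda>w. r * A w))"
  unfolding hom_bound_def
proof (intro allI impI)
  fix w :: "'a list" assume w: "length w \<le> \<kappa>"
  have "\<bar>(r ^ k / fact k) * tpower \<kappa> A k w\<bar> \<le> (real (\<kappa> + 1) * a) ^ k * \<rho> ^ length w" for k
  proof -
    have "\<bar>r ^ k / fact k\<bar> \<le> 1"
      using power_le_one[of "\<bar>r\<bar>" k] \<open>\<bar>r\<bar> \<le> 1\<close> fact_ge_1[of k, where 'a = real]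
      by (simp add: power_abs divide_le_eq_1 order_trans[OF _ fact_ge_1])
    then have "\<bar>(r ^ k / fact k) * tpower \<kappa> A k w\<bar> \<le> 1 * \<bar>tpower \<kappa> A k w\<bar>"
      unfolding abs_mult by (rule mult_right_mono) simp
    also have "\<dots> \<le> (real (\<kappa> + 1) * a) ^ k * \<rho> ^ length w"
      using hom_bound_tpower[OF A \<open>\<rho> \<ge> 0\<close>, of k] w by (simp add: hom_bound_def)
    finally show ?thesis .
  qed
  then show "\<bar>texp \<kappa> (\<lambda>w. r * A w) w\<bar> \<le> (\<Sum>k\<le>\<kappa>. (real (\<kappa> + 1) * a) ^ k) * \<rho> ^ length w"
    unfolding texp_scale sum_distrib_right by (intro order_trans[OF sum_abs] sum_mono) auto
qed

text \<open>
  By the triangular form of the exponential, a coefficient of the logarithm is a coefficient of the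
  exponential minus powers of the part of lower degree, and products respect the scaling. The
  constant depends on \<open>\<kappa>\<close> only, so it serves all increments of a rough path at once.
\<close>

lemma hom_bound_log:
  fixes \<kappa> :: nat
  shows "\<exists>a. \<forall>\<rho> (A :: 'd tensor). \<rho> \<ge> 0 \<and> A \<in> tensor_alg \<kappa> \<and> A [] = 0 \<and> hom_bound \<kappa> \<rho> 1 (texp \<kappa> A)
    \<longrightarrow> hom_bound \<kappa> \<rho> a A"
proof -
  have "\<exists>a. \<forall>\<rho> (A :: 'd tensor). \<rho> \<ge> 0 \<and> A \<in> tensor_alg \<kappa> \<and> A [] = 0 \<and> hom_bound \<kappa> \<rho> 1 (texp \<kappa> A)
    \<longrightarrow> (\<forall>w. length w \<le> n \<longrightarrow> \<bar>A w\<bar> \<le> a * \<rho> ^ length w)" for n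
  proof (induction n)
    case 0
    show ?case by (rule exI[of _ 0]) auto
  next
    case (Suc n)
    then obtain a where a: "\<And>\<rho> (A :: 'd tensor) w. \<rho> \<ge> 0 \<Longrightarrow> A \<in> tensor_alg \<kappa> \<Longrightarrow> A [] = 0
      \<Longrightarrow> hom_bound \<kappa> \<rho> 1 (texp \<kappa> A) \<Longrightarrow> length w \<le> n \<Longrightarrow> \<bar>A w\<bar> \<le> a * \<rho> ^ length w"
      by blast
    define b where "b = 1 + (\<Sum>k\<in>{2..\<kappa>}. (real (\<kappa> + 1) * \<bar>a\<bar>) ^ k)"
    have b0: "b \<ge> 0" unfolding b_def by (intro add_nonneg_nonneg sum_nonneg) auto
    have "\<bar>A w\<bar> \<le> max \<bar>a\<bar> b * \<rho> ^ length w"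
      if A: "\<rho> \<ge> 0" "A \<in> tensor_alg \<kappa>" "A [] = 0" "hom_bound \<kappa> \<rho> 1 (texp \<kappa> A)"
        and w: "length w \<le> Suc n" for \<rho> and A :: "'d tensor" and w
    proof -
      have pos: "\<rho> ^ k \<ge> 0" for k using A by simp
      consider "length w \<le> n" | "length w > \<kappa>" | "length w = Suc n" "length w \<le> \<kappa>" using w by linarith
      then show ?thesis
      proof cases
        case 1
        then have "\<bar>A w\<bar> \<le> a * \<rho> ^ length w" using a A by blast
        also have "\<dots> \<le> max \<bar>a\<bar> b * \<rho> ^ length w" by (rule mult_right_mono) (use pos in auto)
        finally show ?thesis .
      next
        case 2
        then show ?thesis using A(1,2) b0 by (simp add: tensor_alg_def)
      next
        case 3
        \<comment> \<open>Powers with exponent at least two only see the components of degree at most \<open>n\<close>.\<close>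
        define A' where "A' u = (if length u < Suc n then A u else 0)" for u
        have A': "hom_bound \<kappa> \<rho> \<bar>a\<bar> A'"
          unfolding hom_bound_def
        proof (intro allI impI)
          fix u :: "'d list"
          have "\<bar>A' u\<bar> \<le> (if length u < Suc n then a * \<rho> ^ length u else 0)"
            using a[OF A, of u] by (simp add: A'_def)
          also have "\<dots> \<le> \<bar>a\<bar> * \<rho> ^ length u" using pos by (auto intro: mult_right_mono)
          finally show "\<bar>A' u\<bar> \<le> \<bar>a\<bar> * \<rho> ^ length u" .
        qed
        have "tpower \<kappa> A k w = tpower \<kappa> A' k w" if "k \<ge> 2" for k
          by (rule tpower_local[where n = "Suc n"]) (use A(3) w that in \<open>auto simp: A'_def\<close>)
        moreover have "\<bar>tpower \<kappa> A' k w / fact k\<bar> \<le> (real (\<kappa> + 1) * \<bar>a\<bar>) ^ k * \<rho> ^ length w" for k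
        proof -
          have "\<bar>tpower \<kappa> A' k w / fact k\<bar> = \<bar>tpower \<kappa> A' k w\<bar> / fact k"
            by simp
          also have "\<dots> \<le> \<bar>tpower \<kappa> A' k w\<bar> / 1"
            by (rule divide_left_mono) (auto simp: fact_ge_1)
          also have "\<dots> \<le> (real (\<kappa> + 1) * \<bar>a\<bar>) ^ k * \<rho> ^ length w"
            using hom_bound_tpower[OF A' A(1), of k] 3(2) unfolding hom_bound_def div_by_1 by blast
          finally show ?thesis .
        qed
        ultimately have "\<bar>\<Sum>k\<in>{2..\<kappa>}. tpower \<kappa> A k w / fact k\<bar>
            \<le> (\<Sum>k\<in>{2..\<kappa>}. (real (\<kappa> + 1) * \<bar>a\<bar>) ^ k * \<rho> ^ length w)"
          by (intro order_trans[OF sum_abs] sum_mono) auto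
        moreover have "\<bar>texp \<kappa> A w\<bar> \<le> \<rho> ^ length w"
          using A(4) 3(2) unfolding hom_bound_def mult_1 by blast
        ultimately have "\<bar>A w\<bar> \<le> b * \<rho> ^ length w"
          using texp_split[of w \<kappa> A] 3 by (simp add: b_def algebra_simps sum_distrib_left)
        also have "\<dots> \<le> max \<bar>a\<bar> b * \<rho> ^ length w" by (rule mult_right_mono) (use pos in auto)
        finally show ?thesis .
      qed
    qed
    then show ?case by blast
  qed
  from this[of \<kappa>] show ?thesis unfolding hom_bound_def .
qed

section \<open>The Lie algebra is spanned by nested brackets\<close>

lemma tbracket_lin_left:
  "tbracket \<kappa> (\<lambda>w. a * A w + b * A' w) B = (\<lambda>w. a * tbracket \<kappa> A B w + b * tbracket \<kappa> A' B w)"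
  by (simp add: tbracket_def tmult_lin_left tmult_lin_right algebra_simps)

lemma tbracket_lin_right:
  "tbracket \<kappa> B (\<lambda>w. a * A w + b * A' w) = (\<lambda>w. a * tbracket \<kappa> B A w + b * tbracket \<kappa> B A' w)"
  by (simp add: tbracket_def tmult_lin_left tmult_lin_right algebra_simps)

lemma tbracket_jacobi:
  "tbracket \<kappa> (tbracket \<kappa> A B) C w = tbracket \<kappa> A (tbracket \<kappa> B C) w - tbracket \<kappa> B (tbracket \<kappa> A C) w"
proof -
  have l: "tmult \<kappa> (\<lambda>w. P w - Q w) R = (\<lambda>w. tmult \<kappa> P R w - tmult \<kappa> Q R w)"
    and r: "tmult \<kappa> R (\<lambda>w. P w - Q w) = (\<lambda>w. tmult \<kappa> R P w - tmult \<kappa> R Q w)" for P Q R :: "'a tensor"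
    using tmult_lin_left[of \<kappa> 1 P "-1" Q R] tmult_lin_right[of \<kappa> R 1 P "-1" Q] by simp_all
  show ?thesis by (simp add: tbracket_def l r tmult_assoc)
qed

lemma ad_word_homogeneous: "length w \<noteq> length as \<Longrightarrow> ad_word \<kappa> as w = 0"
proof (induction \<kappa> as arbitrary: w rule: ad_word.induct)
  case (2 \<kappa> a)
  then show ?case by (auto simp: tvector_def split: list.splits)
next
  case (3 \<kappa> a b as)
  have "tvector a u * ad_word \<kappa> (b # as) v = 0 \<and> ad_word \<kappa> (b # as) u * tvector a v = 0"
    if "u @ v = w" for u v
  proof (cases "length u = 1 \<and> length v = length (b # as) \<or> length v = 1 \<and> length u = length (b # as)")
    case True
    then show ?thesis using 3(2) that by auto
  next
    case False
    then have "tvector a u = 0 \<or> ad_word \<kappa> (b # as) v = 0" "ad_word \<kappa> (b # as) u = 0 \<or> tvector a v = 0"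
      using 3(1)[of u] 3(1)[of v] by (auto simp: tvector_def split: list.splits)
    then show ?thesis by auto
  qed
  then have "tvector a (take i w) * ad_word \<kappa> (b # as) (drop i w) = 0"
    "ad_word \<kappa> (b # as) (take i w) * tvector a (drop i w) = 0" for i
    using append_take_drop_id by blast+
  then have "conv (tvector a) (ad_word \<kappa> (b # as)) w = 0" "conv (ad_word \<kappa> (b # as)) (tvector a) w = 0"
    unfolding conv_def by (simp_all only: sum.neutral_const)
  then show ?case by (simp add: tbracket_def tmult_conv)
qed simp

lemma ad_word_long:
  assumes "length as > \<kappa>" "length as \<ge> 2" shows "ad_word \<kappa> as = (\<lambda>_. 0)"
proof
  fix w
  obtain a b bs where as: "as = a # b # bs" using assms by (metis Suc_le_length_iff numeral_2_eq_2)
  show "ad_word \<kappa> as w = 0"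
    using ad_word_homogeneous[of w as \<kappa>] assms unfolding as
    by (cases "length w = length as") (auto simp: tbracket_def tmult_conv as)
qed

text \<open>
  The linear span of the nested brackets on which the map from tensors to vector fields is
  prescribed.
\<close>

inductive_set ad_span :: "nat \<Rightarrow> ('d::finite) tensor set" for \<kappa> where
  word: "1 \<le> length as \<Longrightarrow> length as \<le> \<kappa> \<Longrightarrow> ad_word \<kappa> as \<in> ad_span \<kappa>"
| zero: "(\<lambda>_. 0) \<in> ad_span \<kappa>"
| lin: "A \<in> ad_span \<kappa> \<Longrightarrow> B \<in> ad_span \<kappa> \<Longrightarrow> (\<lambda>w. r * A w + s * B w) \<in> ad_span \<kappa>"

lemma ad_span_bracket_tvector:
  assumes "A \<in> ad_span \<kappa>"
  shows "tbracket \<kappa> (tvector a) A \<in> ad_span \<kappa>"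
  using assms
proof (induction rule: ad_span.induct)
  case (word as)
  then obtain b bs where as: "as = b # bs" by (cases as) auto
  then have eq: "tbracket \<kappa> (tvector a) (ad_word \<kappa> as) = ad_word \<kappa> (a # as)" by simp
  show ?case
  proof (cases "length (a # as) \<le> \<kappa>")
    case False
    then have "ad_word \<kappa> (a # as) = (\<lambda>_. 0)" by (intro ad_word_long) (auto simp: as)
    then show ?thesis unfolding eq by (simp add: ad_span.zero)
  qed (unfold eq, rule ad_span.word, auto)
next
  case zero
  show ?case by (simp add: tbracket_def tmult_conv conv_def ad_span.zero cong: if_cong)
next
  case (lin A B r s)
  then show ?case unfolding tbracket_lin_right by (intro ad_span.lin)
qed

text \<open>
  The Jacobi identity in the form \<open>[[a, B], C] = [a, [B, C]] - [B, [a, C]]\<close> shortens the left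
  factor until it is a single vector.
\<close>

lemma ad_span_bracket_ad_word:
  assumes "C \<in> ad_span \<kappa>" "as \<noteq> []"
  shows "tbracket \<kappa> (ad_word \<kappa> as) C \<in> ad_span \<kappa>"
  using assms(2,1)
proof (induction as arbitrary: C rule: list_nonempty_induct)
  case (single a)
  then show ?case by (simp add: ad_span_bracket_tvector)
next
  case (cons a as)
  then obtain b bs where as: "as = b # bs" by (cases as) auto
  have "tbracket \<kappa> (ad_word \<kappa> (a # as)) C
    = (\<lambda>w. 1 * tbracket \<kappa> (tvector a) (tbracket \<kappa> (ad_word \<kappa> as) C) w
         + - 1 * tbracket \<kappa> (ad_word \<kappa> as) (tbracket \<kappa> (tvector a) C) w)"
    unfolding as by (simp add: fun_eq_iff tbracket_jacobi)
  moreover have "\<dots> \<in> ad_span \<kappa>"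
    by (intro ad_span.lin ad_span_bracket_tvector cons.IH cons.prems)
  ultimately show ?case by simp
qed

lemma ad_span_bracket:
  assumes "A \<in> ad_span \<kappa>" "C \<in> ad_span \<kappa>"
  shows "tbracket \<kappa> A C \<in> ad_span \<kappa>"
  using assms(1)
proof (induction rule: ad_span.induct)
  case (word as)
  then show ?case by (intro ad_span_bracket_ad_word assms) auto
next
  case zero
  show ?case by (simp add: tbracket_def tmult_conv conv_def ad_span.zero cong: if_cong)
next
  case (lin A B r s)
  then show ?case unfolding tbracket_lin_left by (intro ad_span.lin)
qed

lemma lie_alg_subset_ad_span:
  assumes "\<kappa> \<ge> 1" "A \<in> lie_alg \<kappa>"
  shows "A \<in> ad_span \<kappa>"
  using assms(2)
proof (induction rule: lie_alg.induct)
  case (vector a)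
  show ?case using ad_span.word[of "[a]" \<kappa>] assms by simp
next
  case (add A B)
  then show ?case using ad_span.lin[of A \<kappa> B 1 1] by simp
next
  case (scale A r)
  then show ?case using ad_span.lin[of A \<kappa> A r 0] by simp
next
  case (bracket A B)
  then show ?case by (intro ad_span_bracket assms)
qed

lemma lie_alg_lin: "A \<in> lie_alg \<kappa> \<Longrightarrow> B \<in> lie_alg \<kappa> \<Longrightarrow> (\<lambda>w. r * A w + s * B w) \<in> lie_alg \<kappa>"
  using lie_alg.add[OF lie_alg.scale[of A \<kappa> r] lie_alg.scale[of B \<kappa> s]] by simp

lemma ad_word_in_lie_alg: "as \<noteq> [] \<Longrightarrow> ad_word \<kappa> as \<in> lie_alg \<kappa>"
  by (induction \<kappa> as rule: ad_word.induct) (auto intro: lie_alg.intros)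

lemma zero_in_lie_alg: "(\<lambda>_. 0) \<in> lie_alg \<kappa>"
  using lie_alg.scale[OF lie_alg.vector[of 0 \<kappa>], of 0] by simp

lemma ad_span_subset_lie_alg: "A \<in> ad_span \<kappa> \<Longrightarrow> A \<in> lie_alg \<kappa>"
proof (induction rule: ad_span.induct)
  case (word as)
  then show ?case by (intro ad_word_in_lie_alg) auto
qed (auto intro: zero_in_lie_alg lie_alg_lin)

lemma lie_alg_in_tensor_alg:
  assumes "\<kappa> \<ge> 1" "A \<in> lie_alg \<kappa>"
  shows "A \<in> tensor_alg \<kappa>"
  using assms(2)
proof (induction rule: lie_alg.induct)
  case (vector a)
  then show ?case using assms(1) by (auto simp: tensor_alg_def tvector_def split: list.splits)
qed (auto simp: tensor_alg_def tbracket_def tmult_conv)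

lemma lie_alg_Nil:
  assumes "A \<in> lie_alg \<kappa>"
  shows "A [] = 0"
  using assms by (induction rule: lie_alg.induct) (auto simp: tvector_def tbracket_def)

lemma lie_alg_uminus: "A \<in> lie_alg \<kappa> \<Longrightarrow> (\<lambda>w. - A w) \<in> lie_alg \<kappa>"
  using lie_alg.scale[of A \<kappa> "-1"] by simp

lemma tlog_texp:
  fixes A :: "('a::finite) tensor"
  assumes "\<kappa> \<ge> 1" "A \<in> lie_alg \<kappa>"
  shows "tlog \<kappa> (texp \<kappa> A) = A"
proof -
  have "inj_on (texp \<kappa>) (lie_alg \<kappa> :: 'a tensor set)"
  proof (rule inj_onI)
    fix B C :: "'a tensor"
    assume "B \<in> lie_alg \<kappa>" "C \<in> lie_alg \<kappa>" "texp \<kappa> B = texp \<kappa> C"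
    then show "B = C"
      using texp_inj[of B \<kappa> C] lie_alg_in_tensor_alg[OF assms(1)] lie_alg_Nil by blast
  qed
  then show ?thesis unfolding tlog_def using assms(2) by (rule the_inv_into_f_f)
qed

section \<open>Smooth functions on open sets\<close>

lemma frechet_derivative_eq: "(f has_derivative D) (at x) \<Longrightarrow> frechet_derivative f (at x) v = D v"
  using frechet_derivative_at[of f D x] by simp

lemma k_smooth_on_cong_imp:
  assumes "open S" "\<And>x. x \<in> S \<Longrightarrow> f x = g x" "k_smooth_on n S f"
  shows "k_smooth_on n S g"
  using assms(2,3)
proof (induction n arbitrary: f g)
  case 0
  then show ?case using continuous_on_cong[of S S f g] by simp
next
  case (Suc n)
  have d: "g differentiable (at x)" if "x \<in> S" for x
  proof -
    have "(f has_derivative frechet_derivative f (at x)) (at x)"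
      using Suc.prems that by (simp add: frechet_derivative_works[symmetric])
    then have "(g has_derivative frechet_derivative f (at x)) (at x)"
      using Suc.prems that \<open>open S\<close> by (auto intro: has_derivative_transform_within_open)
    then show ?thesis by (auto simp: differentiable_def)
  qed
  have "k_smooth_on n S (\<lambda>x. frechet_derivative g (at x) v)" for v
  proof (rule Suc.IH)
    show "k_smooth_on n S (\<lambda>x. frechet_derivative f (at x) v)" using Suc.prems(2) by simp
    fix x assume x: "x \<in> S"
    have "frechet_derivative f (at x) = frechet_derivative g (at x)"
      by (rule frechet_derivative_transform_within_open[OF _ \<open>open S\<close> x Suc.prems(1)])
        (use Suc.prems(2) x in simp_all)
    then show "frechet_derivative f (at x) v = frechet_derivative g (at x) v" by simp
  qed
  then show ?case using d by simp
qed

lemma k_smooth_on_Suc_D: "k_smooth_on (Suc n) S f \<Longrightarrow> k_smooth_on n S f"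
proof (induction n arbitrary: f)
  case 0
  then show ?case
    by (auto intro!: continuous_at_imp_continuous_on differentiable_imp_continuous_within)
next
  case (Suc n)
  have "k_smooth_on n S (\<lambda>x. frechet_derivative f (at x) v)" for v
    by (rule Suc.IH) (use Suc.prems in simp)
  then show ?case using Suc.prems by simp
qed

lemma k_smooth_on_const [simp]: "k_smooth_on n S (\<lambda>_. c)"
  by (induction n arbitrary: c) auto

lemma k_smooth_on_add:
  assumes "open S" "k_smooth_on n S f" "k_smooth_on n S g"
  shows "k_smooth_on n S (\<lambda>x. f x + g x)"
  using assms(2,3)
proof (induction n arbitrary: f g)
  case 0
  then show ?case by (auto intro: continuous_on_add)
next
  case (Suc n)
  have "k_smooth_on n S (\<lambda>x. frechet_derivative (\<lambda>x. f x + g x) (at x) v)" for v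
  proof (rule k_smooth_on_cong_imp[OF \<open>open S\<close>])
    show "k_smooth_on n S (\<lambda>x. frechet_derivative f (at x) v + frechet_derivative g (at x) v)"
      using Suc.prems by (intro Suc.IH) auto
    fix x assume "x \<in> S"
    then have "f differentiable (at x)" "g differentiable (at x)" using Suc.prems by auto
    then have "((\<lambda>x. f x + g x) has_derivative
        (\<lambda>v. frechet_derivative f (at x) v + frechet_derivative g (at x) v)) (at x)"
      by (intro has_derivative_add) (auto simp: frechet_derivative_works[symmetric])
    then show "frechet_derivative f (at x) v + frechet_derivative g (at x) v
        = frechet_derivative (\<lambda>x. f x + g x) (at x) v"
      using frechet_derivative_eq by fastforce
  qed
  then show ?case using Suc.prems by auto
qed

lemma k_smooth_on_scaleR:
  assumes "open S" "k_smooth_on n S f" "k_smooth_on n S g"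
  shows "k_smooth_on n S (\<lambda>x. f x *\<^sub>R g x)"
  using assms(2,3)
proof (induction n arbitrary: f g)
  case 0
  then show ?case by (auto intro: continuous_on_scaleR)
next
  case (Suc n)
  have D: "((\<lambda>x. f x *\<^sub>R g x) has_derivative
        (\<lambda>v. f x *\<^sub>R frechet_derivative g (at x) v + frechet_derivative f (at x) v *\<^sub>R g x)) (at x)"
    if "x \<in> S" for x
    using that Suc.prems by (intro has_derivative_scaleR) (auto simp: frechet_derivative_works[symmetric])
  have "k_smooth_on n S (\<lambda>x. frechet_derivative (\<lambda>x. f x *\<^sub>R g x) (at x) v)" for v
  proof (rule k_smooth_on_cong_imp[OF \<open>open S\<close>])
    show "k_smooth_on n S (\<lambda>x. f x *\<^sub>R frechet_derivative g (at x) v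
        + frechet_derivative f (at x) v *\<^sub>R g x)"
      using Suc.prems k_smooth_on_Suc_D[OF Suc.prems(1)] k_smooth_on_Suc_D[OF Suc.prems(2)]
      by (intro k_smooth_on_add[OF \<open>open S\<close>] Suc.IH) auto
    show "f x *\<^sub>R frechet_derivative g (at x) v + frechet_derivative f (at x) v *\<^sub>R g x
        = frechet_derivative (\<lambda>x. f x *\<^sub>R g x) (at x) v" if "x \<in> S" for x
      using frechet_derivative_eq[OF D[OF that]] by simp
  qed
  then show ?case using D by (auto simp: differentiable_def)
qed

lemma k_smooth_on_linear:
  assumes "open S" "bounded_linear L" "k_smooth_on n S f"
  shows "k_smooth_on n S (\<lambda>x. L (f x))"
  using assms(3)
proof (induction n arbitrary: f)
  case 0
  then show ?case using bounded_linear.continuous_on[OF assms(2)] by auto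
next
  case (Suc n)
  have D: "((\<lambda>x. L (f x)) has_derivative (\<lambda>v. L (frechet_derivative f (at x) v))) (at x)"
    if "x \<in> S" for x
    using that Suc.prems
    by (intro bounded_linear.has_derivative[OF assms(2)]) (auto simp: frechet_derivative_works[symmetric])
  have "k_smooth_on n S (\<lambda>x. frechet_derivative (\<lambda>x. L (f x)) (at x) v)" for v
  proof (rule k_smooth_on_cong_imp[OF \<open>open S\<close>])
    show "k_smooth_on n S (\<lambda>x. L (frechet_derivative f (at x) v))"
      using Suc by auto
    show "L (frechet_derivative f (at x) v) = frechet_derivative (\<lambda>x. L (f x)) (at x) v"
      if "x \<in> S" for x
      using frechet_derivative_eq[OF D[OF that]] by simp
  qed
  then show ?case using D by (auto simp: differentiable_def)
qed

lemma smooth_on_cong: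
  "open S \<Longrightarrow> (\<And>x. x \<in> S \<Longrightarrow> f x = g x) \<Longrightarrow> smooth_on S f \<longleftrightarrow> smooth_on S g"
  unfolding smooth_on_def using k_smooth_on_cong_imp[of S f g] k_smooth_on_cong_imp[of S g f] by auto

lemma smooth_on_const [simp]: "smooth_on S (\<lambda>_. c)"
  by (simp add: smooth_on_def)

lemma smooth_on_add:
  "open S \<Longrightarrow> smooth_on S f \<Longrightarrow> smooth_on S g \<Longrightarrow> smooth_on S (\<lambda>x. f x + g x)"
  by (simp add: smooth_on_def k_smooth_on_add)

lemma smooth_on_scaleR:
  "open S \<Longrightarrow> smooth_on S f \<Longrightarrow> smooth_on S g \<Longrightarrow> smooth_on S (\<lambda>x. f x *\<^sub>R g x)"
  by (simp add: smooth_on_def k_smooth_on_scaleR)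

lemma smooth_on_mult:
  fixes f g :: "_ \<Rightarrow> real"
  shows "open S \<Longrightarrow> smooth_on S f \<Longrightarrow> smooth_on S g \<Longrightarrow> smooth_on S (\<lambda>x. f x * g x)"
  using smooth_on_scaleR[of S f g] by simp

lemma smooth_on_linear: "open S \<Longrightarrow> bounded_linear L \<Longrightarrow> smooth_on S f \<Longrightarrow> smooth_on S (\<lambda>x. L (f x))"
  by (simp add: smooth_on_def k_smooth_on_linear)

lemma smooth_on_sum:
  "open S \<Longrightarrow> (\<And>i. i \<in> I \<Longrightarrow> smooth_on S (f i)) \<Longrightarrow> smooth_on S (\<lambda>x. \<Sum>i\<in>I. f i x)"
  by (induction I rule: infinite_finite_induct) (auto intro: smooth_on_add)

lemma smooth_on_deriv: "smooth_on S f \<Longrightarrow> smooth_on S (\<lambda>x. frechet_derivative f (at x) v)"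
  unfolding smooth_on_def by (metis k_smooth_on.simps(2))

lemma smooth_on_differentiable: "smooth_on S f \<Longrightarrow> x \<in> S \<Longrightarrow> f differentiable (at x)"
  unfolding smooth_on_def by (metis k_smooth_on.simps(2))

lemma smooth_on_has_derivative:
  "smooth_on S f \<Longrightarrow> x \<in> S \<Longrightarrow> (f has_derivative frechet_derivative f (at x)) (at x)"
  using smooth_on_differentiable frechet_derivative_works by blast

lemma smooth_on_continuous_on: "smooth_on S f \<Longrightarrow> continuous_on S f"
  unfolding smooth_on_def by (metis k_smooth_on.simps(1))

lemma linear_Basis_expand:
  fixes u :: "'e::euclidean_space"
  assumes "linear L"
  shows "L u = (\<Sum>b\<in>Basis. (u \<bullet> b) *\<^sub>R L b)"
proof -
  have "L u = L (\<Sum>b\<in>Basis. (u \<bullet> b) *\<^sub>R b)" by (simp only: euclidean_representation)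
  also have "\<dots> = (\<Sum>b\<in>Basis. (u \<bullet> b) *\<^sub>R L b)"
    by (simp add: linear_sum[OF assms] linear_scale[OF assms])
  finally show ?thesis .
qed

lemma frechet_derivative_Basis_expand:
  fixes u :: "'e::euclidean_space"
  assumes "f differentiable (at x)"
  shows "frechet_derivative f (at x) u = (\<Sum>b\<in>Basis. (u \<bullet> b) *\<^sub>R frechet_derivative f (at x) b)"
  using linear_Basis_expand[OF linear_frechet_derivative[OF assms]] .

lemma smooth_on_deriv_field:
  fixes f :: "'e::euclidean_space \<Rightarrow> 'b::real_normed_vector"
  assumes "open S" "smooth_on S f" "smooth_on S Y"
  shows "smooth_on S (\<lambda>x. frechet_derivative f (at x) (Y x))"
proof -
  have "smooth_on S (\<lambda>x. \<Sum>b\<in>Basis. (Y x \<bullet> b) *\<^sub>R frechet_derivative f (at x) b)"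
    by (intro smooth_on_sum smooth_on_scaleR smooth_on_linear[of S "\<lambda>y. y \<bullet> _"] smooth_on_deriv assms
        bounded_linear_inner_left)
  then show ?thesis
    by (subst smooth_on_cong[OF assms(1)])
      (use assms in \<open>auto intro!: frechet_derivative_Basis_expand smooth_on_differentiable\<close>)
qed

section \<open>Symmetry of second derivatives\<close>

text \<open>
  The mean value theorem, applied in the direction \<open>u\<close> and then in the direction \<open>v\<close>, turns the second
  difference over a parallelogram into a mixed derivative at a nearby point.
\<close>

lemma second_difference:
  fixes f :: "'e::real_normed_vector \<Rightarrow> real"
  assumes S: "cball x r \<subseteq> S" and f: "smooth_on S f" and h: "0 < h" "h * (norm u + norm v) \<le> r"
  shows "\<exists>p. norm (p - x) \<le> h * (norm u + norm v) \<and>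
    f (x + h *\<^sub>R u + h *\<^sub>R v) - f (x + h *\<^sub>R u) - f (x + h *\<^sub>R v) + f x
      = h * h * frechet_derivative (\<lambda>y. frechet_derivative f (at y) u) (at p) v"
proof -
  let ?g = "\<lambda>y. frechet_derivative f (at y) u"
  have near: "norm (x + s *\<^sub>R u + t *\<^sub>R v - x) \<le> h * (norm u + norm v)"
    if "0 \<le> s" "s \<le> h" "0 \<le> t" "t \<le> h" for s t
  proof -
    have "norm (s *\<^sub>R u + t *\<^sub>R v) \<le> s * norm u + t * norm v"
      using norm_triangle_ineq[of "s *\<^sub>R u" "t *\<^sub>R v"] that by simp
    also have "\<dots> \<le> h * norm u + h * norm v"
      using that by (intro add_mono mult_right_mono) auto
    finally show ?thesis by (simp add: algebra_simps)
  qed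
  have mem: "x + s *\<^sub>R u + t *\<^sub>R v \<in> S" if "0 \<le> s" "s \<le> h" "0 \<le> t" "t \<le> h" for s t
  proof -
    have "dist x (x + s *\<^sub>R u + t *\<^sub>R v) \<le> r"
      using near[OF that] h by (metis dist_commute dist_norm order_trans)
    then show ?thesis using S by auto
  qed
  have df: "((\<lambda>s. f (x + s *\<^sub>R u + t *\<^sub>R v)) has_real_derivative ?g (x + s *\<^sub>R u + t *\<^sub>R v)) (at s)"
    if "0 \<le> s" "s \<le> h" "0 \<le> t" "t \<le> h" for s t
  proof -
    have "((\<lambda>s. x + s *\<^sub>R u + t *\<^sub>R v) has_derivative (\<lambda>d. d *\<^sub>R u)) (at s)"
      by (auto intro!: derivative_eq_intros)
    from has_derivative_compose[OF this smooth_on_has_derivative[OF f mem[OF that]]]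
    have "((\<lambda>s. f (x + s *\<^sub>R u + t *\<^sub>R v)) has_derivative
        (\<lambda>d. frechet_derivative f (at (x + s *\<^sub>R u + t *\<^sub>R v)) (d *\<^sub>R u))) (at s)" .
    then show ?thesis
      using linear_scale[OF linear_frechet_derivative[OF smooth_on_differentiable[OF f mem[OF that]]]]
      by (simp add: has_field_derivative_def mult_commute_abs)
  qed
  have dg: "((\<lambda>t. ?g (x + s *\<^sub>R u + t *\<^sub>R v)) has_real_derivative
      frechet_derivative ?g (at (x + s *\<^sub>R u + t *\<^sub>R v)) v) (at t)"
    if "0 \<le> s" "s \<le> h" "0 \<le> t" "t \<le> h" for s t
  proof -
    have "((\<lambda>t. x + s *\<^sub>R u + t *\<^sub>R v) has_derivative (\<lambda>d. d *\<^sub>R v)) (at t)"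
      by (auto intro!: derivative_eq_intros)
    from has_derivative_compose[OF this smooth_on_has_derivative[OF smooth_on_deriv[OF f] mem[OF that]]]
    have "((\<lambda>t. ?g (x + s *\<^sub>R u + t *\<^sub>R v)) has_derivative
        (\<lambda>d. frechet_derivative ?g (at (x + s *\<^sub>R u + t *\<^sub>R v)) (d *\<^sub>R v))) (at t)" .
    then show ?thesis
      using linear_scale[OF linear_frechet_derivative[OF smooth_on_differentiable[OF smooth_on_deriv[OF f] mem[OF that]]]]
      by (simp add: has_field_derivative_def mult_commute_abs)
  qed
  have "\<exists>s. 0 < s \<and> s < h \<and>
      (f (x + h *\<^sub>R u + h *\<^sub>R v) - f (x + h *\<^sub>R u + 0 *\<^sub>R v))
        - (f (x + 0 *\<^sub>R u + h *\<^sub>R v) - f (x + 0 *\<^sub>R u + 0 *\<^sub>R v))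
      = (h - 0) * (?g (x + s *\<^sub>R u + h *\<^sub>R v) - ?g (x + s *\<^sub>R u + 0 *\<^sub>R v))"
    by (rule MVT2[of 0 h "\<lambda>s. f (x + s *\<^sub>R u + h *\<^sub>R v) - f (x + s *\<^sub>R u + 0 *\<^sub>R v)"])
      (use h in \<open>auto intro!: DERIV_diff df simp del: scaleR_zero_left\<close>)
  then obtain s where s: "0 < s" "s < h"
    and eq1: "f (x + h *\<^sub>R u + h *\<^sub>R v) - f (x + h *\<^sub>R u) - f (x + h *\<^sub>R v) + f x
      = h * (?g (x + s *\<^sub>R u + h *\<^sub>R v) - ?g (x + s *\<^sub>R u + 0 *\<^sub>R v))"
    by (auto simp: algebra_simps)
  have "\<exists>t. 0 < t \<and> t < h \<and> ?g (x + s *\<^sub>R u + h *\<^sub>R v) - ?g (x + s *\<^sub>R u + 0 *\<^sub>R v)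
      = (h - 0) * frechet_derivative ?g (at (x + s *\<^sub>R u + t *\<^sub>R v)) v"
    by (rule MVT2[of 0 h "\<lambda>t. ?g (x + s *\<^sub>R u + t *\<^sub>R v)"]) (use h s in \<open>auto intro!: dg\<close>)
  then obtain t where t: "0 < t" "t < h" "?g (x + s *\<^sub>R u + h *\<^sub>R v) - ?g (x + s *\<^sub>R u + 0 *\<^sub>R v)
      = h * frechet_derivative ?g (at (x + s *\<^sub>R u + t *\<^sub>R v)) v"
    by auto
  show ?thesis
    using eq1 t near[of s t] s by (intro exI[of _ "x + s *\<^sub>R u + t *\<^sub>R v"]) auto
qed

text \<open>
  The second difference does not depend on the order of the directions, so the two mixed
  derivatives agree at points that converge to \<open>x\<close>.
\<close>

lemma symmetric_second_derivative:
  fixes f :: "'e::real_normed_vector \<Rightarrow> real"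
  assumes S: "open S" "x \<in> S" and f: "smooth_on S f"
  shows "frechet_derivative (\<lambda>y. frechet_derivative f (at y) u) (at x) v
    = frechet_derivative (\<lambda>y. frechet_derivative f (at y) v) (at x) u"
proof -
  define F where "F u v p = frechet_derivative (\<lambda>y. frechet_derivative f (at y) u) (at p) v" for u v p
  obtain r where r: "r > 0" "cball x r \<subseteq> S" using S open_contains_cball by blast
  have cont: "isCont (F u v) x" for u v
    unfolding F_def using smooth_on_continuous_on[OF smooth_on_deriv[OF smooth_on_deriv[OF f]]] S
    by (metis continuous_on_eq_continuous_at)
  \<comment> \<open>The summand \<open>1\<close> makes \<open>m\<close> positive when both directions vanish.\<close>
  define m where "m = norm u + norm v + 1"
  have m: "m > 0" unfolding m_def by (smt (verit) norm_ge_zero)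
  have "\<bar>F u v x - F v u x\<bar> \<le> e" if "e > 0" for e
  proof -
    have "\<exists>d>0. \<forall>p. norm (p - x) < d \<longrightarrow> \<bar>F a b p - F a b x\<bar> < e / 2" for a b
      using cont[of a b] \<open>e > 0\<close> unfolding continuous_at_eps_delta dist_norm real_norm_def
      by (meson half_gt_zero)
    then obtain d1 d2 where d: "d1 > 0" "d2 > 0"
      "\<And>p. norm (p - x) < d1 \<Longrightarrow> \<bar>F u v p - F u v x\<bar> < e / 2"
      "\<And>p. norm (p - x) < d2 \<Longrightarrow> \<bar>F v u p - F v u x\<bar> < e / 2" by metis
    define h where "h = min r (min (d1 / 2) (d2 / 2)) / m"
    have h: "h > 0" unfolding h_def using r d m by auto
    have hm: "h * (norm u + norm v) \<le> min r (min (d1 / 2) (d2 / 2))"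
    proof -
      have "h * (norm u + norm v) \<le> h * m" using h by (intro mult_left_mono) (auto simp: m_def)
      then show ?thesis using m by (simp add: h_def)
    qed
    obtain p where p: "norm (p - x) \<le> h * (norm u + norm v)"
      "f (x + h *\<^sub>R u + h *\<^sub>R v) - f (x + h *\<^sub>R u) - f (x + h *\<^sub>R v) + f x = h * h * F u v p"
      using second_difference[OF r(2) f h, of u v] hm unfolding F_def by auto
    obtain q where q: "norm (q - x) \<le> h * (norm u + norm v)"
      "f (x + h *\<^sub>R v + h *\<^sub>R u) - f (x + h *\<^sub>R v) - f (x + h *\<^sub>R u) + f x = h * h * F v u q"
      using second_difference[OF r(2) f h, of v u] hm unfolding F_def by (auto simp: add.commute)
    have "h * h * F u v p = h * h * F v u q" using p(2) q(2) by (simp add: algebra_simps)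
    then have "F u v p = F v u q" using h by simp
    moreover have "\<bar>F u v p - F u v x\<bar> < e / 2" using d p hm by (intro d(3)) auto
    moreover have "\<bar>F v u q - F v u x\<bar> < e / 2" using d q hm by (intro d(4)) auto
    ultimately show ?thesis by linarith
  qed
  then have "\<bar>F u v x - F v u x\<bar> \<le> 0" by (rule field_le_epsilon) simp
  then show ?thesis by (simp add: F_def)
qed

section \<open>Linear differential operators with smooth coefficients\<close>

text \<open>
  The linear differential operators of order at most \<open>n\<close> with smooth coefficients. They are described
  by the ways to build them, not by a family of coefficients, so that composition with derivatives
  and bounds are proved by induction.
\<close>

inductive dop :: "'e::euclidean_space set \<Rightarrow> nat \<Rightarrow> (('e \<Rightarrow> real) \<Rightarrow> 'e \<Rightarrow> real) \<Rightarrow> bool" for S where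
  partial: "set bs \<subseteq> Basis \<Longrightarrow> length bs \<le> n \<Longrightarrow> dop S n (iter_partial bs)"
| add: "dop S n D \<Longrightarrow> dop S n E \<Longrightarrow> dop S n (\<lambda>h x. D h x + E h x)"
| mult: "smooth_on S a \<Longrightarrow> dop S n D \<Longrightarrow> dop S n (\<lambda>h x. a x * D h x)"

lemma smooth_on_iter_partial: "smooth_on S h \<Longrightarrow> smooth_on S (iter_partial bs h)"
  by (induction bs) (auto intro: smooth_on_deriv)

lemma dop_smooth: "dop S n D \<Longrightarrow> open S \<Longrightarrow> smooth_on S h \<Longrightarrow> smooth_on S (D h)"
  by (induction rule: dop.induct) (auto intro: smooth_on_iter_partial smooth_on_add smooth_on_mult)

lemma dop_mono: "dop S n D \<Longrightarrow> n \<le> n' \<Longrightarrow> dop S n' D"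
  by (induction rule: dop.induct) (auto intro: dop.intros)

lemma dop_sum:
  assumes "\<And>i. i \<in> I \<Longrightarrow> dop S n (D i)"
  shows "dop S n (\<lambda>h x. \<Sum>i\<in>I. D i h x)"
  using assms
proof (induction I rule: infinite_finite_induct)
  case (infinite I)
  show ?case using dop.mult[OF smooth_on_const[of S 0] dop.partial[of "[]" n S]] infinite by simp
next
  case empty
  show ?case using dop.mult[OF smooth_on_const[of S 0] dop.partial[of "[]" n S]] by simp
next
  case (insert i I)
  then show ?case using dop.add[of S n "D i" "\<lambda>h x. \<Sum>i\<in>I. D i h x"] by simp
qed

lemma dop_partial:
  fixes b :: "'e::euclidean_space"
  assumes "open S" "b \<in> Basis" "dop S n D"
  shows "\<exists>E. dop S (Suc n) E \<and>
    (\<forall>h. smooth_on S h \<longrightarrow> (\<forall>x\<in>S. E h x = frechet_derivative (D h) (at x) b))"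
  using assms(3)
proof (induction rule: dop.induct)
  case (partial bs n)
  then have "dop S (Suc n) (iter_partial (b # bs))"
    using \<open>b \<in> Basis\<close> by (intro dop.partial) auto
  moreover have "\<forall>h. smooth_on S h \<longrightarrow>
      (\<forall>x\<in>S. iter_partial (b # bs) h x = frechet_derivative (iter_partial bs h) (at x) b)"
    by simp
  ultimately show ?case by blast
next
  case (add n D1 D2)
  then obtain E1 E2 where E: "dop S (Suc n) E1" "dop S (Suc n) E2"
    "\<And>h x. smooth_on S h \<Longrightarrow> x \<in> S \<Longrightarrow> E1 h x = frechet_derivative (D1 h) (at x) b"
    "\<And>h x. smooth_on S h \<Longrightarrow> x \<in> S \<Longrightarrow> E2 h x = frechet_derivative (D2 h) (at x) b" by metis
  show ?case
  proof (intro exI conjI allI impI ballI)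
    show "dop S (Suc n) (\<lambda>h x. E1 h x + E2 h x)" using E by (intro dop.add)
    fix h :: "'e \<Rightarrow> real" and x assume h: "smooth_on S h" "x \<in> S"
    have "((\<lambda>x. D1 h x + D2 h x) has_derivative
        (\<lambda>v. frechet_derivative (D1 h) (at x) v + frechet_derivative (D2 h) (at x) v)) (at x)"
      by (intro has_derivative_add smooth_on_has_derivative[OF dop_smooth[OF add.hyps(1) assms(1) h(1)] h(2)]
          smooth_on_has_derivative[OF dop_smooth[OF add.hyps(2) assms(1) h(1)] h(2)])
    from frechet_derivative_eq[OF this, of b] show "E1 h x + E2 h x = frechet_derivative (\<lambda>x. D1 h x + D2 h x) (at x) b"
      using E(3,4)[OF h] by simp
  qed
next
  case (mult a n D)
  then obtain E where E: "dop S (Suc n) E"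
    "\<And>h x. smooth_on S h \<Longrightarrow> x \<in> S \<Longrightarrow> E h x = frechet_derivative (D h) (at x) b" by metis
  show ?case
  proof (intro exI conjI allI impI ballI)
    show "dop S (Suc n) (\<lambda>h x. a x * E h x + frechet_derivative a (at x) b * D h x)"
      by (intro dop.add dop.mult smooth_on_deriv mult.hyps(1) E(1) dop_mono[OF mult.hyps(2)]) simp
    fix h :: "'e \<Rightarrow> real" and x assume h: "smooth_on S h" "x \<in> S"
    have "((\<lambda>x. a x * D h x) has_derivative
        (\<lambda>v. a x * frechet_derivative (D h) (at x) v + frechet_derivative a (at x) v * D h x)) (at x)"
      by (intro has_derivative_mult smooth_on_has_derivative[OF mult.hyps(1) h(2)]
          smooth_on_has_derivative[OF dop_smooth[OF mult.hyps(2) assms(1) h(1)] h(2)])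
    from frechet_derivative_eq[OF this, of b] show "a x * E h x + frechet_derivative a (at x) b * D h x
        = frechet_derivative (\<lambda>x. a x * D h x) (at x) b"
      using E(2)[OF h] by simp
  qed
qed

lemma dop_field:
  fixes Y :: "'e::euclidean_space \<Rightarrow> 'e"
  assumes "open S" "smooth_on S Y" "dop S n D"
  shows "\<exists>E. dop S (Suc n) E \<and>
    (\<forall>h. smooth_on S h \<longrightarrow> (\<forall>x\<in>S. E h x = frechet_derivative (D h) (at x) (Y x)))"
proof -
  have "\<forall>b\<in>Basis. \<exists>E. dop S (Suc n) E \<and>
    (\<forall>h. smooth_on S h \<longrightarrow> (\<forall>x\<in>S. E h x = frechet_derivative (D h) (at x) b))"
    using dop_partial[OF assms(1) _ assms(3)] by blast
  then obtain E where E: "\<And>b. b \<in> Basis \<Longrightarrow> dop S (Suc n) (E b)"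
    "\<And>b h x. b \<in> Basis \<Longrightarrow> smooth_on S h \<Longrightarrow> x \<in> S \<Longrightarrow> E b h x = frechet_derivative (D h) (at x) b"
    by metis
  show ?thesis
  proof (intro exI conjI allI impI ballI)
    show "dop S (Suc n) (\<lambda>h x. \<Sum>b\<in>Basis. (Y x \<bullet> b) * E b h x)"
      by (intro dop_sum dop.mult E smooth_on_linear[of S "\<lambda>y. y \<bullet> _"] assms bounded_linear_inner_left)
    fix h :: "'e \<Rightarrow> real" and x assume h: "smooth_on S h" "x \<in> S"
    then have "D h differentiable (at x)"
      using dop_smooth[OF assms(3,1)] smooth_on_differentiable by blast
    then show "(\<Sum>b\<in>Basis. (Y x \<bullet> b) * E b h x) = frechet_derivative (D h) (at x) (Y x)"
      using frechet_derivative_Basis_expand[of "D h" x "Y x"] E(2) h by simp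
  qed
qed

definition partials_le :: "nat \<Rightarrow> 'e::euclidean_space set \<Rightarrow> ('e \<Rightarrow> real) \<Rightarrow> real \<Rightarrow> bool" where
  "partials_le n K h M \<longleftrightarrow>
     (\<forall>bs. \<forall>x\<in>K. set bs \<subseteq> Basis \<and> length bs \<le> n \<longrightarrow> \<bar>iter_partial bs h x\<bar> \<le> M)"

text \<open>
  The point is the order of the quantifiers: the constant comes from bounds for the coefficients on
  \<open>K\<close> and serves all functions \<open>h\<close>.
\<close>

lemma dop_bound:
  assumes "dop S n D" "compact K" "K \<subseteq> S"
  shows "\<exists>C\<ge>0. \<forall>h M. partials_le n K h M \<longrightarrow> (\<forall>x\<in>K. \<bar>D h x\<bar> \<le> C * M)"
  using assms(1)
proof (induction rule: dop.induct)
  case (partial bs n)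
  show ?case
  proof (intro exI[of _ 1] conjI allI impI ballI)
    fix h :: "'a \<Rightarrow> real" and M x assume "partials_le n K h M" "x \<in> K"
    then show "\<bar>iter_partial bs h x\<bar> \<le> 1 * M"
      using partial unfolding partials_le_def by simp
  qed simp
next
  case (add n D1 D2)
  obtain C1 where C1: "C1 \<ge> 0" "\<forall>h M. partials_le n K h M \<longrightarrow> (\<forall>x\<in>K. \<bar>D1 h x\<bar> \<le> C1 * M)"
    using add.IH(1) by blast
  obtain C2 where C2: "C2 \<ge> 0" "\<forall>h M. partials_le n K h M \<longrightarrow> (\<forall>x\<in>K. \<bar>D2 h x\<bar> \<le> C2 * M)"
    using add.IH(2) by blast
  show ?case
  proof (intro exI[of _ "C1 + C2"] conjI allI impI ballI)
    fix h :: "'a \<Rightarrow> real" and M x assume "partials_le n K h M" "x \<in> K"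
    then have "\<bar>D1 h x\<bar> \<le> C1 * M" "\<bar>D2 h x\<bar> \<le> C2 * M" using C1 C2 by blast+
    then show "\<bar>D1 h x + D2 h x\<bar> \<le> (C1 + C2) * M" by (simp add: distrib_right)
  qed (use C1 C2 in simp)
next
  case (mult a n D)
  obtain C where C: "C \<ge> 0" "\<forall>h M. partials_le n K h M \<longrightarrow> (\<forall>x\<in>K. \<bar>D h x\<bar> \<le> C * M)"
    using mult.IH by blast
  have "continuous_on K a"
    using smooth_on_continuous_on[OF mult.hyps(1)] assms(3) by (rule continuous_on_subset)
  then have "bounded (a ` K)"
    by (intro compact_imp_bounded compact_continuous_image assms(2))
  then obtain B where B: "\<forall>y\<in>a ` K. norm y \<le> B" unfolding bounded_iff by blast
  show ?case
  proof (intro exI[of _ "max B 0 * C"] conjI allI impI ballI)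
    fix h :: "'a \<Rightarrow> real" and M x assume a: "partials_le n K h M" "x \<in> K"
    have "\<bar>D h x\<bar> \<le> C * M" using C(2) a by blast
    moreover have "\<bar>a x\<bar> \<le> B" using B a(2) by simp
    ultimately have "\<bar>a x\<bar> * \<bar>D h x\<bar> \<le> max B 0 * (C * M)"
      by (intro mult_mono) auto
    then show "\<bar>a x * D h x\<bar> \<le> max B 0 * C * M"
      by (simp add: abs_mult mult.assoc)
  qed (use C in simp)
qed

section \<open>Calculus on a manifold\<close>

lemma lie_extension_lin:
  assumes "lie_extension \<A> \<kappa> V VL" "A \<in> lie_alg \<kappa>" "B \<in> lie_alg \<kappa>"
  shows "VL (\<lambda>w. r * A w + s * B w) p = tv_lin r (VL A p) s (VL B p)"
  using assms by (simp add: lie_extension_def)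

locale smooth_manifold =
  fixes \<A> :: "('m::{t2_space,second_countable_topology}, 'e::euclidean_space) chart set"
  assumes smooth_atlas: "smooth_atlas \<A>"
begin

abbreviation cim :: "('m, 'e) chart \<Rightarrow> 'e set" where
  "cim c \<equiv> cmap c ` cdom c"

lemma chart_around: obtains c where "c \<in> \<A>" "p \<in> cdom c"
  using smooth_atlas unfolding smooth_atlas_def by blast

lemma some_chart: "(SOME c. c \<in> \<A> \<and> p \<in> cdom c) \<in> \<A> \<and> p \<in> cdom (SOME c. c \<in> \<A> \<and> p \<in> cdom c)"
proof -
  obtain c where "c \<in> \<A>" "p \<in> cdom c" by (rule chart_around)
  then show ?thesis by (intro someI[of "\<lambda>c. c \<in> \<A> \<and> p \<in> cdom c"]) simp
qed

lemma tangent_space_change: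
  assumes "v \<in> tangent_space \<A> p" "c \<in> \<A>" "c' \<in> \<A>" "p \<in> cdom c" "p \<in> cdom c'"
  shows "v c' = frechet_derivative (cmap c' \<circ> cinv c) (at (cmap c p)) (v c)"
  using assms unfolding tangent_space_def mem_Collect_eq by blast

lemma open_cdom: "c \<in> \<A> \<Longrightarrow> open (cdom c)"
  and open_cim: "c \<in> \<A> \<Longrightarrow> open (cim c)"
  and chart_homeomorphism: "c \<in> \<A> \<Longrightarrow> homeomorphism (cdom c) (cim c) (cmap c) (cinv c)"
  using smooth_atlas unfolding smooth_atlas_def by blast+

lemma cinv_cmap [simp]: "c \<in> \<A> \<Longrightarrow> p \<in> cdom c \<Longrightarrow> cinv c (cmap c p) = p"
  and cmap_cinv: "c \<in> \<A> \<Longrightarrow> x \<in> cim c \<Longrightarrow> cmap c (cinv c x) = x"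
  and cinv_in_cdom: "c \<in> \<A> \<Longrightarrow> x \<in> cim c \<Longrightarrow> cinv c x \<in> cdom c"
  using chart_homeomorphism[of c] unfolding homeomorphism_def by auto

lemma continuous_on_cmap: "c \<in> \<A> \<Longrightarrow> continuous_on (cdom c) (cmap c)"
  and continuous_on_cinv: "c \<in> \<A> \<Longrightarrow> continuous_on (cim c) (cinv c)"
  using chart_homeomorphism[of c] unfolding homeomorphism_def by auto

lemma transition_has_derivative:
  assumes "c \<in> \<A>" "c' \<in> \<A>" "p \<in> cdom c" "p \<in> cdom c'"
  shows "((cmap c' \<circ> cinv c) has_derivative frechet_derivative (cmap c' \<circ> cinv c) (at (cmap c p)))
    (at (cmap c p))"
  using smooth_atlas assms unfolding smooth_atlas_def
  by (intro smooth_on_has_derivative[of "cmap c ` (cdom c \<inter> cdom c')"]) auto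

lemma open_overlap:
  assumes "c \<in> \<A>" "open U"
  shows "open (cmap c ` (cdom c \<inter> U))"
proof -
  have "cmap c ` (cdom c \<inter> U) = cim c \<inter> cinv c -` U"
    using cinv_cmap[OF assms(1)] by (auto simp: cmap_cinv[OF assms(1)])
  then show ?thesis
    using continuous_on_cinv[OF assms(1)] open_cim[OF assms(1)] assms(2)
    by (simp add: continuous_on_open_vimage Int_commute)
qed

lemma has_derivative_change_chart:
  assumes c: "c \<in> \<A>" "c' \<in> \<A>" "p \<in> cdom c" "p \<in> cdom c'"
    and D: "((f \<circ> cinv c') has_derivative D) (at (cmap c' p))"
  shows "((f \<circ> cinv c) has_derivative (\<lambda>v. D (frechet_derivative (cmap c' \<circ> cinv c) (at (cmap c p)) v)))
    (at (cmap c p))"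
proof -
  have "((\<lambda>x. (f \<circ> cinv c') ((cmap c' \<circ> cinv c) x)) has_derivative
      (\<lambda>v. D (frechet_derivative (cmap c' \<circ> cinv c) (at (cmap c p)) v))) (at (cmap c p))"
    by (rule has_derivative_compose[OF transition_has_derivative[OF c]]) (use c D in \<open>simp add: o_def\<close>)
  then show ?thesis
    by (rule has_derivative_transform_within_open[OF _ open_overlap[OF c(1) open_cdom[OF c(2)]]])
      (use c in auto)
qed

lemma smooth_fun_has_derivative:
  assumes "smooth_fun \<A> f" "c \<in> \<A>" "p \<in> cdom c"
  shows "((f \<circ> cinv c) has_derivative frechet_derivative (f \<circ> cinv c) (at (cmap c p))) (at (cmap c p))"
  using assms unfolding smooth_fun_def by (intro smooth_on_has_derivative[of "cim c"]) auto

lemma mdiff_chart: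
  assumes f: "smooth_fun \<A> f" and v: "v \<in> tangent_space \<A> p" and c: "c \<in> \<A>" "p \<in> cdom c"
  shows "mdiff \<A> f p v = frechet_derivative (f \<circ> cinv c) (at (cmap c p)) (v c)"
proof -
  define c' where "c' = (SOME c. c \<in> \<A> \<and> p \<in> cdom c)"
  have c': "c' \<in> \<A>" "p \<in> cdom c'"
    using some_chart[of p] unfolding c'_def by auto
  have "((f \<circ> cinv c) has_derivative (\<lambda>v. frechet_derivative (f \<circ> cinv c') (at (cmap c' p))
      (frechet_derivative (cmap c' \<circ> cinv c) (at (cmap c p)) v))) (at (cmap c p))"
    by (rule has_derivative_change_chart[OF c(1) c'(1) c(2) c'(2) smooth_fun_has_derivative[OF f c']])
  then have "frechet_derivative (f \<circ> cinv c) (at (cmap c p)) (v c)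
      = frechet_derivative (f \<circ> cinv c') (at (cmap c' p))
          (frechet_derivative (cmap c' \<circ> cinv c) (at (cmap c p)) (v c))"
    by (rule frechet_derivative_eq)
  also have "frechet_derivative (cmap c' \<circ> cinv c) (at (cmap c p)) (v c) = v c'"
    using tangent_space_change[OF v c(1) c'(1) c(2) c'(2)] by simp
  finally show ?thesis unfolding mdiff_def c'_def[symmetric] Let_def by (rule sym)
qed

lemma mdiff_linear:
  assumes f: "smooth_fun \<A> f"
  shows "mdiff \<A> f p (tv_lin a v b w) = a * mdiff \<A> f p v + b * mdiff \<A> f p w"
proof -
  define c where "c = (SOME c. c \<in> \<A> \<and> p \<in> cdom c)"
  have c: "c \<in> \<A>" "p \<in> cdom c"
    using some_chart[of p] unfolding c_def by auto
  have "linear (frechet_derivative (f \<circ> cinv c) (at (cmap c p)))"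
    using smooth_fun_has_derivative[OF f c] has_derivative_linear by blast
  then show ?thesis unfolding mdiff_def c_def[symmetric] Let_def tv_lin_def
    by (simp only: linear_add linear_scale real_scaleR_def)
qed

lemma vf_apply_chart:
  assumes "smooth_fun \<A> f" "smooth_vfield \<A> Y" "c \<in> \<A>" "x \<in> cim c"
  shows "vf_apply \<A> Y f (cinv c x) = frechet_derivative (f \<circ> cinv c) (at x) (Y (cinv c x) c)"
  using mdiff_chart[OF assms(1) _ assms(3) cinv_in_cdom[OF assms(3,4)], of "Y (cinv c x)"] assms
  unfolding vf_apply_def smooth_vfield_def by (simp add: cmap_cinv)

lemma smooth_fun_vf_apply:
  assumes f: "smooth_fun \<A> f" and Y: "smooth_vfield \<A> Y"
  shows "smooth_fun \<A> (vf_apply \<A> Y f)"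
  unfolding smooth_fun_def
proof
  fix c assume c: "c \<in> \<A>"
  have "smooth_on (cim c) (\<lambda>x. frechet_derivative (f \<circ> cinv c) (at x) (Y (cinv c x) c))"
    using f Y c by (intro smooth_on_deriv_field open_cim) (auto simp: smooth_fun_def smooth_vfield_def)
  then show "smooth_on (cim c) (vf_apply \<A> Y f \<circ> cinv c)"
    using smooth_on_cong[OF open_cim[OF c], of "vf_apply \<A> Y f \<circ> cinv c"
        "\<lambda>x. frechet_derivative (f \<circ> cinv c) (at x) (Y (cinv c x) c)"] vf_apply_chart[OF f Y c] by simp
qed

lemma smooth_fun_sum:
  assumes "\<And>i. i \<in> I \<Longrightarrow> smooth_fun \<A> (F i)"
  shows "smooth_fun \<A> (\<lambda>p. \<Sum>i\<in>I. a i * F i p)"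
  unfolding smooth_fun_def
proof
  fix c assume c: "c \<in> \<A>"
  have "smooth_on (cim c) (F i \<circ> cinv c)" if "i \<in> I" for i
    using assms[OF that] c by (simp add: smooth_fun_def)
  then have "smooth_on (cim c) (\<lambda>x. \<Sum>i\<in>I. a i * (F i \<circ> cinv c) x)"
    by (intro smooth_on_sum smooth_on_mult open_cim c smooth_on_const) (simp add: o_def)
  then show "smooth_on (cim c) ((\<lambda>p. \<Sum>i\<in>I. a i * F i p) \<circ> cinv c)" by (simp add: o_def)
qed

lemma vf_apply_sum:
  assumes F: "\<And>i. i \<in> I \<Longrightarrow> smooth_fun \<A> (F i)"
  shows "vf_apply \<A> Y (\<lambda>p. \<Sum>i\<in>I. a i * F i p) p = (\<Sum>i\<in>I. a i * vf_apply \<A> Y (F i) p)"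
proof -
  define c where "c = (SOME c. c \<in> \<A> \<and> p \<in> cdom c)"
  have c: "c \<in> \<A>" "p \<in> cdom c"
    using some_chart[of p] unfolding c_def by auto
  have "((\<lambda>x. \<Sum>i\<in>I. a i * (F i \<circ> cinv c) x) has_derivative
      (\<lambda>v. \<Sum>i\<in>I. a i * frechet_derivative (F i \<circ> cinv c) (at (cmap c p)) v)) (at (cmap c p))"
    by (intro has_derivative_sum has_derivative_mult_right smooth_fun_has_derivative F c)
  then have "((\<lambda>p. \<Sum>i\<in>I. a i * F i p) \<circ> cinv c has_derivative
      (\<lambda>v. \<Sum>i\<in>I. a i * frechet_derivative (F i \<circ> cinv c) (at (cmap c p)) v)) (at (cmap c p))"
    by (simp add: o_def)
  then have "frechet_derivative ((\<lambda>p. \<Sum>i\<in>I. a i * F i p) \<circ> cinv c) (at (cmap c p)) v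
      = (\<Sum>i\<in>I. a i * frechet_derivative (F i \<circ> cinv c) (at (cmap c p)) v)" for v
    by (rule frechet_derivative_eq)
  then show ?thesis by (simp add: vf_apply_def mdiff_def c_def[symmetric] Let_def)
qed

text \<open>
  The product rule for the pairing of the differential of \<open>F\<close> with the field \<open>b\<close>, obtained by expanding
  the pairing in the basis.
\<close>

lemma derivative_of_deriv_field:
  fixes F :: "'e \<Rightarrow> real" and b :: "'e \<Rightarrow> 'e"
  assumes S: "open S" "x \<in> S" and F: "smooth_on S F" and b: "smooth_on S b"
  shows "frechet_derivative (\<lambda>y. frechet_derivative F (at y) (b y)) (at x) v
    = frechet_derivative F (at x) (frechet_derivative b (at x) v)
      + frechet_derivative (\<lambda>y. frechet_derivative F (at y) (b x)) (at x) v"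
proof -
  let ?D = "\<lambda>y u. frechet_derivative F (at y) u"
  have diff: "F differentiable (at y)" if "y \<in> S" for y
    using F that smooth_on_differentiable by blast
  have expand: "?D y u = (\<Sum>i\<in>Basis. (u \<bullet> i) * ?D y i)" if "y \<in> S" for y u
    using frechet_derivative_Basis_expand[OF diff[OF that], of u] by simp
  have Di: "((\<lambda>y. ?D y i) has_derivative frechet_derivative (\<lambda>y. ?D y i) (at x)) (at x)" for i
    by (rule smooth_on_has_derivative[OF smooth_on_deriv[OF F] S(2)])
  have Db: "((\<lambda>y. b y \<bullet> i) has_derivative (\<lambda>v. frechet_derivative b (at x) v \<bullet> i)) (at x)" for i
    by (intro has_derivative_inner_left smooth_on_has_derivative[OF b S(2)])
  have "((\<lambda>y. \<Sum>i\<in>Basis. (b y \<bullet> i) * ?D y i) has_derivative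
    (\<lambda>v. \<Sum>i\<in>Basis. (b x \<bullet> i) * frechet_derivative (\<lambda>y. ?D y i) (at x) v
        + (frechet_derivative b (at x) v \<bullet> i) * ?D x i)) (at x)"
    by (intro has_derivative_sum has_derivative_mult Db Di)
  then have "((\<lambda>y. ?D y (b y)) has_derivative
    (\<lambda>v. \<Sum>i\<in>Basis. (b x \<bullet> i) * frechet_derivative (\<lambda>y. ?D y i) (at x) v
        + (frechet_derivative b (at x) v \<bullet> i) * ?D x i)) (at x)"
    by (rule has_derivative_transform_within_open[OF _ S]) (simp add: expand)
  then have 1: "frechet_derivative (\<lambda>y. ?D y (b y)) (at x) v
     = (\<Sum>i\<in>Basis. (b x \<bullet> i) * frechet_derivative (\<lambda>y. ?D y i) (at x) v)
       + (\<Sum>i\<in>Basis. (frechet_derivative b (at x) v \<bullet> i) * ?D x i)"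
    by (simp add: frechet_derivative_eq sum.distrib)
  have "((\<lambda>y. \<Sum>i\<in>Basis. (b x \<bullet> i) * ?D y i) has_derivative
    (\<lambda>v. \<Sum>i\<in>Basis. (b x \<bullet> i) * frechet_derivative (\<lambda>y. ?D y i) (at x) v)) (at x)"
    by (intro has_derivative_sum has_derivative_mult_right Di)
  then have "((\<lambda>y. ?D y (b x)) has_derivative
    (\<lambda>v. \<Sum>i\<in>Basis. (b x \<bullet> i) * frechet_derivative (\<lambda>y. ?D y i) (at x) v)) (at x)"
    by (rule has_derivative_transform_within_open[OF _ S]) (simp add: expand)
  then have 2: "frechet_derivative (\<lambda>y. ?D y (b x)) (at x) v
     = (\<Sum>i\<in>Basis. (b x \<bullet> i) * frechet_derivative (\<lambda>y. ?D y i) (at x) v)"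
    by (rule frechet_derivative_eq)
  show ?thesis unfolding 1 2 using expand[OF S(2), of "frechet_derivative b (at x) v"] by simp
qed

text \<open>
  In a chart the second derivatives of \<open>f\<close> cancel by symmetry, and the first derivatives that remain are
  those along the coordinate expression of the Lie derivative.
\<close>

lemma lie_deriv_apply:
  assumes f: "smooth_fun \<A> f" and X: "smooth_vfield \<A> X" and Y: "smooth_vfield \<A> Y"
    and XY: "smooth_vfield \<A> (lie_deriv \<A> X Y)"
  shows "vf_apply \<A> (lie_deriv \<A> X Y) f p
    = vf_apply \<A> X (vf_apply \<A> Y f) p - vf_apply \<A> Y (vf_apply \<A> X f) p"
proof -
  obtain c where c: "c \<in> \<A>" "p \<in> cdom c" by (rule chart_around)
  define x where "x = cmap c p"
  have x: "x \<in> cim c" "cinv c x = p" using c by (auto simp: x_def)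
  let ?F = "f \<circ> cinv c" and ?S = "cim c"
  let ?a = "\<lambda>x. X (cinv c x) c" and ?b = "\<lambda>x. Y (cinv c x) c"
  have S: "open ?S" using c open_cim by blast
  have sm: "smooth_on ?S ?F" "smooth_on ?S ?a" "smooth_on ?S ?b"
    using f X Y c by (auto simp: smooth_fun_def smooth_vfield_def)
  have app: "vf_apply \<A> Z (vf_apply \<A> W f) p
      = frechet_derivative (\<lambda>y. frechet_derivative ?F (at y) (W (cinv c y) c)) (at x) (Z p c)"
    if Z: "smooth_vfield \<A> Z" and W: "smooth_vfield \<A> W" for Z W
  proof -
    have "frechet_derivative (vf_apply \<A> W f \<circ> cinv c) (at x)
        = frechet_derivative (\<lambda>y. frechet_derivative ?F (at y) (W (cinv c y) c)) (at x)"
    proof (rule frechet_derivative_transform_within_open[OF _ S x(1)])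
      show "(vf_apply \<A> W f \<circ> cinv c) differentiable at x"
        using smooth_fun_vf_apply[OF f W] c x(1) smooth_on_differentiable unfolding smooth_fun_def by blast
    qed (use vf_apply_chart[OF f W c(1)] in simp)
    then show ?thesis
      using vf_apply_chart[OF smooth_fun_vf_apply[OF f W] Z c(1) x(1)] x(2) by simp
  qed
  have lin: "linear (frechet_derivative ?F (at x))"
    using smooth_on_differentiable[OF sm(1) x(1)] linear_frechet_derivative by blast
  have "vf_apply \<A> (lie_deriv \<A> X Y) f p = frechet_derivative ?F (at x)
      (frechet_derivative ?b (at x) (X p c) - frechet_derivative ?a (at x) (Y p c))"
    using vf_apply_chart[OF f XY c(1) x(1)] c x by (simp add: lie_deriv_def x_def)
  also have "\<dots> = vf_apply \<A> X (vf_apply \<A> Y f) p - vf_apply \<A> Y (vf_apply \<A> X f) p"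
    unfolding app[OF X Y] app[OF Y X] derivative_of_deriv_field[OF S x(1) sm(1,3)]
      derivative_of_deriv_field[OF S x(1) sm(1,2)] x(2) linear_diff[OF lin]
    using symmetric_second_derivative[OF S x(1) sm(1), of "X p c" "Y p c"] by simp
  finally show ?thesis .
qed

text \<open>
  Being an integral curve at a single time. Curves that solve the equation on a part of the line can
  then be restricted, reparametrised and glued.
\<close>

definition integral_curve_at :: "('m, 'e) vfield \<Rightarrow> (real \<Rightarrow> 'm) \<Rightarrow> real \<Rightarrow> bool" where
  "integral_curve_at Y \<gamma> t \<longleftrightarrow> isCont \<gamma> t \<and>
     (\<forall>c\<in>\<A>. \<gamma> t \<in> cdom c \<longrightarrow> ((cmap c \<circ> \<gamma>) has_vector_derivative Y (\<gamma> t) c) (at t))"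

lemma integral_curve_iff: "integral_curve \<A> Y \<gamma> \<longleftrightarrow> (\<forall>t. integral_curve_at Y \<gamma> t)"
  unfolding integral_curve_def integral_curve_at_def by (auto simp: continuous_on_eq_continuous_at)

lemma integral_curve_at_affine:
  assumes "integral_curve_at Y \<gamma> (b + a * t)"
  shows "integral_curve_at (\<lambda>p c. a *\<^sub>R Y p c) (\<lambda>s. \<gamma> (b + a * s)) t"
  unfolding integral_curve_at_def
proof (intro conjI ballI impI)
  show "isCont (\<lambda>s. \<gamma> (b + a * s)) t"
    using assms by (intro isCont_o2[of t "\<lambda>s. b + a * s" \<gamma>]) (auto simp: integral_curve_at_def)
  fix c assume c: "c \<in> \<A>" "\<gamma> (b + a * t) \<in> cdom c"
  have "((\<lambda>s. b + a * s) has_vector_derivative a) (at t)"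
    by (auto intro!: derivative_eq_intros simp: has_real_derivative_iff_has_vector_derivative[symmetric])
  moreover have "((cmap c \<circ> \<gamma>) has_vector_derivative Y (\<gamma> (b + a * t)) c) (at (b + a * t))"
    using assms c by (simp add: integral_curve_at_def)
  ultimately have "((cmap c \<circ> \<gamma>) \<circ> (\<lambda>s. b + a * s) has_vector_derivative a *\<^sub>R Y (\<gamma> (b + a * t)) c) (at t)"
    by (rule vector_diff_chain_at)
  then show "((cmap c \<circ> (\<lambda>s. \<gamma> (b + a * s))) has_vector_derivative a *\<^sub>R Y (\<gamma> (b + a * t)) c) (at t)"
    by (simp add: o_def)
qed

lemma eventually_in_cdom:
  assumes "c \<in> \<A>" "\<gamma> t \<in> cdom c" "isCont \<gamma> t"
  shows "eventually (\<lambda>s. \<gamma> s \<in> cdom c) (nhds t)"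
proof -
  have "eventually (\<lambda>s. \<gamma> s \<in> cdom c) (at t)"
    using topological_tendstoD[OF assms(3)[unfolded isCont_def] open_cdom[OF assms(1)] assms(2)] .
  then show ?thesis
    unfolding eventually_at_filter by (rule eventually_mono) (use assms(2) in auto)
qed

lemma has_derivative_along_curve:
  fixes f :: "'m \<Rightarrow> 'b::real_normed_vector"
  assumes c: "c \<in> \<A>" "\<gamma> t \<in> cdom c" and cont: "isCont \<gamma> t"
    and \<gamma>: "((cmap c \<circ> \<gamma>) has_vector_derivative v) (at t)"
    and f: "((f \<circ> cinv c) has_derivative D) (at (cmap c (\<gamma> t)))"
  shows "((\<lambda>t. f (\<gamma> t)) has_vector_derivative D v) (at t)"
proof -
  have "((\<lambda>s. (f \<circ> cinv c) ((cmap c \<circ> \<gamma>) s)) has_derivative (\<lambda>d. D (d *\<^sub>R v))) (at t)"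
    by (rule has_derivative_compose[OF \<gamma>[unfolded has_vector_derivative_def]]) (use f in \<open>simp add: o_def\<close>)
  then have *: "((\<lambda>s. (f \<circ> cinv c) ((cmap c \<circ> \<gamma>) s)) has_vector_derivative D v) (at t)"
    using linear_scale[OF has_derivative_linear[OF f]] by (simp add: has_vector_derivative_def)
  obtain U where U: "open U" "t \<in> U" "\<And>s. s \<in> U \<Longrightarrow> \<gamma> s \<in> cdom c"
    using eventually_in_cdom[OF c cont] unfolding eventually_nhds by auto
  show ?thesis
    by (rule has_vector_derivative_transform_within_open[OF * U(1,2)]) (use U(3) c in auto)
qed

lemma function_along_integral_curve:
  assumes f: "smooth_fun \<A> f" and \<gamma>: "integral_curve_at Y \<gamma> t" and Y: "smooth_vfield \<A> Y"
  shows "((\<lambda>t. f (\<gamma> t)) has_real_derivative vf_apply \<A> Y f (\<gamma> t)) (at t)"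
proof -
  obtain c where c: "c \<in> \<A>" "\<gamma> t \<in> cdom c" by (rule chart_around)
  have "((\<lambda>t. f (\<gamma> t)) has_vector_derivative
      frechet_derivative (f \<circ> cinv c) (at (cmap c (\<gamma> t))) (Y (\<gamma> t) c)) (at t)"
    using c \<gamma> unfolding integral_curve_at_def
    by (intro has_derivative_along_curve[where f = f and c = c
          and D = "frechet_derivative (f \<circ> cinv c) (at (cmap c (\<gamma> t)))"]
        smooth_fun_has_derivative[OF f c]) auto
  moreover have "vf_apply \<A> Y f (\<gamma> t) = frechet_derivative (f \<circ> cinv c) (at (cmap c (\<gamma> t))) (Y (\<gamma> t) c)"
    using vf_apply_chart[OF f Y c(1), of "cmap c (\<gamma> t)"] c by simp
  ultimately show ?thesis by (simp add: has_real_derivative_iff_has_vector_derivative)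
qed

section \<open>The differential operators of a dynamical system\<close>

context
  fixes V :: "real ^ ('d::finite) \<Rightarrow> ('m, 'e) vfield"
  assumes V: "dynamical_system \<A> V"
begin

lemma smooth_vfield_V: "smooth_vfield \<A> (V a)"
  using V by (simp add: dynamical_system_def)

lemma smooth_fun_word_op: "smooth_fun \<A> f \<Longrightarrow> smooth_fun \<A> (word_op \<A> V w f)"
  by (induction w) (auto intro: smooth_fun_vf_apply smooth_vfield_V)

lemma word_op_append: "word_op \<A> V (u @ v) f = word_op \<A> V u (word_op \<A> V v f)"
  by (induction u) auto

lemma word_op_sum:
  assumes "\<And>i. i \<in> I \<Longrightarrow> smooth_fun \<A> (F i)"
  shows "word_op \<A> V w (\<lambda>p. \<Sum>i\<in>I. a i * F i p) p = (\<Sum>i\<in>I. a i * word_op \<A> V w (F i) p)"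
proof (induction w arbitrary: p)
  case (Cons j w)
  then have "word_op \<A> V w (\<lambda>p. \<Sum>i\<in>I. a i * F i p) = (\<lambda>p. \<Sum>i\<in>I. a i * word_op \<A> V w (F i) p)"
    by auto
  then show ?case using vf_apply_sum[of I "\<lambda>i. word_op \<A> V w (F i)"] assms smooth_fun_word_op by simp
qed simp

lemma smooth_fun_diff_op: "smooth_fun \<A> f \<Longrightarrow> smooth_fun \<A> (diff_op \<A> \<kappa> V A f)"
  unfolding diff_op_def by (intro smooth_fun_sum smooth_fun_word_op)

lemma diff_op_diff_op:
  assumes "smooth_fun \<A> f"
  shows "diff_op \<A> \<kappa> V A (diff_op \<A> \<kappa> V B f) p
    = (\<Sum>(u, v)\<in>{u. length u \<le> \<kappa>} \<times> {v. length v \<le> \<kappa>}. A u * B v * word_op \<A> V (u @ v) f p)"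
  unfolding diff_op_def[of _ _ _ B] diff_op_def[of _ _ _ A]
  by (simp add: word_op_sum smooth_fun_word_op assms word_op_append sum_distrib_left
      sum.cartesian_product mult.assoc)

text \<open>
  The operator of a truncated product retains exactly those pairs of words whose concatenation is not
  cut off, whereas the composition of the operators involves all pairs.
\<close>

lemma diff_op_tmult:
  "diff_op \<A> \<kappa> V (tmult \<kappa> A B) f p
    = (\<Sum>(u, v)\<in>{(u, v). length u + length v \<le> \<kappa>}. A u * B v * word_op \<A> V (u @ v) f p)"
proof -
  have "diff_op \<A> \<kappa> V (tmult \<kappa> A B) f p = (\<Sum>w\<in>{w. length w \<le> \<kappa>}. \<Sum>i\<le>length w.
      A (take i w) * B (drop i w) * word_op \<A> V (take i w @ drop i w) f p)"
    unfolding diff_op_def by (intro sum.cong) (auto simp: tmult_def sum_distrib_right)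
  also have "\<dots> = (\<Sum>(w, i)\<in>(SIGMA w:{w. length w \<le> \<kappa>}. {..length w}).
      A (take i w) * B (drop i w) * word_op \<A> V (take i w @ drop i w) f p)"
    by (simp add: sum.Sigma)
  also have "\<dots> = (\<Sum>(u, v)\<in>{(u, v). length u + length v \<le> \<kappa>}. A u * B v * word_op \<A> V (u @ v) f p)"
    by (rule sum.reindex_bij_witness[of _ "\<lambda>(u, v). (u @ v, length u)" "\<lambda>(w, i). (take i w, drop i w)"]) auto
  finally show ?thesis .
qed

lemma diff_op_linear:
  "diff_op \<A> \<kappa> V (\<lambda>w. r * A w + s * B w) f p = r * diff_op \<A> \<kappa> V A f p + s * diff_op \<A> \<kappa> V B f p"
  by (simp add: diff_op_def sum_distrib_left sum.distrib algebra_simps)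

lemma vf_apply_V:
  assumes f: "smooth_fun \<A> f" and "\<kappa> \<ge> 1"
  shows "vf_apply \<A> (V a) f p = diff_op \<A> \<kappa> V (tvector a) f p"
proof -
  have Vlin: "V (r *\<^sub>R a + s *\<^sub>R b) p = tv_lin r (V a p) s (V b p)" for r s a b
    using V by (simp add: dynamical_system_def)
  have L: "mdiff \<A> f p (V (r *\<^sub>R a + s *\<^sub>R b) p) = r * mdiff \<A> f p (V a p) + s * mdiff \<A> f p (V b p)" for r s a b
    unfolding Vlin by (rule mdiff_linear[OF f])
  have lin: "linear (\<lambda>a. mdiff \<A> f p (V a p))"
    by (rule linearI) (use L[of 1 _ 1] L[of _ _ 0] in auto)
  have "vf_apply \<A> (V a) f p = mdiff \<A> f p (V (\<Sum>i\<in>UNIV. (a $ i) *\<^sub>R axis i 1) p)"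
    using basis_expansion[of a] by (simp add: vf_apply_def scalar_mult_eq_scaleR)
  also have "\<dots> = (\<Sum>i\<in>UNIV. a $ i * word_op \<A> V [i] f p)"
    by (simp add: linear_sum[OF lin] linear_scale[OF lin] vf_apply_def)
  also have "\<dots> = (\<Sum>w\<in>range (\<lambda>i. [i]). tvector a w * word_op \<A> V w f p)"
    by (subst sum.reindex) (auto simp: inj_on_def tvector_def)
  also have "\<dots> = diff_op \<A> \<kappa> V (tvector a) f p"
    unfolding diff_op_def
    by (rule sum.mono_neutral_left) (use \<open>\<kappa> \<ge> 1\<close> in \<open>auto simp: tvector_def split: list.splits\<close>)
  finally show ?thesis .
qed

text \<open>
  The truncation has no effect on a product of homogeneous tensors whose degrees add up to at most
  \<open>\<kappa>\<close>.
\<close>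

lemma diff_op_tmult_homogeneous:
  assumes f: "smooth_fun \<A> f" and "m + n \<le> \<kappa>"
    and A: "\<And>w. length w \<noteq> m \<Longrightarrow> A w = 0" and B: "\<And>w. length w \<noteq> n \<Longrightarrow> B w = 0"
  shows "diff_op \<A> \<kappa> V (tmult \<kappa> A B) f p = diff_op \<A> \<kappa> V A (diff_op \<A> \<kappa> V B f) p"
proof -
  have fin: "finite ({u :: 'd list. length u \<le> \<kappa>} \<times> {v :: 'd list. length v \<le> \<kappa>})" by simp
  show ?thesis
    unfolding diff_op_tmult diff_op_diff_op[OF f]
  proof (rule sum.mono_neutral_left[OF fin])
    show "{(u :: 'd list, v :: 'd list). length u + length v \<le> \<kappa>}
        \<subseteq> {u. length u \<le> \<kappa>} \<times> {v. length v \<le> \<kappa>}" by auto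
    have "A u * B v * word_op \<A> V (u @ v) f p = 0" if "\<not> length u + length v \<le> \<kappa>" for u v :: "'d list"
    proof -
      have "A u = 0 \<or> B v = 0" using A[of u] B[of v] \<open>m + n \<le> \<kappa>\<close> that by linarith
      then show ?thesis by auto
    qed
    note * = this
    show "\<forall>x\<in>{u. length u \<le> \<kappa>} \<times> {v. length v \<le> \<kappa>} - {(u, v). length u + length v \<le> \<kappa>}.
        (case x of (u, v) \<Rightarrow> A u * B v * word_op \<A> V (u @ v) f p) = 0"
    proof
      fix x assume "x \<in> {u :: 'd list. length u \<le> \<kappa>} \<times> {v :: 'd list. length v \<le> \<kappa>}
        - {(u, v). length u + length v \<le> \<kappa>}"
      then have "\<not> length (fst x) + length (snd x) \<le> \<kappa>" by (auto simp: case_prod_beta)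
      from *[OF this] show "(case x of (u, v) \<Rightarrow> A u * B v * word_op \<A> V (u @ v) f p) = 0"
        by (simp only: case_prod_beta)
    qed
  qed
qed

text \<open>
  A nested bracket and the corresponding nested Lie derivative are iterated commutators, of tensors
  and of operators. The brackets are homogeneous, so that no commutator is truncated.
\<close>

lemma vf_apply_lie_word:
  assumes VL: "lie_extension \<A> \<kappa> V VL" and f: "smooth_fun \<A> f"
    and "1 \<le> length as" "length as \<le> \<kappa>"
  shows "vf_apply \<A> (lie_word \<A> V as) f p = diff_op \<A> \<kappa> V (ad_word \<kappa> as) f p"
  using f assms(3,4)
proof (induction as arbitrary: f p rule: induct_list012)
  case (2 a)
  then show ?case using vf_apply_V[of f \<kappa> a p] by simp
next
  case (3 a b as)
  have smooth: "smooth_vfield \<A> (lie_word \<A> V bs)" if "1 \<le> length bs" "length bs \<le> \<kappa>" for bs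
    using VL ad_word_in_lie_alg[of bs \<kappa>] that unfolding lie_extension_def
    by (metis list.size(3) not_one_le_zero)
  have len: "1 + length (b # as) \<le> \<kappa>" "length (b # as) + 1 \<le> \<kappa>" using 3(5) by auto
  define B where "B = ad_word \<kappa> (b # as)"
  define W where "W = lie_word \<A> V (b # as)"
  have W: "smooth_vfield \<A> W" unfolding W_def using 3(5) by (intro smooth) auto
  have LW: "lie_word \<A> V (a # b # as) = lie_deriv \<A> (V a) W" by (simp add: W_def)
  have sm: "smooth_vfield \<A> (lie_deriv \<A> (V a) W)"
    unfolding LW[symmetric] using 3(5) by (intro smooth) auto
  have IH: "vf_apply \<A> W h = diff_op \<A> \<kappa> V B h" if "smooth_fun \<A> h" for h
    unfolding W_def B_def by (rule ext, rule 3(2)) (use that 3(5) in auto)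
  have Va: "vf_apply \<A> (V a) h = diff_op \<A> \<kappa> V (tvector a) h" if "smooth_fun \<A> h" for h
    by (rule ext, rule vf_apply_V) (use that 3(5) in auto)
  have homB: "B w = 0" if "length w \<noteq> length (b # as)" for w
    unfolding B_def by (rule ad_word_homogeneous[OF that])
  have homa: "tvector a w = 0" if "length w \<noteq> 1" for w
    using that by (auto simp: tvector_def split: list.splits)
  have "vf_apply \<A> (lie_word \<A> V (a # b # as)) f p
      = vf_apply \<A> (V a) (vf_apply \<A> W f) p - vf_apply \<A> W (vf_apply \<A> (V a) f) p"
    unfolding LW by (rule lie_deriv_apply[OF 3(3) smooth_vfield_V W sm])
  also have "\<dots> = diff_op \<A> \<kappa> V (tvector a) (diff_op \<A> \<kappa> V B f) p
      - diff_op \<A> \<kappa> V B (diff_op \<A> \<kappa> V (tvector a) f) p"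
    by (simp add: IH Va 3(3) smooth_fun_diff_op)
  also have "diff_op \<A> \<kappa> V (tvector a) (diff_op \<A> \<kappa> V B f) p = diff_op \<A> \<kappa> V (tmult \<kappa> (tvector a) B) f p"
    by (rule diff_op_tmult_homogeneous[OF 3(3) len(1) homa homB, symmetric])
  also have "diff_op \<A> \<kappa> V B (diff_op \<A> \<kappa> V (tvector a) f) p = diff_op \<A> \<kappa> V (tmult \<kappa> B (tvector a)) f p"
    by (rule diff_op_tmult_homogeneous[OF 3(3) len(2) homB homa, symmetric])
  finally show ?case
    using diff_op_linear[of \<kappa> 1 "tmult \<kappa> (tvector a) B" "-1" "tmult \<kappa> B (tvector a)" f p]
    by (simp add: tbracket_def B_def)
qed simp

lemma vf_apply_lie_extension:
  assumes VL: "lie_extension \<A> \<kappa> V VL" and f: "smooth_fun \<A> f" and "\<kappa> \<ge> 1" and A: "A \<in> lie_alg \<kappa>"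
  shows "vf_apply \<A> (VL A) f p = diff_op \<A> \<kappa> V A f p"
  using lie_alg_subset_ad_span[OF \<open>\<kappa> \<ge> 1\<close> A]
proof (induction rule: ad_span.induct)
  case (word as)
  then have "VL (ad_word \<kappa> as) = lie_word \<A> V as" using VL unfolding lie_extension_def by blast
  then show ?case using vf_apply_lie_word[OF VL f word] by simp
next
  case zero
  have "VL (\<lambda>_. 0) p = tv_lin 0 (VL (\<lambda>_. 0) p) 0 (VL (\<lambda>_. 0) p)"
    using lie_extension_lin[OF VL zero_in_lie_alg zero_in_lie_alg, of 0 0 p] by simp
  then show ?case
    using mdiff_linear[OF f, of p 0 "VL (\<lambda>_. 0) p" 0 "VL (\<lambda>_. 0) p"]
    by (simp add: vf_apply_def diff_op_def)
next
  case (lin A B r s)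
  have "VL (\<lambda>w. r * A w + s * B w) p = tv_lin r (VL A p) s (VL B p)"
    using lin.hyps[THEN ad_span_subset_lie_alg] by (intro lie_extension_lin[OF VL])
  then show ?case
    using lin.IH mdiff_linear[OF f] by (simp add: vf_apply_def diff_op_linear)
qed

text \<open>
  Each letter of a word contributes one derivative along a vector field.
\<close>

lemma word_op_dop:
  assumes c: "c \<in> \<A>"
  shows "\<exists>D. dop (cim c) (length w) D \<and>
    (\<forall>f. smooth_fun \<A> f \<longrightarrow> (\<forall>x\<in>cim c. word_op \<A> V w f (cinv c x) = D (f \<circ> cinv c) x))"
proof (induction w)
  case Nil
  have "dop (cim c) (length ([] :: 'd list)) (iter_partial [])"
    by (rule dop.partial) auto
  moreover have "\<forall>f. smooth_fun \<A> f \<longrightarrow>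
      (\<forall>x\<in>cim c. word_op \<A> V [] f (cinv c x) = iter_partial [] (f \<circ> cinv c) x)" by simp
  ultimately show ?case by blast
next
  case (Cons i w)
  then obtain D where D: "dop (cim c) (length w) D"
    and Dw: "\<forall>f. smooth_fun \<A> f \<longrightarrow> (\<forall>x\<in>cim c. word_op \<A> V w f (cinv c x) = D (f \<circ> cinv c) x)"
    by blast
  have "smooth_on (cim c) (\<lambda>x. V (axis i 1) (cinv c x) c)"
    using smooth_vfield_V c unfolding smooth_vfield_def by blast
  from dop_field[OF open_cim[OF c] this D] obtain E where E: "dop (cim c) (Suc (length w)) E"
    and EY: "\<forall>h. smooth_on (cim c) h \<longrightarrow> (\<forall>x\<in>cim c. E h x
      = frechet_derivative (D h) (at x) (V (axis i 1) (cinv c x) c))" by blast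
  have "word_op \<A> V (i # w) f (cinv c x) = E (f \<circ> cinv c) x" if f: "smooth_fun \<A> f" and x: "x \<in> cim c" for f x
  proof -
    have sm: "smooth_fun \<A> (word_op \<A> V w f)" by (rule smooth_fun_word_op[OF f])
    have "word_op \<A> V (i # w) f (cinv c x)
        = frechet_derivative (word_op \<A> V w f \<circ> cinv c) (at x) (V (axis i 1) (cinv c x) c)"
      using vf_apply_chart[OF sm smooth_vfield_V c x] by simp
    also have "frechet_derivative (word_op \<A> V w f \<circ> cinv c) (at x)
        = frechet_derivative (D (f \<circ> cinv c)) (at x)"
    proof (rule frechet_derivative_transform_within_open[OF _ open_cim[OF c] x])
      show "(word_op \<A> V w f \<circ> cinv c) differentiable at x"
        using sm c x smooth_on_differentiable unfolding smooth_fun_def by blast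
      show "(word_op \<A> V w f \<circ> cinv c) y = D (f \<circ> cinv c) y" if "y \<in> cim c" for y
        unfolding o_apply[of "word_op \<A> V w f"] by (rule Dw[rule_format, OF f that])
    qed
    also have "frechet_derivative (D (f \<circ> cinv c)) (at x) (V (axis i 1) (cinv c x) c) = E (f \<circ> cinv c) x"
      using EY[rule_format, OF _ x, of "f \<circ> cinv c"] f c unfolding smooth_fun_def by simp
    finally show ?thesis .
  qed
  then show ?case
    by (intro exI[of _ E] conjI allI impI ballI) (simp_all only: length_Cons E)
qed

end

end

section \<open>Riemannian length and the topology\<close>

locale riemannian_manifold = smooth_manifold \<A>
  for \<A> :: "('m::{t2_space,second_countable_topology}, 'e::euclidean_space) chart set" +
  fixes g :: "('m, 'e) metric"
  assumes metric: "riemannian_metric \<A> g"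
begin

lemma coord_vector_self:
  assumes c: "c \<in> \<A>" "p \<in> cdom c"
  shows "coord_vector \<A> c u p c = u"
proof -
  have "((cmap c \<circ> cinv c) has_derivative (\<lambda>u. u)) (at (cmap c p))"
    by (rule has_derivative_transform_within_open[OF has_derivative_ident open_cim[OF c(1)]])
      (use c cmap_cinv[OF c(1)] in auto)
  then show ?thesis using c frechet_derivative_eq by (simp add: coord_vector_def)
qed

lemma coord_vector_tangent:
  assumes c: "c \<in> \<A>" "p \<in> cdom c"
  shows "coord_vector \<A> c u p \<in> tangent_space \<A> p"
  unfolding tangent_space_def mem_Collect_eq
proof (intro conjI allI impI ballI)
  fix c' assume "c' \<notin> \<A> \<or> p \<notin> cdom c'"
  then show "coord_vector \<A> c u p c' = 0" by (auto simp: coord_vector_def)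
next
  fix c' c'' assume c': "c' \<in> \<A>" "c'' \<in> \<A>" "p \<in> cdom c' \<inter> cdom c''"
  have "((cmap c'' \<circ> cinv c) has_derivative (\<lambda>v. frechet_derivative (cmap c'' \<circ> cinv c') (at (cmap c' p))
      (frechet_derivative (cmap c' \<circ> cinv c) (at (cmap c p)) v))) (at (cmap c p))"
    by (rule has_derivative_change_chart[OF c(1) c'(1) c(2) _ transition_has_derivative[OF c'(1,2)]])
      (use c' in auto)
  from frechet_derivative_eq[OF this, of u]
  show "coord_vector \<A> c u p c'' = frechet_derivative (cmap c'' \<circ> cinv c') (at (cmap c' p))
      (coord_vector \<A> c u p c')"
    using c' by (simp add: coord_vector_def)
qed

lemma tangent_eq_coord_vector:
  assumes v: "v \<in> tangent_space \<A> p" and c: "c \<in> \<A>" "p \<in> cdom c"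
  shows "v = coord_vector \<A> c (v c) p"
proof
  fix c'
  show "v c' = coord_vector \<A> c (v c) p c'"
  proof (cases "c' \<in> \<A> \<and> p \<in> cdom c'")
    case True
    then show ?thesis
      using tangent_space_change[OF v c(1) _ c(2), of c'] by (simp add: coord_vector_def)
  next
    case False
    then have "v c' = 0" using v unfolding tangent_space_def mem_Collect_eq by blast
    then show ?thesis using False by (auto simp: coord_vector_def)
  qed
qed

lemma coord_vector_lin:
  assumes c: "c \<in> \<A>" "p \<in> cdom c"
  shows "coord_vector \<A> c (a *\<^sub>R u + b *\<^sub>R w) p
    = tv_lin a (coord_vector \<A> c u p) b (coord_vector \<A> c w p)"
proof
  fix c'
  show "coord_vector \<A> c (a *\<^sub>R u + b *\<^sub>R w) p c'
    = tv_lin a (coord_vector \<A> c u p) b (coord_vector \<A> c w p) c'"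
    using transition_has_derivative[OF c(1) _ c(2), of c', THEN has_derivative_linear]
    by (simp add: coord_vector_def tv_lin_def linear_add linear_scale)
qed

lemma tv_lin_tangent:
  assumes "v \<in> tangent_space \<A> p" "w \<in> tangent_space \<A> p"
  shows "tv_lin a v b w \<in> tangent_space \<A> p"
proof -
  obtain c where c: "c \<in> \<A>" "p \<in> cdom c" by (rule chart_around)
  have "tv_lin a v b w = coord_vector \<A> c (a *\<^sub>R v c + b *\<^sub>R w c) p"
    unfolding coord_vector_lin[OF c] using tangent_eq_coord_vector[OF _ c] assms by simp
  then show ?thesis using coord_vector_tangent[OF c] by simp
qed

lemma g_sym: "v \<in> tangent_space \<A> p \<Longrightarrow> w \<in> tangent_space \<A> p \<Longrightarrow> g p v w = g p w v"
  and g_lin: "u \<in> tangent_space \<A> p \<Longrightarrow> v \<in> tangent_space \<A> p \<Longrightarrow> w \<in> tangent_space \<A> p \<Longrightarrow>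
    g p (tv_lin a u b v) w = a * g p u w + b * g p v w"
  and g_pos: "v \<in> tangent_space \<A> p \<Longrightarrow> v \<noteq> (\<lambda>_. 0) \<Longrightarrow> g p v v > 0"
  using metric unfolding riemannian_metric_def by auto

lemma g_nonneg:
  assumes v: "v \<in> tangent_space \<A> p" shows "g p v v \<ge> 0"
proof (cases "v = (\<lambda>_. 0)")
  case True
  then have "v = tv_lin 0 v 0 v" by (simp add: tv_lin_def)
  then have "g p v v = 0 * g p v v + 0 * g p v v" using g_lin[OF v v v, of 0 0] by simp
  then show ?thesis by simp
qed (use g_pos[OF v] in simp)

lemma gnorm_scale:
  assumes v: "v \<in> tangent_space \<A> p"
  shows "gnorm g p (\<lambda>c. a *\<^sub>R v c) = \<bar>a\<bar> * gnorm g p v"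
proof -
  let ?w = "tv_lin a v 0 v"
  have w: "?w \<in> tangent_space \<A> p" using tv_lin_tangent v by blast
  have "g p ?w ?w = a * g p v ?w" using g_lin[OF v v w, of a 0] by simp
  also have "g p v ?w = a * g p v v" using g_sym[OF v w] g_lin[OF v v v, of a 0] by simp
  finally have "g p ?w ?w = a\<^sup>2 * g p v v" by (simp add: power2_eq_square)
  then show ?thesis by (simp add: gnorm_def tv_lin_def real_sqrt_mult)
qed

text \<open>
  In a chart the squared norm is a continuous function on the product of \<open>K\<close> with the Euclidean unit
  sphere. It is positive on this compact set, hence bounded below, and homogeneity does the rest.
\<close>

lemma gnorm_lower_bound:
  assumes c: "c \<in> \<A>" and K: "compact K" "K \<subseteq> cim c"
  shows "\<exists>m>0. \<forall>x\<in>K. \<forall>u. m * norm u \<le> gnorm g (cinv c x) (coord_vector \<A> c u (cinv c x))"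
proof (cases "K = {}")
  case True
  then show ?thesis by (intro exI[of _ 1]) auto
next
  case False
  define G where "G x u w = g (cinv c x) (coord_vector \<A> c u (cinv c x)) (coord_vector \<A> c w (cinv c x))"
    for x u w
  have tan: "coord_vector \<A> c u (cinv c x) \<in> tangent_space \<A> (cinv c x)" if "x \<in> cim c" for x u
    using coord_vector_tangent[OF c cinv_in_cdom[OF c that]] .
  have lin: "linear (\<lambda>u. G x u w)" if x: "x \<in> cim c" for x w
  proof (rule linearI)
    fix u v a
    show "G x (u + v) w = G x u w + G x v w"
      using coord_vector_lin[OF c cinv_in_cdom[OF c x], of 1 u 1 v]
        g_lin[OF tan[OF x, of u] tan[OF x, of v] tan[OF x, of w], of 1 1] by (simp add: G_def)
    show "G x (a *\<^sub>R u) w = a *\<^sub>R G x u w"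
      using coord_vector_lin[OF c cinv_in_cdom[OF c x], of a u 0 u]
        g_lin[OF tan[OF x, of u] tan[OF x, of u] tan[OF x, of w], of a 0] by (simp add: G_def)
  qed
  have sym: "G x u w = G x w u" if x: "x \<in> cim c" for x u w
    unfolding G_def by (rule g_sym[OF tan[OF x] tan[OF x]])
  have expand: "G x u u = (\<Sum>i\<in>Basis. (u \<bullet> i) * (\<Sum>j\<in>Basis. (u \<bullet> j) * G x j i))" if x: "x \<in> cim c" for x u
  proof -
    have "G x u u = (\<Sum>i\<in>Basis. (u \<bullet> i) * G x i u)"
      using linear_Basis_expand[OF lin[OF x], of u u] by simp
    also have "\<dots> = (\<Sum>i\<in>Basis. (u \<bullet> i) * G x u i)" using sym[OF x] by simp
    also have "\<dots> = (\<Sum>i\<in>Basis. (u \<bullet> i) * (\<Sum>j\<in>Basis. (u \<bullet> j) * G x j i))"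
      by (subst linear_Basis_expand[OF lin[OF x], where u = u]) simp
    finally show ?thesis .
  qed
  have cont1: "continuous_on (cim c) (\<lambda>x. G x u w)" for u w
    using metric c unfolding riemannian_metric_def G_def by (blast intro: smooth_on_continuous_on)
  have "continuous_on (K \<times> sphere 0 1)
      (\<lambda>z. \<Sum>i\<in>Basis. (snd z \<bullet> i) * (\<Sum>j\<in>Basis. (snd z \<bullet> j) * G (fst z) j i))"
    using K(2) by (intro continuous_intros continuous_on_compose2[OF cont1]) auto
  then have cont: "continuous_on (K \<times> sphere 0 1) (\<lambda>z. G (fst z) (snd z) (snd z))"
    by (rule continuous_on_eq) (use K(2) expand in auto)
  have "compact (K \<times> (sphere 0 1 :: 'e set))" using K by (intro compact_Times compact_sphere)
  moreover have "K \<times> (sphere 0 1 :: 'e set) \<noteq> {}" using False by simp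
  ultimately obtain z where z: "z \<in> K \<times> sphere 0 1"
    and zmin: "\<And>y. y \<in> K \<times> sphere 0 1 \<Longrightarrow> G (fst z) (snd z) (snd z) \<le> G (fst y) (snd y) (snd y)"
    using continuous_attains_inf[OF _ _ cont] by blast
  define m where "m = G (fst z) (snd z) (snd z)"
  have "m > 0"
  proof -
    have zx: "fst z \<in> cim c" "snd z \<noteq> 0" using z K(2) by auto
    have "coord_vector \<A> c (snd z) (cinv c (fst z)) c \<noteq> 0"
      using zx coord_vector_self[OF c cinv_in_cdom[OF c zx(1)]] by simp
    then have "coord_vector \<A> c (snd z) (cinv c (fst z)) \<noteq> (\<lambda>_. 0)" by metis
    then show ?thesis unfolding m_def G_def by (rule g_pos[OF tan[OF zx(1)]])
  qed
  have "sqrt m * norm u \<le> gnorm g (cinv c x) (coord_vector \<A> c u (cinv c x))" if x: "x \<in> K" for x u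
  proof (cases "u = 0")
    case True
    then show ?thesis using g_nonneg[OF tan] x K(2) by (auto simp: gnorm_def)
  next
    case False
    have xc: "x \<in> cim c" using x K(2) by auto
    define w where "w = u /\<^sub>R norm u"
    have w: "norm w = 1" "u = norm u *\<^sub>R w" using False by (auto simp: w_def)
    have "m \<le> G x w w" using zmin[of "(x, w)"] x w by (simp add: m_def)
    have "coord_vector \<A> c u (cinv c x) = (\<lambda>c'. norm u *\<^sub>R coord_vector \<A> c w (cinv c x) c')"
      using coord_vector_lin[OF c cinv_in_cdom[OF c xc], of "norm u" w 0 w] w(2) by (simp add: tv_lin_def)
    then have "gnorm g (cinv c x) (coord_vector \<A> c u (cinv c x)) = norm u * sqrt (G x w w)"
      using gnorm_scale[OF tan[OF xc, of w], of "norm u"] by (simp add: gnorm_def G_def)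
    then show ?thesis using \<open>m \<le> G x w w\<close> by (simp add: mult.commute[of "sqrt m"] mult_left_mono)
  qed
  then show ?thesis using \<open>m > 0\<close> by (intro exI[of _ "sqrt m"]) auto
qed

abbreviation glength :: "(real \<Rightarrow> 'm) \<Rightarrow> ennreal" where
  "glength \<gamma> \<equiv> \<integral>\<^sup>+ t \<in> {0..1}. ennreal (gnorm g (\<gamma> t) (velocity \<A> \<gamma> t)) \<partial>lborel"

lemma velocity_tangent:
  assumes cont: "isCont \<gamma> t"
    and diff: "\<And>c. c \<in> \<A> \<Longrightarrow> \<gamma> t \<in> cdom c \<Longrightarrow> (cmap c \<circ> \<gamma>) differentiable (at t)"
  shows "velocity \<A> \<gamma> t \<in> tangent_space \<A> (\<gamma> t)"
  unfolding tangent_space_def mem_Collect_eq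
proof (intro conjI allI impI ballI)
  fix c c' assume c: "c \<in> \<A>" "c' \<in> \<A>" "\<gamma> t \<in> cdom c \<inter> cdom c'"
  have "((cmap c \<circ> \<gamma>) has_vector_derivative vector_derivative (cmap c \<circ> \<gamma>) (at t)) (at t)"
    using diff c by (simp add: vector_derivative_works[symmetric])
  then have "((\<lambda>t. cmap c' (\<gamma> t)) has_vector_derivative
      frechet_derivative (cmap c' \<circ> cinv c) (at (cmap c (\<gamma> t))) (vector_derivative (cmap c \<circ> \<gamma>) (at t))) (at t)"
    using c by (intro has_derivative_along_curve[where f = "cmap c'" and c = c] cont
        transition_has_derivative) auto
  then show "velocity \<A> \<gamma> t c' = frechet_derivative (cmap c' \<circ> cinv c) (at (cmap c (\<gamma> t))) (velocity \<A> \<gamma> t c)"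
    using c vector_derivative_at by (fastforce simp: velocity_def o_def)
qed (auto simp: velocity_def)

text \<open>
  The Riemannian speed dominates \<open>m\<close> times the Euclidean speed, whose integral dominates the
  displacement. The speed of a piecewise \<open>C\<^sup>1\<close> curve need not be bounded near the exceptional times.
  Therefore curves of infinite length are treated separately; for the others the speed is Lebesgue
  integrable, and the fundamental theorem of calculus with finitely many exceptions yields the
  displacement.
\<close>

lemma length_lower_bound_in_chart:
  assumes c: "c \<in> \<A>" and \<gamma>: "pw_C1_curve \<A> \<gamma>" and ab: "0 \<le> a" "a \<le> b" "b \<le> 1"
    and dom: "\<And>t. t \<in> {a..b} \<Longrightarrow> \<gamma> t \<in> cdom c" and K: "\<And>t. t \<in> {a..b} \<Longrightarrow> cmap c (\<gamma> t) \<in> K"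
    and m: "m > 0" "\<And>x u. x \<in> K \<Longrightarrow> m * norm u \<le> gnorm g (cinv c x) (coord_vector \<A> c u (cinv c x))"
  shows "ennreal (m * dist (cmap c (\<gamma> a)) (cmap c (\<gamma> b))) \<le> glength \<gamma>"
proof -
  let ?x = "cmap c \<circ> \<gamma>"
  obtain S where S: "finite S"
    and C1: "\<And>c. c \<in> \<A> \<Longrightarrow> (cmap c \<circ> \<gamma>) C1_differentiable_on {t \<in> {0..1} - S. \<gamma> t \<in> cdom c}"
    and cont: "continuous_on {0..1} \<gamma>"
    using \<gamma> unfolding pw_C1_curve_def by blast
  from C1[OF c] obtain D where D: "\<And>t. t \<in> {0..1} - S \<Longrightarrow> \<gamma> t \<in> cdom c \<Longrightarrow> (?x has_vector_derivative D t) (at t)"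
    and contD: "continuous_on {t \<in> {0..1} - S. \<gamma> t \<in> cdom c} D"
    unfolding C1_differentiable_on_def by blast
  define J where "J = {a..b} - (S \<union> {0, 1})"
  define d where "d t = indicator J t *\<^sub>R D t" for t
  have J: "t \<in> {0<..<1} - S" "\<gamma> t \<in> cdom c" "cmap c (\<gamma> t) \<in> K" if "t \<in> J" for t
    using that ab dom K by (auto simp: J_def)
  have "J \<in> sets borel" unfolding J_def using S by (intro sets.Diff borel_closed[OF finite_imp_closed[of "S \<union> {0, 1}"]]) auto
  moreover have "continuous_on J D"
    by (rule continuous_on_subset[OF contD]) (use J in force)
  ultimately have meas: "d \<in> borel_measurable borel"
    unfolding d_def by (rule borel_measurable_continuous_on_indicator)
  have speed: "ennreal (m * norm (d t)) \<le> ennreal (gnorm g (\<gamma> t) (velocity \<A> \<gamma> t)) * indicator {0..1} t" for t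
  proof (cases "t \<in> J")
    case True
    have "t \<in> interior {0..1}" using J(1)[OF True] by simp
    then have cont_t: "isCont \<gamma> t" using cont continuous_on_interior by blast
    have "velocity \<A> \<gamma> t \<in> tangent_space \<A> (\<gamma> t)"
    proof (rule velocity_tangent[OF cont_t])
      fix c' assume c': "c' \<in> \<A>" "\<gamma> t \<in> cdom c'"
      have "t \<in> {t \<in> {0..1} - S. \<gamma> t \<in> cdom c'}" using c' J(1)[OF True] by auto
      then show "(cmap c' \<circ> \<gamma>) differentiable at t"
        using C1[OF c'(1)] unfolding C1_differentiable_on_eq by blast
    qed
    moreover have "velocity \<A> \<gamma> t c = D t"
    proof -
      have "(?x has_vector_derivative D t) (at t)" using D J[OF True] by auto
      then show ?thesis using J[OF True] c vector_derivative_at by (simp add: velocity_def)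
    qed
    ultimately have "velocity \<A> \<gamma> t = coord_vector \<A> c (D t) (\<gamma> t)"
      using tangent_eq_coord_vector[OF _ c J(2)[OF True]] by metis
    then show ?thesis
      using m(2)[OF J(3)[OF True], of "D t"] c J[OF True] True by (auto simp: d_def intro!: ennreal_leI)
  qed (simp add: d_def)
  have le: "(\<integral>\<^sup>+ t. ennreal (m * norm (d t)) \<partial>lborel) \<le> glength \<gamma>"
    by (rule nn_integral_mono) (rule speed)
  have eq: "(\<integral>\<^sup>+ t. ennreal (m * norm (d t)) \<partial>lborel) = ennreal m * (\<integral>\<^sup>+ t. ennreal (norm (d t)) \<partial>lborel)"
    using m(1) meas by (simp add: ennreal_mult' nn_integral_cmult)
  show ?thesis
  proof (cases "(\<integral>\<^sup>+ t. ennreal (norm (d t)) \<partial>lborel) = top")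
    case True
    then have "ennreal m * (\<integral>\<^sup>+ t. ennreal (norm (d t)) \<partial>lborel) = top"
      using m(1) by (simp add: ennreal_mult_top)
    then show ?thesis using le eq by (simp add: top_unique)
  next
    case False
    then have "(\<integral>\<^sup>+ t. ennreal (norm (d t)) \<partial>lborel) < \<infinity>" by (simp add: less_top[symmetric])
    then have int: "integrable lborel d" using meas by (intro integrableI_bounded) auto
    have "(d has_integral (?x b - ?x a)) {a..b}"
    proof (rule fundamental_theorem_of_calculus_interior_strong[of "S \<union> {0, 1}"])
      show "finite (S \<union> {0, 1})" using S by simp
      show "a \<le> b" by fact
      have "continuous_on {a..b} \<gamma>" by (rule continuous_on_subset[OF cont]) (use ab in auto)
      then show "continuous_on {a..b} ?x"
        by (rule continuous_on_compose)
          (rule continuous_on_subset[OF continuous_on_cmap[OF c]], use dom in auto)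
      fix t assume t: "t \<in> {a<..<b} - (S \<union> {0, 1})"
      then have "t \<in> J" by (auto simp: J_def)
      then show "(?x has_vector_derivative d t) (at t)"
        using D[of t] J[of t] by (auto simp: d_def)
    qed
    then have "(d has_integral (?x b - ?x a)) UNIV"
      by (rule has_integral_on_superset) (auto simp: d_def J_def)
    with has_integral_integral_lborel[OF int] have "?x b - ?x a = integral\<^sup>L lborel d"
      using has_integral_unique by blast
    then have "dist (cmap c (\<gamma> a)) (cmap c (\<gamma> b)) \<le> (LINT t|lborel. norm (d t))"
      using integral_norm_bound[of lborel d]
      by (simp add: dist_norm norm_minus_commute[of "cmap c (\<gamma> a)"])
    then have "ennreal (m * dist (cmap c (\<gamma> a)) (cmap c (\<gamma> b))) \<le> ennreal m * ennreal (LINT t|lborel. norm (d t))"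
      using m(1) by (simp add: ennreal_mult'[symmetric] ennreal_leI)
    also have "ennreal (LINT t|lborel. norm (d t)) = (\<integral>\<^sup>+ t. ennreal (norm (d t)) \<partial>lborel)"
      using int by (intro nn_integral_eq_integral[symmetric]) auto
    finally show ?thesis using le eq by simp
  qed
qed

text \<open>
  If the curve left the ball, then up to the first exit, seen from the time \<open>t0\<close>, it would cover a
  Euclidean distance of at least \<open>r / 2\<close> within the chart. The base time is arbitrary, so that
  the distance to a point and the distance from a point are covered by one argument.
\<close>

lemma curve_stays_in_ball:
  assumes c: "c \<in> \<A>" and \<gamma>: "pw_C1_curve \<A> \<gamma>" and r: "cball x0 r \<subseteq> cim c"
    and m: "m > 0" "\<And>x u. x \<in> cball x0 r \<Longrightarrow> m * norm u \<le> gnorm g (cinv c x) (coord_vector \<A> c u (cinv c x))"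
    and t0: "t0 \<in> {0..1}" "\<gamma> t0 \<in> cdom c" "dist x0 (cmap c (\<gamma> t0)) \<le> r / 2"
    and short: "glength \<gamma> < ennreal (m * (r / 2))" and t1: "t1 \<in> {0..1}"
  shows "\<gamma> t1 \<in> cinv c ` ball x0 r"
proof (rule ccontr)
  assume out: "\<gamma> t1 \<notin> cinv c ` ball x0 r"
  \<comment> \<open>Walking from \<open>t0\<close> to \<open>t1\<close>, in either direction, turns the exit time into a minimum.\<close>
  define \<sigma> where "\<sigma> u = t0 + u * (t1 - t0)" for u
  have \<sigma>01: "\<sigma> u \<in> {0..1}" if "u \<in> {0..1}" for u
  proof -
    have "convex {0..1::real}" by simp
    from convexD_alt[OF this t0(1) t1, of u] that show ?thesis by (simp add: \<sigma>_def algebra_simps)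
  qed
  have cont\<gamma>: "continuous_on {0..1} \<gamma>" using \<gamma> by (simp add: pw_C1_curve_def)
  have cont: "continuous_on {0..1} (\<lambda>u. \<gamma> (\<sigma> u))"
    by (rule continuous_on_compose2[OF cont\<gamma>]) (use \<sigma>01 in \<open>auto simp: \<sigma>_def intro!: continuous_intros\<close>)
  have ball_eq: "cinv c ` ball x0 r = {q \<in> cdom c. cmap c q \<in> ball x0 r}"
  proof (intro set_eqI iffI)
    fix q assume "q \<in> cinv c ` ball x0 r"
    then obtain x where "x \<in> ball x0 r" "q = cinv c x" by blast
    moreover then have "x \<in> cim c" using r ball_subset_cball by blast
    ultimately show "q \<in> {q \<in> cdom c. cmap c q \<in> ball x0 r}"
      using cmap_cinv[OF c] cinv_in_cdom[OF c] by simp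
  next
    fix q assume "q \<in> {q \<in> cdom c. cmap c q \<in> ball x0 r}"
    then show "q \<in> cinv c ` ball x0 r" using cinv_cmap[OF c] by (metis (no_types, lifting) imageI mem_Collect_eq)
  qed
  have "open {q \<in> cdom c. cmap c q \<in> ball x0 r}"
  proof -
    have "{q \<in> cdom c. cmap c q \<in> ball x0 r} = cmap c -` ball x0 r \<inter> cdom c" by blast
    then show ?thesis
      using continuous_on_cmap[OF c] by (simp only: continuous_on_open_vimage[OF open_cdom[OF c]] open_ball)
  qed
  then have openN: "open (cinv c ` ball x0 r)" unfolding ball_eq .
  have "compact (cinv c ` cball x0 r)"
    by (rule compact_continuous_image[OF continuous_on_subset[OF continuous_on_cinv[OF c] r] compact_cball])
  then have closedC: "closed (cinv c ` cball x0 r)" by (rule compact_imp_closed)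
  define B where "B = {u \<in> {0..1}. \<gamma> (\<sigma> u) \<notin> cinv c ` ball x0 r}"
  have "closed B"
  proof -
    have "B = {0..1} \<inter> (\<lambda>u. \<gamma> (\<sigma> u)) -` (- cinv c ` ball x0 r)" by (auto simp: B_def)
    then show ?thesis
      using continuous_closed_preimage[OF cont closed_atLeastAtMost closed_Compl[OF openN]] by simp
  qed
  moreover have "bounded B" by (rule bounded_subset[of "{0..1}"]) (auto simp: B_def)
  ultimately have "compact B" by (simp add: compact_eq_bounded_closed)
  moreover have "1 \<in> B" using out by (simp add: B_def \<sigma>_def)
  ultimately obtain v where v: "v \<in> B" "\<And>u. u \<in> B \<Longrightarrow> v \<le> u"
    using compact_attains_inf[of B] by blast
  have "r \<ge> 0" using t0(3) zero_le_dist[of x0 "cmap c (\<gamma> t0)"] by linarith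
  have "0 < r"
  proof (rule ccontr)
    assume "\<not> 0 < r" with \<open>r \<ge> 0\<close> short show False by simp
  qed
  have inside: "\<gamma> (\<sigma> u) \<in> cinv c ` ball x0 r" if "0 \<le> u" "u < v" for u
    using that v(2)[of u] v(1) by (force simp: B_def)
  have "\<sigma> 0 = t0" by (simp add: \<sigma>_def)
  have "\<gamma> t0 \<in> cinv c ` ball x0 r" unfolding ball_eq using t0 \<open>0 < r\<close> by auto
  then have "v \<noteq> 0" using v(1) \<open>\<sigma> 0 = t0\<close> by (auto simp: B_def)
  then have v01: "0 < v" "v \<le> 1" using v(1) by (auto simp: B_def)
  have clos: "closure {0..<v} = {0..v}" using v01 by simp
  have "(\<lambda>u. \<gamma> (\<sigma> u)) ` closure {0..<v} \<subseteq> cinv c ` cball x0 r"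
  proof (rule image_closure_subset[OF _ closedC])
    show "continuous_on (closure {0..<v}) (\<lambda>u. \<gamma> (\<sigma> u))"
      unfolding clos by (rule continuous_on_subset[OF cont]) (use v01 in auto)
    show "(\<lambda>u. \<gamma> (\<sigma> u)) ` {0..<v} \<subseteq> cinv c ` cball x0 r"
      using inside ball_subset_cball by fastforce
  qed
  then have inC: "\<gamma> (\<sigma> u) \<in> cdom c \<and> cmap c (\<gamma> (\<sigma> u)) \<in> cball x0 r" if "0 \<le> u" "u \<le> v" for u
  proof -
    have "\<gamma> (\<sigma> u) \<in> cinv c ` cball x0 r"
      using \<open>(\<lambda>u. \<gamma> (\<sigma> u)) ` closure {0..<v} \<subseteq> cinv c ` cball x0 r\<close> that unfolding clos by auto
    then obtain x where "x \<in> cball x0 r" "\<gamma> (\<sigma> u) = cinv c x" by blast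
    then show ?thesis using r cmap_cinv[OF c, of x] cinv_in_cdom[OF c, of x] by (simp add: subset_iff)
  qed
  have "cmap c (\<gamma> (\<sigma> v)) \<notin> ball x0 r"
    using v(1) inC[of v] v01 unfolding B_def ball_eq by auto
  then have "dist (cmap c (\<gamma> t0)) (cmap c (\<gamma> (\<sigma> v))) \<ge> r / 2"
    using t0(3) dist_triangle[of x0 "cmap c (\<gamma> (\<sigma> v))" "cmap c (\<gamma> t0)"] by simp
  then have far: "ennreal (m * (r / 2)) \<le> ennreal (m * dist (cmap c (\<gamma> t0)) (cmap c (\<gamma> (\<sigma> v))))"
    using m(1) by (intro ennreal_leI mult_left_mono) auto
  have seg: "\<exists>u. 0 \<le> u \<and> u \<le> v \<and> t = \<sigma> u" if "t \<in> {min t0 (\<sigma> v)..max t0 (\<sigma> v)}" for t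
  proof -
    have "t \<in> closed_segment (\<sigma> 0) (\<sigma> v)"
      using that \<open>\<sigma> 0 = t0\<close> by (auto simp: closed_segment_eq_real_ivl min_def max_def split: if_splits)
    then obtain w where "0 \<le> w" "w \<le> 1" "t = (1 - w) * \<sigma> 0 + w * \<sigma> v"
      unfolding closed_segment_def by auto
    then show ?thesis
      using v01 by (intro exI[of _ "w * v"]) (auto simp: \<sigma>_def algebra_simps intro: mult_left_le_one_le)
  qed
  have "ennreal (m * dist (cmap c (\<gamma> (min t0 (\<sigma> v)))) (cmap c (\<gamma> (max t0 (\<sigma> v))))) \<le> glength \<gamma>"
  proof (rule length_lower_bound_in_chart[OF c \<gamma> _ _ _ _ _ m])
    show "0 \<le> min t0 (\<sigma> v)" "max t0 (\<sigma> v) \<le> 1" using t0(1) \<sigma>01[of v] v01 by auto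
    fix t assume "t \<in> {min t0 (\<sigma> v)..max t0 (\<sigma> v)}"
    then obtain u where "0 \<le> u" "u \<le> v" "t = \<sigma> u" using seg by blast
    then show "\<gamma> t \<in> cdom c" "cmap c (\<gamma> t) \<in> cball x0 r" using inC by auto
  qed auto
  then have "ennreal (m * dist (cmap c (\<gamma> t0)) (cmap c (\<gamma> (\<sigma> v)))) \<le> glength \<gamma>"
    by (auto simp: min_def max_def dist_commute split: if_splits)
  with far short show False by (meson leD order_trans)
qed

text \<open>
  Curves shorter than \<open>m (r / 2)\<close> stay in the chart, where their length controls the displacement.
  At least one such curve exists, and any other curve is longer than that one.
\<close>

lemma gdist_bounds_chart_distance:
  assumes c: "c \<in> \<A>" and r: "cball x0 r \<subseteq> cim c"
    and m: "m > 0" "\<And>x u. x \<in> cball x0 r \<Longrightarrow> m * norm u \<le> gnorm g (cinv c x) (coord_vector \<A> c u (cinv c x))"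
    and near: "p \<in> cdom c \<and> dist x0 (cmap c p) \<le> r / 2 \<or> q \<in> cdom c \<and> dist x0 (cmap c q) \<le> r / 2"
    and short: "gdist \<A> g p q < ennreal (m * (r / 2))"
  shows "p \<in> cdom c" "q \<in> cdom c" "cmap c p \<in> ball x0 r" "cmap c q \<in> ball x0 r"
    "ennreal (m * dist (cmap c p) (cmap c q)) \<le> gdist \<A> g p q"
proof -
  have curve: "p \<in> cdom c \<and> q \<in> cdom c \<and> cmap c p \<in> ball x0 r \<and> cmap c q \<in> ball x0 r \<and>
      ennreal (m * dist (cmap c p) (cmap c q)) \<le> glength \<gamma>"
    if \<gamma>: "pw_C1_curve \<A> \<gamma>" "\<gamma> 0 = p" "\<gamma> 1 = q" and L: "glength \<gamma> < ennreal (m * (r / 2))" for \<gamma>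
  proof -
    obtain t0 :: real where t0: "t0 \<in> {0..1}" "\<gamma> t0 \<in> cdom c" "dist x0 (cmap c (\<gamma> t0)) \<le> r / 2"
    proof (cases "p \<in> cdom c \<and> dist x0 (cmap c p) \<le> r / 2")
      case True
      then show ?thesis using that[of 0] \<gamma> by simp
    next
      case False
      then have "q \<in> cdom c \<and> dist x0 (cmap c q) \<le> r / 2" using near by blast
      then show ?thesis using that[of 1] \<gamma> by simp
    qed
    have stay: "\<gamma> t \<in> cdom c \<and> cmap c (\<gamma> t) \<in> ball x0 r" if t: "t \<in> {0..1}" for t
    proof -
      have "\<gamma> t \<in> cinv c ` ball x0 r" by (rule curve_stays_in_ball[OF c \<gamma>(1) r m t0 L t])
      then obtain x where x: "x \<in> ball x0 r" "\<gamma> t = cinv c x" by blast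
      then have "x \<in> cim c" using r ball_subset_cball by blast
      then show ?thesis using x cmap_cinv[OF c] cinv_in_cdom[OF c] by simp
    qed
    have "ennreal (m * dist (cmap c (\<gamma> 0)) (cmap c (\<gamma> 1))) \<le> glength \<gamma>"
    proof (rule length_lower_bound_in_chart[OF c \<gamma>(1) _ _ _ _ _ m])
      fix t :: real assume "t \<in> {0..1}"
      then show "\<gamma> t \<in> cdom c" "cmap c (\<gamma> t) \<in> cball x0 r"
        using stay[of t] ball_subset_cball by blast+
    qed auto
    then show ?thesis using stay[of 0] stay[of 1] \<gamma> by simp
  qed
  obtain \<gamma> where \<gamma>: "pw_C1_curve \<A> \<gamma>" "\<gamma> 0 = p" "\<gamma> 1 = q" and L: "glength \<gamma> < ennreal (m * (r / 2))"
    using short unfolding gdist_def by (auto simp: INF_less_iff)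
  have c0: "p \<in> cdom c \<and> q \<in> cdom c \<and> cmap c p \<in> ball x0 r \<and> cmap c q \<in> ball x0 r \<and>
      ennreal (m * dist (cmap c p) (cmap c q)) \<le> glength \<gamma>"
    by (rule curve[OF \<gamma> L])
  then show "p \<in> cdom c" "q \<in> cdom c" "cmap c p \<in> ball x0 r" "cmap c q \<in> ball x0 r" by auto
  show "ennreal (m * dist (cmap c p) (cmap c q)) \<le> gdist \<A> g p q"
    unfolding gdist_def
  proof (rule INF_greatest)
    fix \<eta> assume "\<eta> \<in> {\<gamma>. pw_C1_curve \<A> \<gamma> \<and> \<gamma> 0 = p \<and> \<gamma> 1 = q}"
    then have \<eta>: "pw_C1_curve \<A> \<eta>" "\<eta> 0 = p" "\<eta> 1 = q" by auto
    show "ennreal (m * dist (cmap c p) (cmap c q)) \<le> glength \<eta>"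
    proof (cases "glength \<eta> < ennreal (m * (r / 2))")
      case True
      then show ?thesis using curve[OF \<eta>] by blast
    next
      case False
      have "ennreal (m * dist (cmap c p) (cmap c q)) \<le> glength \<gamma>" using c0 by blast
      also have "\<dots> \<le> ennreal (m * (r / 2))" using L by simp
      also have "\<dots> \<le> glength \<eta>" using False by simp
      finally show ?thesis .
    qed
  qed
qed

lemma metric_ball_in_chart:
  assumes c: "c \<in> \<A>" "p \<in> cdom c" and U: "open U" "p \<in> U"
  obtains r m where "r > 0" "m > 0" "cball (cmap c p) r \<subseteq> cmap c ` (cdom c \<inter> U)"
    "\<And>x u. x \<in> cball (cmap c p) r \<Longrightarrow> m * norm u \<le> gnorm g (cinv c x) (coord_vector \<A> c u (cinv c x))"
proof -
  have "open (cmap c ` (cdom c \<inter> U))" "cmap c p \<in> cmap c ` (cdom c \<inter> U)"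
    using open_overlap[OF c(1) U(1)] c U by auto
  then obtain r where r: "r > 0" "cball (cmap c p) r \<subseteq> cmap c ` (cdom c \<inter> U)"
    using open_contains_cball by blast
  then have "cball (cmap c p) r \<subseteq> cim c" by blast
  from gnorm_lower_bound[OF c(1) compact_cball this] r that show ?thesis by blast
qed

text \<open>
  This links completeness, which speaks of the Riemannian distance, with the topology of the
  manifold.
\<close>

lemma tendsto_if_gdist_tendsto_0:
  assumes "(\<lambda>n. gdist \<A> g (\<sigma> n) q) \<longlonglongrightarrow> 0"
  shows "\<sigma> \<longlonglongrightarrow> q"
proof (rule topological_tendstoI)
  fix U assume U: "open U" "q \<in> U"
  obtain c where c: "c \<in> \<A>" "q \<in> cdom c" by (rule chart_around)
  obtain r m where r: "r > 0" "cball (cmap c q) r \<subseteq> cmap c ` (cdom c \<inter> U)" and m: "m > 0"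
    "\<And>x u. x \<in> cball (cmap c q) r \<Longrightarrow> m * norm u \<le> gnorm g (cinv c x) (coord_vector \<A> c u (cinv c x))"
    using metric_ball_in_chart[OF c U] by metis
  have rc: "cball (cmap c q) r \<subseteq> cim c" using r(2) by blast
  have "0 < ennreal (m * (r / 2))" using r m by simp
  then have "eventually (\<lambda>n. gdist \<A> g (\<sigma> n) q < ennreal (m * (r / 2))) sequentially"
    by (rule order_tendstoD(2)[OF assms])
  then show "eventually (\<lambda>n. \<sigma> n \<in> U) sequentially"
  proof (rule eventually_mono)
    fix n assume n: "gdist \<A> g (\<sigma> n) q < ennreal (m * (r / 2))"
    have near: "\<sigma> n \<in> cdom c \<and> dist (cmap c q) (cmap c (\<sigma> n)) \<le> r / 2
      \<or> q \<in> cdom c \<and> dist (cmap c q) (cmap c q) \<le> r / 2" using c r by simp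
    have "\<sigma> n \<in> cdom c" "cmap c (\<sigma> n) \<in> cball (cmap c q) r"
      using gdist_bounds_chart_distance[OF c(1) rc m near n] by auto
    then obtain p' where "p' \<in> cdom c" "p' \<in> U" "cmap c (\<sigma> n) = cmap c p'" using r(2) by blast
    then show "\<sigma> n \<in> U" using \<open>\<sigma> n \<in> cdom c\<close> c(1) by (metis cinv_cmap)
  qed
qed

text \<open>
  The piece of the curve between \<open>s\<close> and \<open>t\<close>, reparametrised to the unit interval, has speed at most
  \<open>K \<bar>t - s\<bar>\<close>.
\<close>

lemma gdist_integral_curve:
  assumes Y: "smooth_vfield \<A> Y" and K: "\<And>p. gnorm g p (Y p) \<le> K"
    and \<gamma>: "\<And>u. u \<in> closed_segment s t \<Longrightarrow> integral_curve_at Y \<gamma> u"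
  shows "gdist \<A> g (\<gamma> s) (\<gamma> t) \<le> ennreal (K * \<bar>t - s\<bar>)"
proof -
  define \<eta> where "\<eta> u = \<gamma> (s + (t - s) * u)" for u
  have ic: "integral_curve_at (\<lambda>p c. (t - s) *\<^sub>R Y p c) \<eta> u" if "u \<in> {0..1}" for u
    unfolding \<eta>_def using that
    by (intro integral_curve_at_affine \<gamma>) (auto simp: closed_segment_def algebra_simps intro!: exI[of _ u])
  then have cont01: "continuous_on {0..1} \<eta>"
    by (simp add: integral_curve_at_def continuous_at_imp_continuous_on)
  have deriv: "((cmap c \<circ> \<eta>) has_vector_derivative (t - s) *\<^sub>R Y (\<eta> u) c) (at u)"
    if "u \<in> {0..1}" "c \<in> \<A>" "\<eta> u \<in> cdom c" for u c
    using ic[OF that(1)] that(2,3) by (simp add: integral_curve_at_def)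
  have "pw_C1_curve \<A> \<eta>"
    unfolding pw_C1_curve_def
  proof (intro conjI exI[of _ "{}"] ballI)
    fix c assume c: "c \<in> \<A>"
    let ?E = "{u \<in> {0..1} - {}. \<eta> u \<in> cdom c}"
    have "continuous_on ?E (\<lambda>u. Y (cinv c (cmap c (\<eta> u))) c)"
    proof (rule continuous_on_compose2[of "cim c" "\<lambda>x. Y (cinv c x) c"])
      show "continuous_on (cim c) (\<lambda>x. Y (cinv c x) c)"
        using Y c smooth_on_continuous_on unfolding smooth_vfield_def by blast
      show "continuous_on ?E (\<lambda>u. cmap c (\<eta> u))"
        by (rule continuous_on_compose2[OF continuous_on_cmap[OF c]])
          (auto intro: continuous_on_subset[OF cont01])
    qed auto
    then have "continuous_on ?E (\<lambda>u. Y (\<eta> u) c)"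
      by (rule continuous_on_eq) (use c in auto)
    then have "continuous_on ?E (\<lambda>u. (t - s) *\<^sub>R Y (\<eta> u) c)" by (intro continuous_intros)
    moreover have "\<forall>u\<in>?E. ((cmap c \<circ> \<eta>) has_vector_derivative (t - s) *\<^sub>R Y (\<eta> u) c) (at u)"
      using deriv c by auto
    ultimately show "(cmap c \<circ> \<eta>) C1_differentiable_on ?E"
      unfolding C1_differentiable_on_def by (intro exI[of _ "\<lambda>u. (t - s) *\<^sub>R Y (\<eta> u) c"] conjI)
  qed (auto simp: cont01)
  moreover have "\<eta> 0 = \<gamma> s" "\<eta> 1 = \<gamma> t" by (simp_all add: \<eta>_def)
  ultimately have "gdist \<A> g (\<gamma> s) (\<gamma> t) \<le> glength \<eta>"
    unfolding gdist_def by (intro INF_lower) auto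
  also have "glength \<eta> \<le> (\<integral>\<^sup>+ u \<in> {0..1}. ennreal (K * \<bar>t - s\<bar>) \<partial>(lborel :: real measure))"
  proof (rule nn_integral_mono)
    fix u :: real
    have "gnorm g (\<eta> u) (velocity \<A> \<eta> u) \<le> K * \<bar>t - s\<bar>" if u: "u \<in> {0..1}"
    proof -
      have tan: "Y (\<eta> u) \<in> tangent_space \<A> (\<eta> u)" using Y by (simp add: smooth_vfield_def)
      have "velocity \<A> \<eta> u = (\<lambda>c. (t - s) *\<^sub>R Y (\<eta> u) c)"
      proof
        fix c
        show "velocity \<A> \<eta> u c = (t - s) *\<^sub>R Y (\<eta> u) c"
        proof (cases "c \<in> \<A> \<and> \<eta> u \<in> cdom c")
          case True
          then show ?thesis using vector_derivative_at[OF deriv[OF u]] by (simp add: velocity_def)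
        next
          case False
          then have "Y (\<eta> u) c = 0" using tan unfolding tangent_space_def mem_Collect_eq by blast
          then show ?thesis using False by (auto simp: velocity_def)
        qed
      qed
      then have "gnorm g (\<eta> u) (velocity \<A> \<eta> u) = \<bar>t - s\<bar> * gnorm g (\<eta> u) (Y (\<eta> u))"
        using gnorm_scale[OF tan] by simp
      then show ?thesis using K[of "\<eta> u"] by (simp add: mult.commute[of K] mult_left_mono)
    qed
    then show "ennreal (gnorm g (\<eta> u) (velocity \<A> \<eta> u)) * indicator {0..1} u
        \<le> ennreal (K * \<bar>t - s\<bar>) * indicator {0..1} u"
      by (auto simp: indicator_def intro: ennreal_leI)
  qed
  also have "\<dots> = ennreal (K * \<bar>t - s\<bar>)" by (simp add: nn_integral_cmult_indicator)
  finally show ?thesis .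
qed

end

section \<open>Existence of integral curves\<close>

lemma smooth_on_cball_lipschitz:
  fixes F :: "'e::euclidean_space \<Rightarrow> 'e"
  assumes F: "smooth_on S F" and S: "cball x0 r \<subseteq> S"
  obtains L B where "L \<ge> 0" "B \<ge> 0"
    "\<And>x y. x \<in> cball x0 r \<Longrightarrow> y \<in> cball x0 r \<Longrightarrow> norm (F x - F y) \<le> L * norm (x - y)"
    "\<And>x. x \<in> cball x0 r \<Longrightarrow> norm (F x) \<le> B"
proof -
  have bdd: "\<exists>C\<ge>0. \<forall>x\<in>cball x0 r. norm (h x) \<le> C" if "continuous_on S h" for h :: "'e \<Rightarrow> 'e"
  proof -
    have "bounded (h ` cball x0 r)"
      by (intro compact_imp_bounded compact_continuous_image compact_cball continuous_on_subset[OF that S])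
    then obtain C where C: "\<forall>y\<in>h ` cball x0 r. norm y \<le> C" unfolding bounded_iff by blast
    then show ?thesis by (intro exI[of _ "max C 0"]) (simp add: le_max_iff_disj)
  qed
  obtain B where B: "B \<ge> 0" "\<forall>x\<in>cball x0 r. norm (F x) \<le> B"
    using bdd[OF smooth_on_continuous_on[OF F]] by blast
  have "\<forall>b. \<exists>C\<ge>0. \<forall>x\<in>cball x0 r. norm (frechet_derivative F (at x) b) \<le> C"
    using bdd smooth_on_continuous_on smooth_on_deriv[OF F] by blast
  then obtain C where C: "\<And>b. C b \<ge> 0" "\<And>b x. x \<in> cball x0 r \<Longrightarrow> norm (frechet_derivative F (at x) b) \<le> C b"
    by metis
  define L where "L = (\<Sum>b\<in>(Basis :: 'e set). C b)"
  have L: "L \<ge> 0" unfolding L_def by (intro sum_nonneg C)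
  have lip: "norm (F x - F y) \<le> L * norm (x - y)" if x: "x \<in> cball x0 r" and y: "y \<in> cball x0 r" for x y
  proof (rule differentiable_bound[OF convex_cball _ _ x y])
    fix z assume z: "z \<in> cball x0 r"
    then have zS: "z \<in> S" using S by auto
    show "(F has_derivative frechet_derivative F (at z)) (at z within cball x0 r)"
      using smooth_on_has_derivative[OF F zS] has_derivative_at_withinI by blast
    show "onorm (frechet_derivative F (at z)) \<le> L"
    proof (rule onorm_le)
      fix v
      have "norm (frechet_derivative F (at z) v) = norm (\<Sum>b\<in>Basis. (v \<bullet> b) *\<^sub>R frechet_derivative F (at z) b)"
        using frechet_derivative_Basis_expand[OF smooth_on_differentiable[OF F zS], of v] by simp
      also have "\<dots> \<le> (\<Sum>b\<in>Basis. norm v * C b)"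
      proof (rule sum_norm_le)
        fix b :: 'e assume "b \<in> Basis"
        then show "norm ((v \<bullet> b) *\<^sub>R frechet_derivative F (at z) b) \<le> norm v * C b"
          using C(2)[OF z, of b] Basis_le_norm[of b v] by (simp add: mult_mono)
      qed
      also have "\<dots> = L * norm v" by (simp add: L_def sum_distrib_left mult.commute)
      finally show "norm (frechet_derivative F (at z) v) \<le> L * norm v" .
    qed
  qed
  show ?thesis by (rule that[OF L B(1)]) (use lip B in auto)
qed

text \<open>
  The contraction principle for the integral equation, on bounded continuous functions on the whole
  line with the time clamped to \<open>{- \<delta>..\<delta>}\<close>. The integral from \<open>0\<close> to \<open>t\<close> is written as a difference of two
  integrals from \<open>- \<delta>\<close>, which treats both signs of \<open>t\<close> alike; two intervals of length at most \<open>2 \<delta>\<close>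
  account for the factor \<open>4\<close>.
\<close>

lemma picard:
  fixes F :: "'e::euclidean_space \<Rightarrow> 'e"
  assumes L: "L \<ge> 0" "\<And>x y. norm (F x - F y) \<le> L * norm (x - y)"
    and B: "B \<ge> 0" "\<And>x. norm (F x) \<le> B" and \<delta>: "\<delta> > 0" "8 * \<delta> * L \<le> 1"
  shows "\<exists>u. u 0 = x \<and> (\<forall>t. norm (u t - x) \<le> 4 * \<delta> * B) \<and>
    (\<forall>t. \<bar>t\<bar> < \<delta> \<longrightarrow> (u has_vector_derivative F (u t)) (at t))"
proof -
  have contF: "continuous_on UNIV F"
  proof (rule lipschitz_on_continuous_on)
    show "L-lipschitz_on UNIV F" using L by (auto simp: lipschitz_on_def dist_norm)
  qed
  define cl where "cl t = max (- \<delta>) (min t \<delta>)" for t :: real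
  have cl: "cl t \<in> {- \<delta>..\<delta>}" for t using \<delta>(1) by (auto simp: cl_def)
  have contcl: "continuous_on UNIV cl" unfolding cl_def by (intro continuous_intros)
  define I where "I w t = integral {- \<delta>..cl t} (\<lambda>s. F (apply_bcontfun w s))
      - integral {- \<delta>..0} (\<lambda>s. F (apply_bcontfun w s))" for w :: "real \<Rightarrow>\<^sub>C 'e" and t
  have conth: "continuous_on A (\<lambda>s. F (apply_bcontfun w s))" for w :: "real \<Rightarrow>\<^sub>C 'e" and A
    by (rule continuous_on_compose2[OF contF]) auto
  have int1: "norm (integral {- \<delta>..t} (\<lambda>s. F (apply_bcontfun w s))) \<le> 2 * \<delta> * B"
    if "t \<in> {- \<delta>..\<delta>}" for t and w :: "real \<Rightarrow>\<^sub>C 'e"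
  proof -
    have "norm (integral {- \<delta>..t} (\<lambda>s. F (apply_bcontfun w s))) \<le> B * (t - - \<delta>)"
      using that B by (intro integral_bound conth) auto
    also have "\<dots> \<le> B * (2 * \<delta>)" using that B(1) by (intro mult_left_mono) auto
    finally show ?thesis by (simp add: mult.commute)
  qed
  have Ibound: "norm (I w t) \<le> 4 * \<delta> * B" for w t
    using norm_triangle_ineq4[of "integral {- \<delta>..cl t} (\<lambda>s. F (apply_bcontfun w s))"
        "integral {- \<delta>..0} (\<lambda>s. F (apply_bcontfun w s))"] int1[OF cl, of t w] int1[of 0 w] \<delta>(1)
    by (simp add: I_def)
  have Icont: "continuous_on UNIV (I w)" for w
  proof -
    have "continuous_on {- \<delta>..\<delta>} (\<lambda>t. integral {- \<delta>..t} (\<lambda>s. F (apply_bcontfun w s)))"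
      by (intro indefinite_integral_continuous_1 integrable_continuous_real conth)
    then have "continuous_on UNIV (\<lambda>t. integral {- \<delta>..cl t} (\<lambda>s. F (apply_bcontfun w s)))"
      by (rule continuous_on_compose2[OF _ contcl]) (use cl in auto)
    then show ?thesis unfolding I_def by (intro continuous_intros)
  qed
  define \<Phi> where "\<Phi> w = Bcontfun (\<lambda>t. x + I w t)" for w
  have \<Phi>: "apply_bcontfun (\<Phi> w) = (\<lambda>t. x + I w t)" for w
    unfolding \<Phi>_def
  proof (rule Bcontfun_inverse, rule bcontfun_normI)
    show "continuous_on UNIV (\<lambda>t. x + I w t)" by (intro continuous_intros Icont)
    show "norm (x + I w t) \<le> norm x + 4 * \<delta> * B" for t
      using norm_triangle_ineq[of x "I w t"] Ibound[of w t] by linarith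
  qed
  have diff: "norm (integral {- \<delta>..t} (\<lambda>s. F (apply_bcontfun w s)) - integral {- \<delta>..t} (\<lambda>s. F (apply_bcontfun v s)))
      \<le> 2 * \<delta> * (L * dist w v)" if t: "t \<in> {- \<delta>..\<delta>}" for t w v
  proof -
    have "integral {- \<delta>..t} (\<lambda>s. F (apply_bcontfun w s)) - integral {- \<delta>..t} (\<lambda>s. F (apply_bcontfun v s))
        = integral {- \<delta>..t} (\<lambda>s. F (apply_bcontfun w s) - F (apply_bcontfun v s))"
      by (intro integral_diff[symmetric] integrable_continuous_real conth)
    also have "norm \<dots> \<le> (L * dist w v) * (t - - \<delta>)"
    proof (rule integral_bound)
      fix s
      have "norm (F (apply_bcontfun w s) - F (apply_bcontfun v s)) \<le> L * dist (apply_bcontfun w s) (apply_bcontfun v s)"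
        using L(2) by (simp add: dist_norm)
      also have "\<dots> \<le> L * dist w v" by (intro mult_left_mono dist_bounded L)
      finally show "norm (F (apply_bcontfun w s) - F (apply_bcontfun v s)) \<le> L * dist w v" .
    qed (use t in \<open>auto intro: continuous_intros conth\<close>)
    also have "\<dots> \<le> (L * dist w v) * (2 * \<delta>)"
      using t L(1) by (intro mult_left_mono) auto
    finally show ?thesis by (simp add: mult.commute)
  qed
  have contr: "dist (\<Phi> w) (\<Phi> v) \<le> (1 / 2) * dist w v" for w v
  proof (rule dist_bound)
    fix t
    have "dist (apply_bcontfun (\<Phi> w) t) (apply_bcontfun (\<Phi> v) t) = norm (I w t - I v t)"
      by (simp add: \<Phi> dist_norm)
    also have "I w t - I v t
        = (integral {- \<delta>..cl t} (\<lambda>s. F (apply_bcontfun w s)) - integral {- \<delta>..cl t} (\<lambda>s. F (apply_bcontfun v s)))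
        - (integral {- \<delta>..0} (\<lambda>s. F (apply_bcontfun w s)) - integral {- \<delta>..0} (\<lambda>s. F (apply_bcontfun v s)))"
      by (simp add: I_def)
    also have "norm \<dots> \<le> 2 * \<delta> * (L * dist w v) + 2 * \<delta> * (L * dist w v)"
      by (intro order_trans[OF norm_triangle_ineq4] add_mono diff cl) (use \<delta>(1) in auto)
    also have "\<dots> = (8 * \<delta> * L) * dist w v / 2" by simp
    also have "\<dots> \<le> 1 * dist w v / 2" using \<delta>(2) by (intro divide_right_mono mult_right_mono) auto
    finally show "dist (apply_bcontfun (\<Phi> w) t) (apply_bcontfun (\<Phi> v) t) \<le> (1 / 2) * dist w v" by simp
  qed
  have "\<exists>!w. \<Phi> w = w" by (rule banach_fix_type[of "1 / 2"]) (use contr in auto)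
  then obtain w where w: "\<Phi> w = w" by blast
  define u where "u = apply_bcontfun w"
  have u: "u t = x + I w t" for t using \<Phi>[of w] w by (metis u_def)
  show ?thesis
  proof (intro exI[of _ u] conjI allI impI)
    show "u 0 = x" using \<delta>(1) by (simp add: u I_def cl_def)
    show "norm (u t - x) \<le> 4 * \<delta> * B" for t using Ibound by (simp add: u)
    fix t assume t: "\<bar>t\<bar> < \<delta>"
    have "((\<lambda>t. integral {- \<delta>..t} (\<lambda>s. F (u s))) has_vector_derivative F (u t)) (at t within {- \<delta>..\<delta>})"
      unfolding u_def by (rule integral_has_vector_derivative[OF conth]) (use t in auto)
    moreover have "at t within {- \<delta>..\<delta>} = at t" by (rule at_within_interior) (use t in auto)
    ultimately have "((\<lambda>t. x + (integral {- \<delta>..t} (\<lambda>s. F (u s)) - integral {- \<delta>..0} (\<lambda>s. F (u s))))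
        has_vector_derivative F (u t)) (at t)"
      by (auto intro!: derivative_eq_intros)
    then show "(u has_vector_derivative F (u t)) (at t)"
    proof (rule has_vector_derivative_transform_within_open)
      show "open {- \<delta><..<\<delta>}" "t \<in> {- \<delta><..<\<delta>}" using t by auto
      fix s assume "s \<in> {- \<delta><..<\<delta>}"
      then have "cl s = s" by (simp add: cl_def)
      then show "x + (integral {- \<delta>..s} (\<lambda>s. F (u s)) - integral {- \<delta>..0} (\<lambda>s. F (u s))) = u s"
        using u[of s] by (simp add: I_def u_def[symmetric])
    qed
  qed
qed

context smooth_manifold
begin

lemma integral_curve_atI:
  assumes Y: "smooth_vfield \<A> Y" and cont: "isCont \<gamma> t" and c: "c \<in> \<A>" "\<gamma> t \<in> cdom c"
    and D: "((cmap c \<circ> \<gamma>) has_vector_derivative Y (\<gamma> t) c) (at t)"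
  shows "integral_curve_at Y \<gamma> t"
  unfolding integral_curve_at_def
proof (intro conjI cont ballI impI)
  fix c' assume c': "c' \<in> \<A>" "\<gamma> t \<in> cdom c'"
  have tan: "Y (\<gamma> t) \<in> tangent_space \<A> (\<gamma> t)" using Y by (simp add: smooth_vfield_def)
  have "((\<lambda>t. cmap c' (\<gamma> t)) has_vector_derivative
      frechet_derivative (cmap c' \<circ> cinv c) (at (cmap c (\<gamma> t))) (Y (\<gamma> t) c)) (at t)"
    by (rule has_derivative_along_curve[OF c cont D transition_has_derivative[OF c(1) c'(1) c(2) c'(2)]])
  then show "((cmap c' \<circ> \<gamma>) has_vector_derivative Y (\<gamma> t) c') (at t)"
    using tangent_space_change[OF tan c(1) c'(1) c(2) c'(2)] by (simp add: o_def)
qed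

lemma integral_curve_at_cong:
  assumes "open U" "t \<in> U" "\<And>s. s \<in> U \<Longrightarrow> \<gamma> s = \<eta> s" "integral_curve_at Y \<gamma> t"
  shows "integral_curve_at Y \<eta> t"
proof -
  have ev: "eventually (\<lambda>s. \<gamma> s = \<eta> s) (nhds t)"
    using assms(1-3) unfolding eventually_nhds by blast
  have "isCont \<eta> t" using assms(4) isCont_cong[OF ev] by (simp add: integral_curve_at_def)
  moreover have "((cmap c \<circ> \<eta>) has_vector_derivative Y (\<eta> t) c) (at t)"
    if "c \<in> \<A>" "\<eta> t \<in> cdom c" for c
  proof (rule has_vector_derivative_transform_within_open[OF _ assms(1,2)])
    show "((cmap c \<circ> \<gamma>) has_vector_derivative Y (\<eta> t) c) (at t)"
      using assms(4) that assms(3)[OF assms(2)] by (simp add: integral_curve_at_def)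
  qed (use assms(3) in simp)
  ultimately show ?thesis by (simp add: integral_curve_at_def)
qed

lemma integral_curve_at_glue:
  assumes l: "t \<le> a \<Longrightarrow> integral_curve_at Y \<gamma> t" and r: "t \<ge> a \<Longrightarrow> integral_curve_at Y \<eta> t"
    and eq: "\<gamma> a = \<eta> a"
  shows "integral_curve_at Y (\<lambda>s. if s \<le> a then \<gamma> s else \<eta> s) t"
proof -
  consider "t < a" | "t > a" | "t = a" by linarith
  then show ?thesis
  proof cases
    case 1
    show ?thesis by (rule integral_curve_at_cong[of "{..<a}" t \<gamma>, OF _ _ _ l]) (use 1 in simp_all)
  next
    case 2
    show ?thesis by (rule integral_curve_at_cong[of "{a<..}" t \<eta>, OF _ _ _ r]) (use 2 in simp_all)
  next
    case 3
    have ic: "integral_curve_at Y \<gamma> a" "integral_curve_at Y \<eta> a" using l r 3 by auto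
    have "isCont (\<lambda>s. if s \<le> a then \<gamma> s else \<eta> s) a"
    proof (rule isCont_If_ge)
      show "continuous (at_left a) \<gamma>"
        using ic(1) by (auto simp: integral_curve_at_def intro: continuous_at_imp_continuous_at_within)
      have "(\<eta> \<longlongrightarrow> \<eta> a) (at a)" using ic(2) by (simp add: integral_curve_at_def isCont_def)
      then show "(\<eta> \<longlongrightarrow> \<gamma> a) (at_right a)" unfolding eq by (rule tendsto_within_subset) simp
    qed
    moreover have "((cmap c \<circ> (\<lambda>s. if s \<le> a then \<gamma> s else \<eta> s)) has_vector_derivative Y (\<gamma> a) c) (at a)"
      if c: "c \<in> \<A>" "\<gamma> a \<in> cdom c" for c
    proof -
      have "((\<lambda>s. if s \<in> {..a} then (cmap c \<circ> \<gamma>) s else (cmap c \<circ> \<eta>) s) has_vector_derivative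
          (if a \<in> {..a} then Y (\<gamma> a) c else Y (\<gamma> a) c)) (at a within UNIV)"
      proof (rule has_vector_derivative_If_within_closures)
        show "((cmap c \<circ> \<gamma>) has_vector_derivative Y (\<gamma> a) c) (at a within {..a} \<union> closure {..a} \<inter> closure {a..})"
          using ic(1) c unfolding integral_curve_at_def by (blast intro: has_vector_derivative_at_within)
        show "((cmap c \<circ> \<eta>) has_vector_derivative Y (\<gamma> a) c) (at a within {a..} \<union> closure {..a} \<inter> closure {a..})"
          using ic(2) c unfolding integral_curve_at_def eq by (blast intro: has_vector_derivative_at_within)
      qed (auto simp: eq)
      moreover have "cmap c \<circ> (\<lambda>s. if s \<le> a then \<gamma> s else \<eta> s)
          = (\<lambda>s. if s \<in> {..a} then (cmap c \<circ> \<gamma>) s else (cmap c \<circ> \<eta>) s)"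
        by (rule ext) simp
      ultimately show ?thesis by (simp only: if_cancel)
    qed
    ultimately show ?thesis unfolding 3 integral_curve_at_def by simp
  qed
qed

text \<open>
  Composed with the nearest point projection onto a ball in a chart, the vector field becomes globally
  bounded and Lipschitz. The solutions of the modified equation do not leave the ball within a time
  that is the same for all starting points near \<open>p\<close>, and there they solve the original equation.
\<close>

lemma local_integral_curves:
  assumes Y: "smooth_vfield \<A> Y"
  shows "\<exists>U \<delta>. open U \<and> p \<in> U \<and> \<delta> > 0 \<and>
    (\<forall>q\<in>U. \<exists>\<gamma>. \<gamma> 0 = q \<and> (\<forall>t. \<bar>t\<bar> < \<delta> \<longrightarrow> integral_curve_at Y \<gamma> t))"
proof -
  obtain c where c: "c \<in> \<A>" "p \<in> cdom c" by (rule chart_around)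
  define x0 where "x0 = cmap c p"
  have "x0 \<in> cim c" using c by (simp add: x0_def)
  then obtain R where R: "R > 0" "cball x0 R \<subseteq> cim c"
    using open_cim[OF c(1)] open_contains_cball by blast
  define F where "F x = Y (cinv c x) c" for x
  have F: "smooth_on (cim c) F" using Y c by (simp add: smooth_vfield_def F_def[abs_def])
  obtain L B where L: "L \<ge> 0" "B \<ge> 0"
    "\<And>x y. x \<in> cball x0 R \<Longrightarrow> y \<in> cball x0 R \<Longrightarrow> norm (F x - F y) \<le> L * norm (x - y)"
    "\<And>x. x \<in> cball x0 R \<Longrightarrow> norm (F x) \<le> B"
    using smooth_on_cball_lipschitz[OF F R(2)] by metis
  define P where "P = closest_point (cball x0 R)"
  have ball: "convex (cball x0 R)" "closed (cball x0 R)" "cball x0 R \<noteq> {}" using R by auto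
  have P: "P x \<in> cball x0 R" for x unfolding P_def by (rule closest_point_in_set[OF ball(2,3)])
  have Plip: "norm (P x - P y) \<le> norm (x - y)" for x y
    using closest_point_lipschitz[OF ball, of x y] by (simp add: P_def dist_norm)
  have FP: "norm (F (P x) - F (P y)) \<le> L * norm (x - y)" for x y
    using L(3)[OF P P, of x y] mult_left_mono[OF Plip L(1), of x y] by linarith
  \<comment> \<open>The first bound makes the Picard map a contraction, the second keeps solutions that start in
    the ball of radius \<open>R / 2\<close> inside the ball of radius \<open>R\<close>.\<close>
  define \<delta> where "\<delta> = min (1 / (8 * (L + 1))) (R / (8 * (B + 1)))"
  have \<delta>: "\<delta> > 0" using L R by (simp add: \<delta>_def)
  have \<delta>L: "8 * \<delta> * L \<le> 1"
  proof -
    have "8 * \<delta> * L \<le> 8 * (1 / (8 * (L + 1))) * L"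
      using L by (intro mult_right_mono mult_left_mono) (auto simp: \<delta>_def)
    also have "\<dots> \<le> 1" using L by (simp add: field_simps)
    finally show ?thesis .
  qed
  have \<delta>B: "4 * \<delta> * B \<le> R / 2"
  proof -
    have "4 * \<delta> * B \<le> 4 * (R / (8 * (B + 1))) * B"
      using L by (intro mult_right_mono mult_left_mono) (auto simp: \<delta>_def)
    also have "\<dots> \<le> R / 2" using L R by (simp add: field_simps)
    finally show ?thesis .
  qed
  define U where "U = cmap c -` ball x0 (R / 2) \<inter> cdom c"
  have "open U" unfolding U_def
    using continuous_on_cmap[OF c(1)] by (simp only: continuous_on_open_vimage[OF open_cdom[OF c(1)]] open_ball)
  moreover have "p \<in> U" using c R by (simp add: U_def x0_def)
  moreover have "\<exists>\<gamma>. \<gamma> 0 = q \<and> (\<forall>t. \<bar>t\<bar> < \<delta> \<longrightarrow> integral_curve_at Y \<gamma> t)" if q: "q \<in> U" for q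
  proof -
    have bdd: "norm (F (P x)) \<le> B" for x by (rule L(4)[OF P])
    obtain u where u: "u 0 = cmap c q" "\<And>t. norm (u t - cmap c q) \<le> 4 * \<delta> * B"
      "\<And>t. \<bar>t\<bar> < \<delta> \<Longrightarrow> (u has_vector_derivative F (P (u t))) (at t)"
      using picard[of L "\<lambda>x. F (P x)" B \<delta> "cmap c q", OF L(1) FP L(2) bdd \<delta> \<delta>L] by blast
    have uball: "u t \<in> cball x0 R" for t
    proof -
      have "dist x0 (cmap c q) < R / 2" using q by (simp add: U_def)
      moreover have "dist (cmap c q) (u t) \<le> R / 2"
        using u(2)[of t] \<delta>B by (simp add: dist_norm norm_minus_commute)
      ultimately show ?thesis using dist_triangle[of x0 "u t" "cmap c q"] by simp
    qed
    then have uim: "u t \<in> cim c" for t using R(2) by blast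
    define \<gamma> where "\<gamma> t = cinv c (u t)" for t
    have "\<gamma> 0 = q" using u(1) q c by (simp add: \<gamma>_def U_def)
    moreover have "integral_curve_at Y \<gamma> t" if t: "\<bar>t\<bar> < \<delta>" for t
    proof (rule integral_curve_atI[OF Y _ c(1)])
      have "isCont u t" using u(3)[OF t] has_vector_derivative_continuous by blast
      moreover have "isCont (cinv c) (u t)"
        using continuous_on_cinv[OF c(1)] continuous_on_eq_continuous_at[OF open_cim[OF c(1)]] uim by blast
      ultimately show "isCont \<gamma> t" unfolding \<gamma>_def by (rule isCont_o2)
      show "\<gamma> t \<in> cdom c" unfolding \<gamma>_def by (rule cinv_in_cdom[OF c(1) uim])
      have "cmap c \<circ> \<gamma> = u" using cmap_cinv[OF c(1) uim] by (auto simp: \<gamma>_def)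
      moreover have "F (P (u t)) = Y (\<gamma> t) c"
        using closest_point_self[OF uball] by (simp add: P_def F_def \<gamma>_def)
      ultimately show "((cmap c \<circ> \<gamma>) has_vector_derivative Y (\<gamma> t) c) (at t)"
        using u(3)[OF t] by simp
    qed
    ultimately show ?thesis by blast
  qed
  ultimately show ?thesis using \<delta> by blast
qed

text \<open>
  The cap \<open>e \<le> 1\<close> keeps the supremum finite, and half of the supremum is a time that is attained.
\<close>

definition existence_time :: "('m, 'e) vfield \<Rightarrow> 'm \<Rightarrow> real" where
  "existence_time Y q =
     Sup {e. 0 < e \<and> e \<le> 1 \<and> (\<exists>\<gamma>. \<gamma> 0 = q \<and> (\<forall>t. \<bar>t\<bar> < e \<longrightarrow> integral_curve_at Y \<gamma> t))} / 2"

lemma existence_time_lower: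
  assumes "\<gamma> 0 = q" "\<And>t. \<bar>t\<bar> < e \<Longrightarrow> integral_curve_at Y \<gamma> t" "e > 0"
  shows "min e 1 / 2 \<le> existence_time Y q"
proof -
  have "min e 1 \<in> {e. 0 < e \<and> e \<le> 1 \<and> (\<exists>\<gamma>. \<gamma> 0 = q \<and> (\<forall>t. \<bar>t\<bar> < e \<longrightarrow> integral_curve_at Y \<gamma> t))}"
    using assms by (auto intro!: exI[of _ \<gamma>])
  then have "min e 1 \<le> Sup {e. 0 < e \<and> e \<le> 1 \<and> (\<exists>\<gamma>. \<gamma> 0 = q \<and> (\<forall>t. \<bar>t\<bar> < e \<longrightarrow> integral_curve_at Y \<gamma> t))}"
    by (rule cSup_upper) (rule bdd_aboveI[of _ 1], blast)
  then show ?thesis by (simp add: existence_time_def)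
qed

lemma existence_time_locally_bounded_below:
  assumes "smooth_vfield \<A> Y"
  shows "\<exists>U \<delta>. open U \<and> p \<in> U \<and> \<delta> > 0 \<and> (\<forall>q\<in>U. \<delta> \<le> existence_time Y q)"
proof -
  obtain U \<delta> where U: "open U" "p \<in> U" "\<delta> > 0"
    "\<forall>q\<in>U. \<exists>\<gamma>. \<gamma> 0 = q \<and> (\<forall>t. \<bar>t\<bar> < \<delta> \<longrightarrow> integral_curve_at Y \<gamma> t)"
    using local_integral_curves[OF assms, of p] by blast
  have "min \<delta> 1 / 2 \<le> existence_time Y q" if q: "q \<in> U" for q
  proof -
    obtain \<gamma> where "\<gamma> 0 = q" "\<forall>t. \<bar>t\<bar> < \<delta> \<longrightarrow> integral_curve_at Y \<gamma> t" using U(4) q by blast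
    then show ?thesis using existence_time_lower[of \<gamma> q \<delta> Y] U(3) by blast
  qed
  moreover have "min \<delta> 1 / 2 > 0" using U(3) by simp
  ultimately show ?thesis using U(1,2) by blast
qed

lemma existence_time_attained:
  assumes Y: "smooth_vfield \<A> Y"
  shows "0 < existence_time Y q"
    "\<exists>\<gamma>. \<gamma> 0 = q \<and> (\<forall>t. \<bar>t\<bar> < existence_time Y q \<longrightarrow> integral_curve_at Y \<gamma> t)"
proof -
  show pos: "0 < existence_time Y q"
    using existence_time_locally_bounded_below[OF Y, of q] by force
  let ?E = "{e. 0 < e \<and> e \<le> 1 \<and> (\<exists>\<gamma>. \<gamma> 0 = q \<and> (\<forall>t. \<bar>t\<bar> < e \<longrightarrow> integral_curve_at Y \<gamma> t))}"
  have ne: "?E \<noteq> {}"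
  proof -
    obtain U \<delta> where "q \<in> U" "\<delta> > 0"
      "\<forall>q\<in>U. \<exists>\<gamma>. \<gamma> 0 = q \<and> (\<forall>t. \<bar>t\<bar> < \<delta> \<longrightarrow> integral_curve_at Y \<gamma> t)"
      using local_integral_curves[OF Y, of q] by blast
    then obtain \<gamma> where "\<gamma> 0 = q" "\<forall>t. \<bar>t\<bar> < \<delta> \<longrightarrow> integral_curve_at Y \<gamma> t" by blast
    then have "min \<delta> 1 \<in> ?E" using \<open>\<delta> > 0\<close> by auto
    then show ?thesis by blast
  qed
  have "existence_time Y q < Sup ?E" using pos by (simp add: existence_time_def)
  then obtain e where "e \<in> ?E" "existence_time Y q < e" using less_cSupE[OF _ ne] by blast
  then show "\<exists>\<gamma>. \<gamma> 0 = q \<and> (\<forall>t. \<bar>t\<bar> < existence_time Y q \<longrightarrow> integral_curve_at Y \<gamma> t)"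
    by fastforce
qed

end

context riemannian_manifold
begin

text \<open>
  Local solutions are concatenated greedily: each step advances by half of the existence time at the
  point that has been reached. If the times \<open>T n\<close> were bounded, then the points reached would form a
  Cauchy sequence, because the speed is bounded. But near its limit the existence time is bounded
  below, and the steps could not tend to zero.
\<close>

lemma forward_integral_curve:
  assumes complete: "complete_metric \<A> g" and Y: "smooth_vfield \<A> Y"
    and K: "\<And>p. gnorm g p (Y p) \<le> K"
  shows "\<exists>\<gamma> e. \<gamma> 0 = p \<and> e > 0 \<and> (\<forall>t > - e. integral_curve_at Y \<gamma> t)"
proof -
  let ?\<epsilon> = "existence_time Y"
  have "\<forall>q. \<exists>\<gamma>. \<gamma> 0 = q \<and> (\<forall>t. \<bar>t\<bar> < ?\<epsilon> q \<longrightarrow> integral_curve_at Y \<gamma> t)"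
    using existence_time_attained(2)[OF Y] by blast
  then obtain \<Gamma> where \<Gamma>0: "\<And>q. \<Gamma> q 0 = q"
    and \<Gamma>: "\<And>q t. \<bar>t\<bar> < ?\<epsilon> q \<Longrightarrow> integral_curve_at Y (\<Gamma> q) t" by metis
  have \<epsilon>pos: "0 < ?\<epsilon> q" for q by (rule existence_time_attained(1)[OF Y])
  \<comment> \<open>The state of the construction: the time reached so far and the curve constructed so far.\<close>
  define step where "step z = (let t' = fst z + ?\<epsilon> (snd z (fst z)) / 2 in
    (t', \<lambda>u. if u \<le> t' then snd z u else \<Gamma> (snd z t') (u - t')))" for z :: "real \<times> (real \<Rightarrow> 'm)"
  define T where "T n = fst ((step ^^ n) (0, \<Gamma> p))" for n
  define C where "C n = snd ((step ^^ n) (0, \<Gamma> p))" for n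
  have T0: "T 0 = 0" and C0: "C 0 = \<Gamma> p" by (simp_all add: T_def C_def)
  have TS: "T (Suc n) = T n + ?\<epsilon> (C n (T n)) / 2" for n
    by (simp add: T_def C_def step_def Let_def)
  have CS: "C (Suc n) = (\<lambda>u. if u \<le> T (Suc n) then C n u else \<Gamma> (C n (T (Suc n))) (u - T (Suc n)))" for n
  proof -
    have "C (Suc n) = snd (step ((step ^^ n) (0, \<Gamma> p)))" by (simp add: C_def)
    also have "\<dots> = (\<lambda>u. if u \<le> T n + ?\<epsilon> (C n (T n)) / 2 then C n u
        else \<Gamma> (C n (T n + ?\<epsilon> (C n (T n)) / 2)) (u - (T n + ?\<epsilon> (C n (T n)) / 2)))"
      unfolding step_def Let_def fst_conv snd_conv T_def C_def by (rule refl)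
    finally show ?thesis unfolding TS .
  qed
  have Tless: "T n < T (Suc n)" for n using \<epsilon>pos[of "C n (T n)"] by (simp add: TS)
  have Tmono: "T n \<le> T m" if "n \<le> m" for n m
    by (rule lift_Suc_mono_le[of T, OF less_imp_le[OF Tless] that])
  have agree: "C m u = C n u" if "n \<le> m" "u \<le> T (Suc n)" for n m u
    using that(1)
  proof (induction m rule: dec_induct)
    case (step m)
    have "u \<le> T (Suc m)" using that(2) Tmono[of "Suc n" "Suc m"] step.hyps by simp
    then show ?case using step.IH by (simp add: CS)
  qed simp
  have solves: "- ?\<epsilon> p < u \<Longrightarrow> u < T n + ?\<epsilon> (C n (T n)) \<Longrightarrow> integral_curve_at Y (C n) u" for n u
  proof (induction n arbitrary: u)
    case 0
    then show ?case by (simp add: T0 C0 \<Gamma>0 \<Gamma>)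
  next
    case (Suc n)
    define t' where "t' = T (Suc n)"
    define q where "q = C n t'"
    have t': "T n < t'" "t' < T n + ?\<epsilon> (C n (T n))"
      using \<epsilon>pos[of "C n (T n)"] by (simp_all add: t'_def TS)
    have Cq: "C (Suc n) (T (Suc n)) = q" by (simp add: CS q_def t'_def)
    have "integral_curve_at Y (\<lambda>u. if u \<le> t' then C n u else \<Gamma> q (u - t')) u"
    proof (rule integral_curve_at_glue)
      show "integral_curve_at Y (C n) u" if "u \<le> t'" using Suc.IH[of u] Suc.prems(1) that t' by simp
      show "C n t' = \<Gamma> q (t' - t')" by (simp add: \<Gamma>0 q_def)
      assume "t' \<le> u"
      then have "\<bar>- t' + 1 * u\<bar> < ?\<epsilon> q" using Suc.prems(2) unfolding Cq by (simp add: t'_def)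
      from integral_curve_at_affine[OF \<Gamma>[OF this]]
      show "integral_curve_at Y (\<lambda>u. \<Gamma> q (u - t')) u" by simp
    qed
    then show ?case unfolding CS t'_def q_def .
  qed
  have unbounded: "\<exists>n. b < T n" for b
  proof (rule ccontr)
    assume "\<nexists>n. b < T n"
    then have Tb: "T n \<le> b" for n by (meson leI)
    have "incseq T" using Tmono by (simp add: incseq_def)
    then obtain l where l: "T \<longlonglongrightarrow> l" using incseq_convergent[of T b] Tb by blast
    define q where "q n = C n (T n)" for n
    have dist: "gdist \<A> g (q m) (q n) \<le> ennreal (\<bar>K\<bar> * \<bar>T n - T m\<bar>)" for m n
    proof -
      define k where "k = max m n"
      have "T 0 \<le> T m" "T 0 \<le> T n" "T m \<le> T k" "T n \<le> T k" by (simp_all add: Tmono k_def)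
      then have seg: "integral_curve_at Y (C k) u" if "u \<in> closed_segment (T m) (T n)" for u
        using that \<epsilon>pos[of p] \<epsilon>pos[of "C k (T k)"] T0
        by (intro solves) (auto simp: closed_segment_eq_real_ivl split: if_splits)
      have "q m = C k (T m)" "q n = C k (T n)"
        unfolding q_def by (rule agree[symmetric, OF _ less_imp_le[OF Tless]], simp add: k_def)+
      then have "gdist \<A> g (q m) (q n) \<le> ennreal (K * \<bar>T n - T m\<bar>)"
        using gdist_integral_curve[OF Y K seg] by simp
      also have "\<dots> \<le> ennreal (\<bar>K\<bar> * \<bar>T n - T m\<bar>)" by (intro ennreal_leI mult_right_mono) auto
      finally show ?thesis .
    qed
    have "\<exists>N. \<forall>m\<ge>N. \<forall>n\<ge>N. gdist \<A> g (q m) (q n) < ennreal e" if "e > 0" for e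
    proof -
      have "Cauchy T" using l by (rule LIMSEQ_imp_Cauchy)
      then obtain N where N: "\<And>m n. m \<ge> N \<Longrightarrow> n \<ge> N \<Longrightarrow> \<bar>T m - T n\<bar> < e / (\<bar>K\<bar> + 1)"
        using \<open>e > 0\<close> unfolding Cauchy_def dist_real_def
        by (metis abs_ge_zero add_nonneg_pos divide_pos_pos zero_less_one)
      have "gdist \<A> g (q m) (q n) < ennreal e" if "m \<ge> N" "n \<ge> N" for m n
      proof -
        have "\<bar>T n - T m\<bar> < e / (\<bar>K\<bar> + 1)" using N[OF that(2,1)] .
        then have "(\<bar>K\<bar> + 1) * \<bar>T n - T m\<bar> < e" by (simp add: field_simps)
        then have "\<bar>K\<bar> * \<bar>T n - T m\<bar> < e" by (simp add: algebra_simps)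
        then have "ennreal (\<bar>K\<bar> * \<bar>T n - T m\<bar>) < ennreal e" by (intro ennreal_lessI \<open>e > 0\<close>)
        with dist[of m n] show ?thesis by (rule le_less_trans)
      qed
      then show ?thesis by blast
    qed
    then obtain x where "(\<lambda>n. gdist \<A> g (q n) x) \<longlonglongrightarrow> 0"
      using complete unfolding complete_metric_def by blast
    then have qx: "q \<longlonglongrightarrow> x" by (rule tendsto_if_gdist_tendsto_0)
    obtain U \<delta> where U: "open U" "x \<in> U" "\<delta> > 0" "\<forall>q\<in>U. \<delta> \<le> ?\<epsilon> q"
      using existence_time_locally_bounded_below[OF Y, of x] by blast
    have ev1: "eventually (\<lambda>n. q n \<in> U) sequentially"
      by (rule topological_tendstoD[OF qx U(1,2)])
    have "(\<lambda>n. T (Suc n) - T n) \<longlonglongrightarrow> l - l"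
      by (intro tendsto_diff l LIMSEQ_Suc)
    then have "eventually (\<lambda>n. T (Suc n) - T n < \<delta> / 2) sequentially"
      using U(3) by (intro order_tendstoD(2)) auto
    with ev1 have "eventually (\<lambda>n. False) sequentially"
    proof eventually_elim
      case (elim n)
      then have "\<delta> \<le> ?\<epsilon> (C n (T n))" using U(4) by (simp add: q_def)
      then show False using elim(2) by (simp add: TS)
    qed
    then show False by simp
  qed
  define N where "N u = (LEAST n. u < T n)" for u
  have N: "u < T (N u)" for u unfolding N_def using unbounded[of u] by (rule LeastI_ex)
  have N_le: "u < T n \<Longrightarrow> N u \<le> n" for u n unfolding N_def by (rule Least_le)
  define \<gamma> where "\<gamma> u = C (N u) u" for u
  have \<gamma>: "\<gamma> u = C n u" if "u < T n" for u n
    unfolding \<gamma>_def using agree[OF N_le[OF that], of u] N[of u] Tless[of "N u"] by simp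
  have "integral_curve_at Y \<gamma> u" if "u > - ?\<epsilon> p" for u
  proof (rule integral_curve_at_cong[of "{..<T (N u)}" u "C (N u)"])
    show "integral_curve_at Y (C (N u)) u"
      using N[of u] \<epsilon>pos[of "C (N u) (T (N u))"] by (intro solves that) simp
  qed (use N \<gamma> in auto)
  moreover have "\<gamma> 0 = p"
  proof -
    have "\<gamma> 0 = C (Suc 0) 0" by (rule \<gamma>) (use Tless[of 0] T0 in simp)
    also have "\<dots> = C 0 0" using agree[of 0 "Suc 0" 0] Tless[of 0] T0 by simp
    finally show ?thesis by (simp add: C0 \<Gamma>0)
  qed
  ultimately show ?thesis using \<epsilon>pos[of p] by blast
qed

lemma smooth_vfield_uminus:
  assumes Y: "smooth_vfield \<A> Y"
  shows "smooth_vfield \<A> (\<lambda>p c. (- 1) *\<^sub>R Y p c)"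
  unfolding smooth_vfield_def
proof (intro conjI allI ballI)
  fix p
  have "tv_lin (- 1) (Y p) 0 (Y p) \<in> tangent_space \<A> p"
    using Y by (intro tv_lin_tangent) (auto simp: smooth_vfield_def)
  then show "(\<lambda>c. (- 1) *\<^sub>R Y p c) \<in> tangent_space \<A> p" by (simp add: tv_lin_def)
next
  fix c assume c: "c \<in> \<A>"
  then have "smooth_on (cim c) (\<lambda>x. Y (cinv c x) c)" using Y by (simp add: smooth_vfield_def)
  then show "smooth_on (cim c) (\<lambda>x. (- 1) *\<^sub>R Y (cinv c x) c)"
    by (intro smooth_on_scaleR open_cim c smooth_on_const)
qed

text \<open>
  A forward solution for \<open>Y\<close> is glued at time \<open>0\<close> to the time reversal of a forward solution for \<open>- Y\<close>.
\<close>

theorem complete_if_bounded: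
  assumes complete: "complete_metric \<A> g" and Y: "smooth_vfield \<A> Y"
    and K: "\<And>p. gnorm g p (Y p) \<le> K"
  shows "\<exists>\<gamma>. integral_curve \<A> Y \<gamma> \<and> \<gamma> 0 = p"
proof -
  obtain \<eta> e where \<eta>: "\<eta> 0 = p" "e > 0" "\<And>t. t > - e \<Longrightarrow> integral_curve_at Y \<eta> t"
    using forward_integral_curve[OF complete Y K, of p] by blast
  have "gnorm g q (\<lambda>c. (- 1) *\<^sub>R Y q c) \<le> K" for q
  proof -
    have "Y q \<in> tangent_space \<A> q" using Y by (simp add: smooth_vfield_def)
    from gnorm_scale[OF this, of "- 1"] K[of q] show ?thesis by simp
  qed
  from forward_integral_curve[OF complete smooth_vfield_uminus[OF Y] this, of p]
  obtain \<zeta> d where \<zeta>: "\<zeta> 0 = p" "d > 0"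
    "\<And>t. t > - d \<Longrightarrow> integral_curve_at (\<lambda>p c. (- 1) *\<^sub>R Y p c) \<zeta> t" by blast
  have reversed: "integral_curve_at Y (\<lambda>t. \<zeta> (- t)) t" if "t < d" for t
  proof -
    have "integral_curve_at (\<lambda>p c. (- 1) *\<^sub>R Y p c) \<zeta> (0 + (- 1) * t)"
      by (rule \<zeta>(3)) (use that in simp)
    from integral_curve_at_affine[OF this] show ?thesis by simp
  qed
  define \<gamma> where "\<gamma> = (\<lambda>t. if t \<le> 0 then \<zeta> (- t) else \<eta> t)"
  have "integral_curve_at Y \<gamma> t" for t
    unfolding \<gamma>_def by (rule integral_curve_at_glue) (use reversed \<eta> \<zeta> in auto)
  moreover have "\<gamma> 0 = p" by (simp add: \<gamma>_def \<zeta>)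
  ultimately show ?thesis using integral_curve_iff by blast
qed

end

section \<open>Bounds on compact neighbourhoods\<close>

context smooth_manifold
begin

text \<open>
  The supremum that defines the norm is a real number: finitely many derivatives in finitely many
  charts are continuous functions on compact sets.
\<close>

lemma abs_iter_partial_le_Ck_norm:
  assumes P: "compact_nhd \<A> S P" and f: "smooth_fun \<A> f"
    and cL: "(c, L) \<in> P" "p \<in> L" and bs: "set bs \<subseteq> Basis" "length bs \<le> n"
  shows "\<bar>iter_partial bs (f \<circ> cinv c) (cmap c p)\<bar> \<le> Ck_norm n P f"
proof -
  define E where "E = {\<bar>iter_partial bs (f \<circ> cinv c) (cmap c p)\<bar> | c L p bs.
     (c, L) \<in> P \<and> p \<in> L \<and> set bs \<subseteq> Basis \<and> length bs \<le> n}"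
  have "bounded ((\<lambda>p. iter_partial bs (f \<circ> cinv c) (cmap c p)) ` L)" if "(c, L) \<in> P" for c L bs
  proof -
    have c: "c \<in> \<A>" "compact L" "L \<subseteq> cdom c" using P that by (auto simp: compact_nhd_def)
    have "smooth_on (cim c) (f \<circ> cinv c)" using f c(1) by (simp add: smooth_fun_def)
    then have "continuous_on (cim c) (iter_partial bs (f \<circ> cinv c))"
      by (intro smooth_on_continuous_on smooth_on_iter_partial)
    then have "continuous_on L (\<lambda>p. iter_partial bs (f \<circ> cinv c) (cmap c p))"
      by (rule continuous_on_compose2[OF _ continuous_on_subset[OF continuous_on_cmap[OF c(1)] c(3)]])
        (rule image_mono[OF c(3)])
    then show ?thesis using c(2) by (intro compact_imp_bounded compact_continuous_image)
  qed
  moreover have "finite {bs :: 'e list. set bs \<subseteq> Basis \<and> length bs \<le> n}"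
    by (intro finite_lists_length_le finite_Basis)
  moreover have "finite P" using P by (simp add: compact_nhd_def)
  ultimately have "bounded (\<Union>(c, L)\<in>P. \<Union>bs\<in>{bs. set bs \<subseteq> Basis \<and> length bs \<le> n}.
      (\<lambda>p. iter_partial bs (f \<circ> cinv c) (cmap c p)) ` L)"
    by (intro bounded_UN) auto
  then obtain B where B: "\<forall>z\<in>(\<Union>(c, L)\<in>P. \<Union>bs\<in>{bs. set bs \<subseteq> Basis \<and> length bs \<le> n}.
      (\<lambda>p. iter_partial bs (f \<circ> cinv c) (cmap c p)) ` L). norm z \<le> B"
    unfolding bounded_iff by blast
  have "z \<le> B" if "z \<in> E" for z
    using that unfolding E_def mem_Collect_eq
  proof (elim exE conjE)
    fix c L p bs
    assume z: "z = \<bar>iter_partial bs (f \<circ> cinv c) (cmap c p)\<bar>"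
      "(c, L) \<in> P" "p \<in> L" "set bs \<subseteq> Basis" "length bs \<le> n"
    have "norm (iter_partial bs (f \<circ> cinv c) (cmap c p)) \<le> B"
      by (rule B[rule_format]) (use z(2-) in blast)
    then show ?thesis using z(1) by simp
  qed
  then have "bdd_above E" by (rule bdd_aboveI)
  moreover have "\<bar>iter_partial bs (f \<circ> cinv c) (cmap c p)\<bar> \<in> E"
    unfolding E_def mem_Collect_eq by (intro exI conjI) (rule refl cL bs)+
  ultimately show ?thesis unfolding Ck_norm_def E_def[symmetric] by (intro cSup_upper)
qed

lemma Ck_norm_nonneg:
  assumes P: "compact_nhd \<A> S P" and f: "smooth_fun \<A> f" and "S \<noteq> {}"
  shows "0 \<le> Ck_norm n P f"
proof -
  obtain p where "p \<in> S" using \<open>S \<noteq> {}\<close> by blast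
  moreover have "S \<subseteq> interior (\<Union>(c, L)\<in>P. L)" using P by (simp add: compact_nhd_def)
  ultimately have "p \<in> (\<Union>(c, L)\<in>P. L)" using interior_subset by blast
  then obtain c L where cL: "(c, L) \<in> P" "p \<in> L" by blast
  have "\<bar>iter_partial [] (f \<circ> cinv c) (cmap c p)\<bar> \<le> Ck_norm n P f"
    by (rule abs_iter_partial_le_Ck_norm[OF P f cL]) simp_all
  then show ?thesis by (rule order_trans[OF abs_ge_zero])
qed

lemma Ck_norm_lipschitz:
  assumes P: "compact_nhd \<A> S P" and f: "smooth_fun \<A> f" and c: "c \<in> \<A>"
    and L: "(c, cinv c ` cball x0 r) \<in> P" "cball x0 r \<subseteq> cim c"
    and x: "x \<in> cball x0 r" and y: "y \<in> cball x0 r" and n: "n \<ge> 1"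
  shows "\<bar>f (cinv c x) - f (cinv c y)\<bar> \<le> (DIM('e) * Ck_norm n P f) * dist x y"
proof -
  have sm: "smooth_on (cim c) (f \<circ> cinv c)" using f c by (simp add: smooth_fun_def)
  have "norm ((f \<circ> cinv c) x - (f \<circ> cinv c) y) \<le> (DIM('e) * Ck_norm n P f) * norm (x - y)"
  proof (rule differentiable_bound[OF convex_cball _ _ x y])
    fix z assume z: "z \<in> cball x0 r"
    then have zc: "z \<in> cim c" using L(2) by blast
    show "((f \<circ> cinv c) has_derivative frechet_derivative (f \<circ> cinv c) (at z)) (at z within cball x0 r)"
      using smooth_on_has_derivative[OF sm zc] has_derivative_at_withinI by blast
    have part: "\<bar>frechet_derivative (f \<circ> cinv c) (at z) b\<bar> \<le> Ck_norm n P f" if "b \<in> Basis" for b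
      using abs_iter_partial_le_Ck_norm[OF P f L(1) imageI[OF z], of "[b]" n] that n cmap_cinv[OF c zc] by simp
    show "onorm (frechet_derivative (f \<circ> cinv c) (at z)) \<le> DIM('e) * Ck_norm n P f"
    proof (rule onorm_le)
      fix v
      have "norm (frechet_derivative (f \<circ> cinv c) (at z) v)
          = \<bar>\<Sum>b\<in>Basis. (v \<bullet> b) * frechet_derivative (f \<circ> cinv c) (at z) b\<bar>"
        using frechet_derivative_Basis_expand[OF smooth_on_differentiable[OF sm zc], of v] by simp
      also have "\<dots> \<le> (\<Sum>b\<in>(Basis :: 'e set). norm v * Ck_norm n P f)"
      proof (rule order_trans[OF sum_abs sum_mono])
        fix b :: 'e assume b: "b \<in> Basis"
        show "\<bar>(v \<bullet> b) * frechet_derivative (f \<circ> cinv c) (at z) b\<bar> \<le> norm v * Ck_norm n P f"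
          unfolding abs_mult using part[OF b] Basis_le_norm[OF b, of v] by (intro mult_mono) auto
      qed
      finally show "norm (frechet_derivative (f \<circ> cinv c) (at z) v) \<le> DIM('e) * Ck_norm n P f * norm v"
        by (simp add: mult_ac)
    qed
  qed
  then show ?thesis by (simp add: dist_norm)
qed

lemma word_op_le_Ck_norm:
  fixes V :: "real ^ ('d::finite) \<Rightarrow> ('m, 'e) vfield"
  assumes V: "dynamical_system \<A> V" and P: "compact_nhd \<A> S P"
  shows "\<exists>D\<ge>0. \<forall>f w q. smooth_fun \<A> f \<and> length w \<le> n \<and> q \<in> (\<Union>(c, L)\<in>P. L) \<longrightarrow>
    \<bar>word_op \<A> V w f q\<bar> \<le> D * Ck_norm n P f"
proof -
  have "\<exists>D\<ge>0. \<forall>f. smooth_fun \<A> f \<longrightarrow> (\<forall>q\<in>snd z. \<bar>word_op \<A> V w f q\<bar> \<le> D * Ck_norm n P f)"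
    if w: "length w \<le> n" and z: "z \<in> P" for w and z
  proof -
    obtain c L where cL: "z = (c, L)" by (cases z)
    have c: "c \<in> \<A>" "compact L" "L \<subseteq> cdom c" using P z cL by (auto simp: compact_nhd_def)
    obtain D where D: "dop (cim c) (length w) D"
      "\<forall>f. smooth_fun \<A> f \<longrightarrow> (\<forall>x\<in>cim c. word_op \<A> V w f (cinv c x) = D (f \<circ> cinv c) x)"
      using word_op_dop[OF V c(1)] by blast
    have K: "compact (cmap c ` L)" "cmap c ` L \<subseteq> cim c"
      using c by (auto intro!: compact_continuous_image continuous_on_subset[OF continuous_on_cmap])
    obtain C where C: "C \<ge> 0"
      "\<forall>h M. partials_le (length w) (cmap c ` L) h M \<longrightarrow> (\<forall>x\<in>cmap c ` L. \<bar>D h x\<bar> \<le> C * M)"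
      using dop_bound[OF D(1) K] by blast
    have "\<bar>word_op \<A> V w f q\<bar> \<le> C * Ck_norm n P f" if f: "smooth_fun \<A> f" and q: "q \<in> L" for f q
    proof -
      have "partials_le (length w) (cmap c ` L) (f \<circ> cinv c) (Ck_norm n P f)"
        unfolding partials_le_def
      proof (intro allI ballI impI)
        fix bs :: "'e list" and x assume "x \<in> cmap c ` L" and bs: "set bs \<subseteq> Basis \<and> length bs \<le> length w"
        then obtain p where p: "p \<in> L" "x = cmap c p" by blast
        show "\<bar>iter_partial bs (f \<circ> cinv c) x\<bar> \<le> Ck_norm n P f"
          unfolding p(2) using bs w cL z p(1) by (intro abs_iter_partial_le_Ck_norm[OF P f]) auto
      qed
      then have "\<bar>D (f \<circ> cinv c) (cmap c q)\<bar> \<le> C * Ck_norm n P f"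
        using C(2) q by blast
      moreover have "word_op \<A> V w f (cinv c (cmap c q)) = D (f \<circ> cinv c) (cmap c q)"
        using D(2) f q c(3) by blast
      ultimately show ?thesis using c q by (simp add: subset_iff)
    qed
    then show ?thesis using C(1) cL by auto
  qed
  then obtain D where D: "\<And>w z. length w \<le> n \<Longrightarrow> z \<in> P \<Longrightarrow> D w z \<ge> 0"
    "\<And>w z f q. length w \<le> n \<Longrightarrow> z \<in> P \<Longrightarrow> smooth_fun \<A> f \<Longrightarrow> q \<in> snd z \<Longrightarrow>
      \<bar>word_op \<A> V w f q\<bar> \<le> D w z * Ck_norm n P f" by metis
  define D' where "D' = (\<Sum>w\<in>{w. length w \<le> n}. \<Sum>z\<in>P. D w z)"
  have fin: "finite P" using P by (simp add: compact_nhd_def)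
  have "D' \<ge> 0" unfolding D'_def by (intro sum_nonneg D) auto
  moreover have "\<bar>word_op \<A> V w f q\<bar> \<le> D' * Ck_norm n P f"
    if f: "smooth_fun \<A> f" and w: "length w \<le> n" and q: "q \<in> (\<Union>(c, L)\<in>P. L)" for f w q
  proof -
    obtain c L where cL: "(c, L) \<in> P" "q \<in> L" using q by blast
    have "D w (c, L) \<le> (\<Sum>z\<in>P. D w z)" by (rule member_le_sum[OF cL(1) _ fin]) (use D(1) w in auto)
    also have "\<dots> \<le> D'" unfolding D'_def
      by (rule member_le_sum[of w _ "\<lambda>w. \<Sum>z\<in>P. D w z"]) (use w D(1) in \<open>auto intro: sum_nonneg\<close>)
    finally have le: "D w (c, L) \<le> D'" .
    have "\<bar>iter_partial [] (f \<circ> cinv c) (cmap c q)\<bar> \<le> Ck_norm n P f"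
      by (rule abs_iter_partial_le_Ck_norm[OF P f cL]) simp_all
    then have "0 \<le> Ck_norm n P f" by (rule order_trans[OF abs_ge_zero])
    then have "D w (c, L) * Ck_norm n P f \<le> D' * Ck_norm n P f" by (intro mult_right_mono le)
    then show ?thesis using D(2)[OF w cL(1) f, of q] cL(2) by simp
  qed
  ultimately show ?thesis by blast
qed

end

context riemannian_manifold
begin

text \<open>
  Finitely many chart balls of half the radius cover \<open>S\<close>, and the full closed balls form \<open>P\<close>. A point
  at a distance less than \<open>\<sigma>\<close> from a point of \<open>S\<close> lies in the same closed ball; this ball is convex in
  the chart, so there derivatives control differences of \<open>f\<close>.
\<close>

lemma metric_tube:
  assumes S: "compact S"
  shows "\<exists>P \<sigma> \<Lambda>. compact_nhd \<A> S P \<and> \<sigma> > 0 \<and> \<Lambda> \<ge> 0 \<and>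
    (\<forall>q\<in>S. \<forall>q' e. gdist \<A> g q q' \<le> ennreal e \<and> 0 \<le> e \<and> e < \<sigma> \<longrightarrow> q' \<in> (\<Union>(c, L)\<in>P. L) \<and>
      (\<forall>f n. smooth_fun \<A> f \<and> n \<ge> 1 \<longrightarrow> \<bar>f q - f q'\<bar> \<le> \<Lambda> * Ck_norm n P f * e))"
proof -
  have "\<exists>c r m. c \<in> \<A> \<and> p \<in> cdom c \<and> r > 0 \<and> m > 0 \<and> cball (cmap c p) r \<subseteq> cim c \<and>
      (\<forall>x\<in>cball (cmap c p) r. \<forall>u. m * norm u \<le> gnorm g (cinv c x) (coord_vector \<A> c u (cinv c x)))" for p
  proof -
    obtain c where c: "c \<in> \<A>" "p \<in> cdom c" by (rule chart_around)
    obtain r m where "r > 0" "m > 0" "cball (cmap c p) r \<subseteq> cmap c ` (cdom c \<inter> UNIV)"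
      "\<And>x u. x \<in> cball (cmap c p) r \<Longrightarrow> m * norm u \<le> gnorm g (cinv c x) (coord_vector \<A> c u (cinv c x))"
      using metric_ball_in_chart[OF c open_UNIV UNIV_I] by metis
    then show ?thesis using c by (intro exI[of _ c] exI[of _ r] exI[of _ m]) auto
  qed
  then obtain c r m where c: "\<And>p. c p \<in> \<A>" "\<And>p. p \<in> cdom (c p)" and r: "\<And>p. r p > 0"
      "\<And>p. cball (cmap (c p) p) (r p) \<subseteq> cim (c p)" and m0: "\<And>p. m p > 0"
    and m: "\<And>p x u. x \<in> cball (cmap (c p) p) (r p) \<Longrightarrow>
      m p * norm u \<le> gnorm g (cinv (c p) x) (coord_vector \<A> (c p) u (cinv (c p) x))" by metis
  define N where "N p = cmap (c p) -` ball (cmap (c p) p) (r p / 2) \<inter> cdom (c p)" for p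
  define K where "K p = cinv (c p) ` cball (cmap (c p) p) (r p)" for p
  have openN: "open (N p)" for p
    unfolding N_def using continuous_on_cmap[OF c(1)]
    by (simp only: continuous_on_open_vimage[OF open_cdom[OF c(1)]] open_ball)
  have inK: "q \<in> K p" if "q \<in> cdom (c p)" "cmap (c p) q \<in> cball (cmap (c p) p) (r p)" for p q
    unfolding K_def using that cinv_cmap[OF c(1) that(1)] by (metis imageI)
  have NK: "N p \<subseteq> K p" for p
  proof
    fix q assume "q \<in> N p"
    then show "q \<in> K p" using r(1)[of p] by (intro inK) (auto simp: N_def)
  qed
  have "p \<in> N p" for p using c(2) r(1) by (simp add: N_def)
  then have "S \<subseteq> (\<Union>p\<in>S. N p)" by blast
  then obtain F where F: "F \<subseteq> S" "finite F" "S \<subseteq> (\<Union>p\<in>F. N p)"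
    by (rule compactE_image[OF S openN])
  define P where "P = (\<lambda>p. (c p, K p)) ` F"
  have UP: "(\<Union>(c, L)\<in>P. L) = (\<Union>p\<in>F. K p)" by (auto simp: P_def)
  have nhd: "compact_nhd \<A> S P"
    unfolding compact_nhd_def
  proof (intro conjI)
    show "finite P" using F by (simp add: P_def)
    have "compact (K p)" "K p \<subseteq> cdom (c p)" for p
      unfolding K_def using r(2)[of p] cinv_in_cdom[OF c(1)]
      by (auto intro!: compact_continuous_image continuous_on_subset[OF continuous_on_cinv[OF c(1)]])
    then show "\<forall>(c, L)\<in>P. c \<in> \<A> \<and> compact L \<and> L \<subseteq> cdom c" using c(1) by (auto simp: P_def)
    have "(\<Union>p\<in>F. N p) \<subseteq> interior (\<Union>p\<in>F. K p)"
      using NK openN by (intro interior_maximal) blast+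
    then show "S \<subseteq> interior (\<Union>(c, L)\<in>P. L)" unfolding UP using F(3) by blast
  qed
  define \<sigma> where "\<sigma> = Min (insert 1 ((\<lambda>p. m p * (r p / 2)) ` F))"
  have "\<sigma> > 0" unfolding \<sigma>_def using F(2) m0 r(1) by (subst Min_gr_iff) auto
  moreover have "\<sigma> \<le> m p * (r p / 2)" if "p \<in> F" for p
    unfolding \<sigma>_def by (rule Min_le) (use F(2) that in auto)
  ultimately have \<sigma>: "\<sigma> > 0" "\<And>p. p \<in> F \<Longrightarrow> \<sigma> \<le> m p * (r p / 2)" by blast+
  define \<Lambda> where "\<Lambda> = (\<Sum>p\<in>F. DIM('e) / m p)"
  have \<Lambda>: "\<Lambda> \<ge> 0" "\<And>p. p \<in> F \<Longrightarrow> DIM('e) / m p \<le> \<Lambda>"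
    unfolding \<Lambda>_def using F(2) m0 less_imp_le[OF m0] by (auto intro!: sum_nonneg member_le_sum)
  have main: "\<forall>q\<in>S. \<forall>q' e. gdist \<A> g q q' \<le> ennreal e \<and> 0 \<le> e \<and> e < \<sigma> \<longrightarrow> q' \<in> (\<Union>(c, L)\<in>P. L) \<and>
      (\<forall>f n. smooth_fun \<A> f \<and> n \<ge> 1 \<longrightarrow> \<bar>f q - f q'\<bar> \<le> \<Lambda> * Ck_norm n P f * e)"
  proof (intro ballI allI impI)
    fix q q' e assume q: "q \<in> S" and "gdist \<A> g q q' \<le> ennreal e \<and> 0 \<le> e \<and> e < \<sigma>"
    then have e: "gdist \<A> g q q' \<le> ennreal e" "0 \<le> e" "e < \<sigma>" by blast+
    obtain p where p: "p \<in> F" "q \<in> N p" using q F(3) by blast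
    let ?c = "c p"
    have near: "q \<in> cdom ?c \<and> dist (cmap ?c p) (cmap ?c q) \<le> r p / 2
        \<or> q' \<in> cdom ?c \<and> dist (cmap ?c p) (cmap ?c q') \<le> r p / 2"
      using p(2) by (auto simp: N_def)
    have "gdist \<A> g q q' < ennreal (m p * (r p / 2))"
    proof -
      have "ennreal e < ennreal (m p * (r p / 2))"
        using e(2,3) \<sigma>(2)[OF p(1)] by (intro ennreal_lessI) auto
      with e(1) show ?thesis by (rule le_less_trans)
    qed
    note bounds = gdist_bounds_chart_distance[OF c(1) r(2) m0 m near this]
    have q'K: "q' \<in> K p" using bounds(2,4) ball_subset_cball by (intro inK) blast+
    have "ennreal (m p * dist (cmap ?c q) (cmap ?c q')) \<le> ennreal e" using bounds(5) e(1) by (rule order_trans)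
    then have "m p * dist (cmap ?c q) (cmap ?c q') \<le> e" using e(2) by (simp add: ennreal_le_iff)
    then have xd: "dist (cmap ?c q) (cmap ?c q') \<le> e / m p" using m0[of p] by (simp add: field_simps)
    have "\<bar>f q - f q'\<bar> \<le> \<Lambda> * Ck_norm n P f * e" if f: "smooth_fun \<A> f" and n: "n \<ge> 1" for f n
    proof -
      have Ck: "0 \<le> Ck_norm n P f" using Ck_norm_nonneg[OF nhd f] q by blast
      have "\<bar>f (cinv ?c (cmap ?c q)) - f (cinv ?c (cmap ?c q'))\<bar>
          \<le> (DIM('e) * Ck_norm n P f) * dist (cmap ?c q) (cmap ?c q')"
        by (rule Ck_norm_lipschitz[OF nhd f c(1) _ r(2) _ _ n])
          (use p(1) bounds(3,4) ball_subset_cball in \<open>auto simp: P_def K_def\<close>)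
      also have "\<dots> \<le> (DIM('e) * Ck_norm n P f) * (e / m p)"
        using xd Ck by (intro mult_left_mono) auto
      also have "\<dots> = (DIM('e) / m p) * (Ck_norm n P f * e)" by simp
      also have "\<dots> \<le> \<Lambda> * (Ck_norm n P f * e)"
        using \<Lambda>(2)[OF p(1)] Ck e(2) by (intro mult_right_mono) auto
      finally show ?thesis using bounds(1,2) c(1) by (simp add: mult.assoc)
    qed
    then show "q' \<in> (\<Union>(c, L)\<in>P. L) \<and>
        (\<forall>f n. smooth_fun \<A> f \<and> n \<ge> 1 \<longrightarrow> \<bar>f q - f q'\<bar> \<le> \<Lambda> * Ck_norm n P f * e)"
      using q'K p(1) unfolding UP by blast
  qed
  show ?thesis by (intro exI conjI) (rule nhd \<sigma>(1) \<Lambda>(1) main)+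
qed

end

section \<open>The increments of a rough path\<close>

lemma abs_le_tnorm:
  assumes "length w \<le> \<kappa>"
  shows "\<bar>A w\<bar> \<le> tnorm \<kappa> (tdeg (length w) A)"
proof -
  have "(tdeg (length w) A w)\<^sup>2 \<le> (\<Sum>v\<in>{v. length v \<le> \<kappa>}. (tdeg (length w) A v)\<^sup>2)"
    by (rule member_le_sum) (use assms in auto)
  then have "sqrt ((A w)\<^sup>2) \<le> tnorm \<kappa> (tdeg (length w) A)"
    unfolding tnorm_def by (intro real_sqrt_le_mono) (simp add: tdeg_def)
  then show ?thesis by simp
qed

lemma tnorm_le:
  fixes A :: "('d::finite) tensor" and b :: real
  assumes "\<And>w. length w \<le> \<kappa> \<Longrightarrow> \<bar>A w\<bar> \<le> b"
  shows "tnorm \<kappa> A \<le> card {w :: 'd list. length w \<le> \<kappa>} * b"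
proof -
  have "tnorm \<kappa> A \<le> (\<Sum>w\<in>{w. length w \<le> \<kappa>}. \<bar>A w\<bar>)"
    unfolding tnorm_def using L2_set_le_sum_abs[of A "{w. length w \<le> \<kappa>}"] by (simp add: L2_set_def)
  also have "\<dots> \<le> (\<Sum>w\<in>{w :: 'd list. length w \<le> \<kappa>}. b)" by (intro sum_mono assms) simp
  finally show ?thesis by simp
qed

text \<open>
  The homogeneous norm bounds every degree by a power, and the scaling parameter absorbs the constant
  of the rough path.
\<close>

lemma hom_bound_of_hom_norm:
  assumes "hom_norm \<kappa> A \<le> b" "A [] = 1" "b \<ge> 0"
  shows "hom_bound \<kappa> b 1 A"
  unfolding hom_bound_def
proof (intro allI impI)
  fix w :: "'a list" assume w: "length w \<le> \<kappa>"
  show "\<bar>A w\<bar> \<le> 1 * b ^ length w"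
  proof (cases "w = []")
    case False
    let ?k = "length w" and ?n = "tnorm \<kappa> (tdeg (length w) A)"
    have k: "?k > 0" using False by simp
    have "root ?k ?n \<le> hom_norm \<kappa> A"
      unfolding hom_norm_def by (rule Max_ge) (use w k in \<open>auto simp: Suc_le_eq\<close>)
    then have "root ?k ?n \<le> b" using assms(1) by simp
    moreover have n0: "?n \<ge> 0" by (simp add: tnorm_def sum_nonneg)
    ultimately have "root ?k ?n ^ ?k \<le> b ^ ?k" by (intro power_mono real_root_ge_zero)
    then have "?n \<le> b ^ ?k" using k n0 by simp
    then show ?thesis using abs_le_tnorm[OF w, of A] by simp
  qed (use assms in simp)
qed

text \<open>
  For \<open>s > t\<close> the increment is the inverse of the exponential of some \<open>\<xi>\<close>, with logarithm \<open>- \<xi>\<close>; this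
  has the same bound as \<open>\<xi>\<close>.
\<close>

lemma rough_path_log:
  fixes X :: "real \<Rightarrow> real \<Rightarrow> ('d::finite) tensor"
  assumes \<kappa>: "\<kappa> \<ge> 1" and X: "geometric_rough_path \<kappa> \<alpha> T X"
  shows "\<exists>a. \<forall>s\<in>{0..T}. \<forall>t\<in>{0..T}. \<exists>\<xi>\<in>lie_alg \<kappa>. rp_extend \<kappa> X s t = texp \<kappa> \<xi> \<and>
    tlog \<kappa> (rp_extend \<kappa> X s t) = \<xi> \<and> hom_bound \<kappa> (\<bar>t - s\<bar> powr \<alpha>) a \<xi>"
proof -
  obtain c where c: "\<And>s t. 0 \<le> s \<Longrightarrow> s \<le> t \<Longrightarrow> t \<le> T \<Longrightarrow> hom_norm \<kappa> (X s t) \<le> c * \<bar>t - s\<bar> powr \<alpha>"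
    and geo: "\<And>s t. 0 \<le> s \<Longrightarrow> s \<le> t \<Longrightarrow> t \<le> T \<Longrightarrow> X s t \<in> geo_group \<kappa>"
  proof -
    note X' = X[unfolded geometric_rough_path_def]
    from X'[THEN conjunct2, THEN conjunct2, THEN conjunct2, THEN conjunct2]
    obtain c where "\<forall>s t. 0 \<le> s \<and> s \<le> t \<and> t \<le> T \<longrightarrow> hom_norm \<kappa> (X s t) \<le> c * \<bar>t - s\<bar> powr \<alpha>" ..
    then show thesis using that[of c] X'[THEN conjunct1] by simp
  qed
  define b where "b = max c 1"
  obtain a where a: "\<And>\<rho> (A :: 'd tensor). \<rho> \<ge> 0 \<Longrightarrow> A \<in> tensor_alg \<kappa> \<Longrightarrow> A [] = 0 \<Longrightarrow>
      hom_bound \<kappa> \<rho> 1 (texp \<kappa> A) \<Longrightarrow> hom_bound \<kappa> \<rho> a A"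
    using hom_bound_log[of \<kappa>] by blast
  have forward: "\<exists>\<xi>\<in>lie_alg \<kappa>. X s t = texp \<kappa> \<xi> \<and> hom_bound \<kappa> (\<bar>t - s\<bar> powr \<alpha>) (a * b ^ \<kappa>) \<xi>"
    if st: "0 \<le> s" "s \<le> t" "t \<le> T" for s t
  proof -
    let ?\<rho> = "\<bar>t - s\<bar> powr \<alpha>"
    obtain \<xi> where \<xi>: "\<xi> \<in> lie_alg \<kappa>" "X s t = texp \<kappa> \<xi>" using geo[OF st] unfolding geo_group_def by blast
    have nil: "\<xi> [] = 0" "\<xi> \<in> tensor_alg \<kappa>"
      using lie_alg_Nil lie_alg_in_tensor_alg[OF \<kappa>] \<xi>(1) by blast+
    have "c * ?\<rho> \<le> b * ?\<rho>" by (intro mult_right_mono) (simp_all add: b_def)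
    then have "hom_norm \<kappa> (texp \<kappa> \<xi>) \<le> b * ?\<rho>" using c[OF st] \<xi>(2) by simp
    then have "hom_bound \<kappa> (b * ?\<rho>) 1 (texp \<kappa> \<xi>)"
      by (rule hom_bound_of_hom_norm) (simp_all add: nil b_def)
    then have h: "hom_bound \<kappa> (b * ?\<rho>) a \<xi>" by (intro a nil) (simp_all add: b_def)
    have "hom_bound \<kappa> ?\<rho> (a * b ^ \<kappa>) \<xi>"
      unfolding hom_bound_def
    proof (intro allI impI)
      fix w :: "'d list" assume w: "length w \<le> \<kappa>"
      have "\<bar>\<xi> w\<bar> \<le> a * (b * ?\<rho>) ^ length w" using h w by (simp add: hom_bound_def)
      also have "\<dots> = a * (b ^ length w * ?\<rho> ^ length w)" by (simp add: power_mult_distrib)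
      also have "\<dots> \<le> a * (b ^ \<kappa> * ?\<rho> ^ length w)"
        using hom_bound_nonneg[OF h] w by (intro mult_left_mono mult_right_mono power_increasing) (simp_all add: b_def)
      finally show "\<bar>\<xi> w\<bar> \<le> a * b ^ \<kappa> * ?\<rho> ^ length w" by (simp add: mult.assoc)
    qed
    then show ?thesis using \<xi> by blast
  qed
  have "\<exists>\<xi>\<in>lie_alg \<kappa>. rp_extend \<kappa> X s t = texp \<kappa> \<xi> \<and>
    tlog \<kappa> (rp_extend \<kappa> X s t) = \<xi> \<and> hom_bound \<kappa> (\<bar>t - s\<bar> powr \<alpha>) (a * b ^ \<kappa>) \<xi>"
    if "s \<in> {0..T}" "t \<in> {0..T}" for s t
  proof (cases "s \<le> t")
    case True
    then obtain \<xi> where "\<xi> \<in> lie_alg \<kappa>" "X s t = texp \<kappa> \<xi>" "hom_bound \<kappa> (\<bar>t - s\<bar> powr \<alpha>) (a * b ^ \<kappa>) \<xi>"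
      using forward[of s t] \<open>s \<in> {0..T}\<close> \<open>t \<in> {0..T}\<close> by auto
    then show ?thesis using True tlog_texp[OF \<kappa>] by (intro bexI[of _ \<xi>]) (simp_all add: rp_extend_def)
  next
    case False
    then obtain \<xi> where \<xi>: "\<xi> \<in> lie_alg \<kappa>" "X t s = texp \<kappa> \<xi>" "hom_bound \<kappa> (\<bar>s - t\<bar> powr \<alpha>) (a * b ^ \<kappa>) \<xi>"
      using forward[of t s] \<open>s \<in> {0..T}\<close> \<open>t \<in> {0..T}\<close> by auto
    have e: "rp_extend \<kappa> X s t = texp \<kappa> (\<lambda>w. - \<xi> w)"
      using False \<xi>(2) tinverse_texp[OF lie_alg_in_tensor_alg[OF \<kappa> \<xi>(1)] lie_alg_Nil[OF \<xi>(1)]]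
      by (simp add: rp_extend_def)
    show ?thesis
      using e \<xi>(3) lie_alg_uminus[OF \<xi>(1)] tlog_texp[OF \<kappa> lie_alg_uminus[OF \<xi>(1)]]
      by (intro bexI[of _ "\<lambda>w. - \<xi> w"]) (simp_all add: hom_bound_def abs_minus_commute)
  qed
  then show ?thesis by blast
qed

section \<open>Taylor expansion along the flow\<close>

context smooth_manifold
begin

lemma diff_op_tone:
  fixes V :: "real ^ ('d::finite) \<Rightarrow> ('m, 'e) vfield"
  shows "diff_op \<A> \<kappa> V tone f p = f p"
proof -
  have "diff_op \<A> \<kappa> V tone f p = (\<Sum>w\<in>{w :: 'd list. length w \<le> \<kappa>}. if w = [] then f p else 0)"
    unfolding diff_op_def by (rule sum.cong) (auto simp: tone_def)
  then show ?thesis by simp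
qed

text \<open>
  The derivative of the interpolation \<open>h\<close> is the operator of a truncated product minus a composition of
  operators, so it is a sum over the pairs of words that the truncation cuts off. Such a pair has
  total length at least \<open>\<kappa> + 1\<close>, so its coefficient is of order \<open>\<rho>\<close> to the power \<open>\<kappa> + 1\<close> when \<open>\<rho> \<le> 1\<close>.
\<close>

lemma taylor_along_flow:
  fixes V :: "real ^ ('d::finite) \<Rightarrow> ('m, 'e) vfield" and \<xi> :: "'d tensor"
  assumes \<kappa>: "\<kappa> \<ge> 1" and V: "dynamical_system \<A> V" and VL: "lie_extension \<A> \<kappa> V VL"
    and \<xi>: "\<xi> \<in> lie_alg \<kappa>" and \<gamma>: "integral_curve \<A> (VL \<xi>) \<gamma>" and f: "smooth_fun \<A> f"
    and \<rho>: "0 \<le> \<rho>" "\<rho> \<le> 1" and a: "hom_bound \<kappa> \<rho> a \<xi>"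
    and M: "\<And>w u. length w \<le> 2 * \<kappa> \<Longrightarrow> u \<in> {0..1} \<Longrightarrow> \<bar>word_op \<A> V w f (\<gamma> u)\<bar> \<le> M"
  shows "\<bar>f (\<gamma> 1) - diff_op \<A> \<kappa> V (texp \<kappa> \<xi>) f (\<gamma> 0)\<bar>
    \<le> real (card ({w :: 'd list. length w \<le> \<kappa>} \<times> {w :: 'd list. length w \<le> \<kappa>}))
      * (a * (\<Sum>k\<le>\<kappa>. (real (\<kappa> + 1) * a) ^ k) * M * \<rho> ^ (\<kappa> + 1))"
proof -
  let ?W = "{w :: 'd list. length w \<le> \<kappa>}"
  define e where "e = (\<Sum>k\<le>\<kappa>. (real (\<kappa> + 1) * a) ^ k)"
  define E where "E u = texp \<kappa> (\<lambda>w. u * \<xi> w)" for u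
  define h where "h u = diff_op \<A> \<kappa> V (E u) f (\<gamma> (1 - u))" for u
  define R where "R u = diff_op \<A> \<kappa> V (tmult \<kappa> \<xi> (E u)) f (\<gamma> (1 - u))
      - diff_op \<A> \<kappa> V \<xi> (diff_op \<A> \<kappa> V (E u) f) (\<gamma> (1 - u))" for u
  have a0: "0 \<le> a" by (rule hom_bound_nonneg[OF a])
  have e0: "0 \<le> e" unfolding e_def using a0 by (intro sum_nonneg) simp
  have M0: "0 \<le> M" using M[of "[]" 0] by simp
  have smooth: "smooth_fun \<A> (word_op \<A> V w f)" for w by (rule smooth_fun_word_op[OF V f])
  have smoothVL: "smooth_vfield \<A> (VL \<xi>)" using VL \<xi> by (simp add: lie_extension_def)
  have deriv: "(h has_real_derivative R u) (at u)" for u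
  proof -
    have dw: "((\<lambda>u. word_op \<A> V w f (\<gamma> (1 - u))) has_real_derivative
        - vf_apply \<A> (VL \<xi>) (word_op \<A> V w f) (\<gamma> (1 - u))) (at u)" for w
    proof -
      have "((\<lambda>t. word_op \<A> V w f (\<gamma> t)) has_real_derivative
          vf_apply \<A> (VL \<xi>) (word_op \<A> V w f) (\<gamma> (1 - u))) (at (1 - u))"
        using \<gamma> integral_curve_iff by (intro function_along_integral_curve[OF smooth _ smoothVL]) blast
      moreover have "((\<lambda>u. 1 - u) has_real_derivative - 1) (at u)" by (auto intro!: derivative_eq_intros)
      ultimately show ?thesis using DERIV_chain2 by fastforce
    qed
    have "(h has_real_derivative (\<Sum>w\<in>?W. tmult \<kappa> \<xi> (E u) w * word_op \<A> V w f (\<gamma> (1 - u))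
        + - vf_apply \<A> (VL \<xi>) (word_op \<A> V w f) (\<gamma> (1 - u)) * E u w)) (at u)"
      unfolding h_def diff_op_def E_def
      by (intro DERIV_sum DERIV_mult dw has_derivative_texp lie_alg_Nil[OF \<xi>])
    also have "(\<Sum>w\<in>?W. tmult \<kappa> \<xi> (E u) w * word_op \<A> V w f (\<gamma> (1 - u))
        + - vf_apply \<A> (VL \<xi>) (word_op \<A> V w f) (\<gamma> (1 - u)) * E u w)
      = diff_op \<A> \<kappa> V (tmult \<kappa> \<xi> (E u)) f (\<gamma> (1 - u))
        - (\<Sum>w\<in>?W. E u w * vf_apply \<A> (VL \<xi>) (word_op \<A> V w f) (\<gamma> (1 - u)))"
      by (simp add: diff_op_def sum.distrib sum_subtractf mult.commute)
    also have "(\<Sum>w\<in>?W. E u w * vf_apply \<A> (VL \<xi>) (word_op \<A> V w f) (\<gamma> (1 - u)))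
      = vf_apply \<A> (VL \<xi>) (diff_op \<A> \<kappa> V (E u) f) (\<gamma> (1 - u))"
      unfolding diff_op_def by (rule vf_apply_sum[symmetric]) (rule smooth)
    also have "\<dots> = diff_op \<A> \<kappa> V \<xi> (diff_op \<A> \<kappa> V (E u) f) (\<gamma> (1 - u))"
      by (rule vf_apply_lie_extension[OF V VL smooth_fun_diff_op[OF V f] \<kappa> \<xi>])
    finally show ?thesis by (simp add: R_def)
  qed
  have bound: "\<bar>R u\<bar> \<le> real (card (?W \<times> ?W)) * (a * e * M * \<rho> ^ (\<kappa> + 1))" if u: "u \<in> {0..1}" for u
  proof -
    let ?t = "\<lambda>(v, w). \<xi> v * E u w * word_op \<A> V (v @ w) f (\<gamma> (1 - u))"
    let ?D = "{(v, w). length v + length w \<le> \<kappa>} :: ('d list \<times> 'd list) set"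
    have sub: "?D \<subseteq> ?W \<times> ?W" by auto
    have "R u = - sum ?t (?W \<times> ?W - ?D)"
      unfolding R_def diff_op_tmult[OF V] diff_op_diff_op[OF V f]
      using sum_diff[OF _ sub, of ?t] by simp
    then have "\<bar>R u\<bar> \<le> (\<Sum>z\<in>?W \<times> ?W - ?D. \<bar>?t z\<bar>)" using sum_abs by simp
    also have "\<dots> \<le> (\<Sum>z\<in>?W \<times> ?W - ?D. a * e * M * \<rho> ^ (\<kappa> + 1))"
    proof (rule sum_mono)
      fix z assume "z \<in> ?W \<times> ?W - ?D"
      then obtain v w where z: "z = (v, w)" "length v \<le> \<kappa>" "length w \<le> \<kappa>" "\<kappa> + 1 \<le> length v + length w"
        by (cases z) auto
      have "\<bar>\<xi> v\<bar> \<le> a * \<rho> ^ length v" using a z(2) by (simp add: hom_bound_def)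
      moreover have "\<bar>E u w\<bar> \<le> e * \<rho> ^ length w"
        using hom_bound_texp[OF a \<rho>(1), of u] u z(3) unfolding hom_bound_def E_def e_def by simp
      moreover have "\<bar>word_op \<A> V (v @ w) f (\<gamma> (1 - u))\<bar> \<le> M"
        using z(2,3) u by (intro M) auto
      ultimately have "\<bar>\<xi> v\<bar> * \<bar>E u w\<bar> * \<bar>word_op \<A> V (v @ w) f (\<gamma> (1 - u))\<bar>
          \<le> (a * \<rho> ^ length v) * (e * \<rho> ^ length w) * M"
        using a0 e0 \<rho>(1) M0 by (intro mult_mono) auto
      also have "\<dots> = a * e * M * \<rho> ^ (length v + length w)" by (simp add: power_add)
      also have "\<dots> \<le> a * e * M * \<rho> ^ (\<kappa> + 1)"
        using a0 e0 M0 \<rho> z(4) by (intro mult_left_mono power_decreasing) auto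
      finally show "\<bar>?t z\<bar> \<le> a * e * M * \<rho> ^ (\<kappa> + 1)" using z(1) by (simp add: abs_mult)
    qed
    also have "\<dots> = real (card (?W \<times> ?W - ?D)) * (a * e * M * \<rho> ^ (\<kappa> + 1))" by simp
    also have "\<dots> \<le> real (card (?W \<times> ?W)) * (a * e * M * \<rho> ^ (\<kappa> + 1))"
      using a0 e0 M0 \<rho> by (intro mult_right_mono of_nat_mono card_mono) auto
    finally show ?thesis .
  qed
  obtain z where z: "0 < z" "z < 1" "h 1 - h 0 = (1 - 0) * R z"
    using MVT2[of 0 1 h R] deriv by auto
  have "h 0 = f (\<gamma> 1)" by (simp add: h_def E_def texp_zero diff_op_tone)
  moreover have "h 1 = diff_op \<A> \<kappa> V (texp \<kappa> \<xi>) f (\<gamma> 0)" by (simp add: h_def E_def)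
  ultimately have "\<bar>f (\<gamma> 1) - diff_op \<A> \<kappa> V (texp \<kappa> \<xi>) f (\<gamma> 0)\<bar> = \<bar>R z\<bar>" using z(3) by simp
  then show ?thesis using bound[of z] z by (simp add: e_def)
qed

end

section \<open>The expansion along the solution\<close>

lemma tnorm_scale: "tnorm \<kappa> (\<lambda>w. r * A w) = \<bar>r\<bar> * tnorm \<kappa> A"
  by (simp add: tnorm_def power_mult_distrib sum_distrib_left[symmetric] real_sqrt_mult)

lemma tnorm_eq_0:
  assumes "tnorm \<kappa> A = 0" "A \<in> tensor_alg \<kappa>"
  shows "A = (\<lambda>_. 0)"
proof
  fix w
  show "A w = 0"
  proof (cases "length w \<le> \<kappa>")
    case True
    have "(\<Sum>w\<in>{w. length w \<le> \<kappa>}. (A w)\<^sup>2) = 0" using assms(1) by (simp add: tnorm_def)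
    then have "\<forall>w\<in>{w. length w \<le> \<kappa>}. (A w)\<^sup>2 = 0" by (subst (asm) sum_nonneg_eq_0_iff) auto
    then show ?thesis using True by simp
  qed (use assms(2) in \<open>simp add: tensor_alg_def\<close>)
qed

context riemannian_manifold
begin

lemma gnorm_le_tnorm:
  fixes VL :: "('d::finite) tensor \<Rightarrow> ('m, 'e) vfield"
  assumes \<kappa>: "\<kappa> \<ge> 1" and VL: "lie_extension \<A> \<kappa> V VL" and fin: "sup_norm_V g \<kappa> VL < \<infinity>"
  shows "\<exists>K\<ge>0. \<forall>A\<in>lie_alg \<kappa>. \<forall>p. gnorm g p (VL A p) \<le> K * tnorm \<kappa> A"
proof -
  define K where "K = enn2real (sup_norm_V g \<kappa> VL)"
  have K: "ennreal K = sup_norm_V g \<kappa> VL" "K \<ge> 0" using fin by (simp_all add: K_def)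
  have tan: "VL A p \<in> tangent_space \<A> p" if "A \<in> lie_alg \<kappa>" for A p
    using VL that by (simp add: lie_extension_def smooth_vfield_def)
  have one: "gnorm g p (VL A p) \<le> K" if A: "A \<in> lie_alg \<kappa>" "tnorm \<kappa> A = 1" for A p
  proof -
    have "ennreal (gnorm g p (VL A p)) \<le> (SUP p. ennreal (gnorm g p (VL A p)))"
      by (rule SUP_upper) simp
    also have "\<dots> \<le> sup_norm_V g \<kappa> VL" unfolding sup_norm_V_def by (rule SUP_upper) (use A in simp)
    finally show ?thesis unfolding K(1)[symmetric] using K(2) by (simp add: ennreal_le_iff)
  qed
  have scale: "VL (\<lambda>w. r * A w) p = (\<lambda>c. r *\<^sub>R VL A p c)" if "A \<in> lie_alg \<kappa>" for r A p
    using lie_extension_lin[OF VL that that, of r 0 p] by (simp add: tv_lin_def)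
  have "gnorm g p (VL A p) \<le> K * tnorm \<kappa> A" if A: "A \<in> lie_alg \<kappa>" for A p
  proof (cases "tnorm \<kappa> A = 0")
    case True
    then have "A = (\<lambda>w. 0 * A w)" using tnorm_eq_0[OF True lie_alg_in_tensor_alg[OF \<kappa> A]] by simp
    then have "VL A p = (\<lambda>c. 0 *\<^sub>R VL A p c)" using scale[OF A, of 0 p] by simp
    then have "gnorm g p (VL A p) = \<bar>0\<bar> * gnorm g p (VL A p)" using gnorm_scale[OF tan[OF A, of p], of 0] by simp
    then show ?thesis using True by simp
  next
    case False
    define r where "r = tnorm \<kappa> A"
    have r: "r > 0" using False by (simp add: r_def tnorm_def sum_nonneg less_le)
    define B where "B = (\<lambda>w. (1 / r) * A w)"
    have B: "B \<in> lie_alg \<kappa>" unfolding B_def using A by (rule lie_alg.scale)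
    have "tnorm \<kappa> B = 1" unfolding B_def tnorm_scale using r by (simp add: r_def[symmetric])
    from one[OF B this, of p] have "r * gnorm g p (VL B p) \<le> r * K" using r by (intro mult_left_mono) auto
    moreover have "A = (\<lambda>w. r * B w)" using r by (simp add: B_def)
    then have "gnorm g p (VL A p) = r * gnorm g p (VL B p)"
      using scale[OF B, of r p] gnorm_scale[OF tan[OF B, of p], of r] r by simp
    ultimately show ?thesis by (simp add: r_def mult.commute)
  qed
  then show ?thesis using K(2) by blast
qed

end

theorem proposition1p28:
  fixes \<kappa> :: nat and T \<alpha> \<theta> :: real
    and \<A> :: "('m::{t2_space,second_countable_topology}, 'e::euclidean_space) chart set"
    and g :: "('m, 'e) metric"
    and nabla :: "'m \<Rightarrow> ('m, 'e) tvec \<Rightarrow> ('m, 'e) vfield \<Rightarrow> ('m, 'e) tvec"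
    and X :: "real \<Rightarrow> real \<Rightarrow> ('d::finite) tensor"
    and V :: "real ^ 'd \<Rightarrow> ('m, 'e) vfield"
    and VL :: "'d tensor \<Rightarrow> ('m, 'e) vfield"
    and \<mu> \<phi> :: "real \<Rightarrow> real \<Rightarrow> 'm \<Rightarrow> 'm"
    and m0 :: 'm and y :: "real \<Rightarrow> 'm"
  assumes "\<kappa> \<ge> 1" and "T > 0"
    and "1 / real (\<kappa> + 1) < \<alpha>" and "\<alpha> \<le> 1 / real \<kappa>"
    and "\<theta> = \<alpha> * real (\<kappa> + 1)"
    and "smooth_atlas \<A>"
    and "geometric_rough_path \<kappa> \<alpha> T X"
    and "dynamical_system \<A> V"
    and "lie_extension \<A> \<kappa> V VL"
    and "riemannian_metric \<A> g" and "complete_metric \<A> g"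
    and "levi_civita \<A> g nabla"
    and "sup_norm_V g \<kappa> VL + sup_norm_nabla_V \<A> g nabla \<kappa> VL < \<infinity>"
    and "\<And>s t. \<mu> t s = vf_exp \<A> (VL (tlog \<kappa> (rp_extend \<kappa> X s t)))"
    and "continuous_on ({0..T} \<times> {0..T} \<times> UNIV) (\<lambda>(t, s, m). \<phi> t s m)"
    and "\<forall>t\<in>{0..T}. \<phi> t t = id"
    and "\<forall>r\<in>{0..T}. \<forall>s\<in>{0..T}. \<forall>t\<in>{0..T}. \<phi> t s \<circ> \<phi> s r = \<phi> t r"
    and "\<exists>C::real. \<forall>s\<in>{0..T}. \<forall>t\<in>{0..T}.
           (SUP m. gdist \<A> g (\<phi> t s m) (\<mu> t s m)) \<le> ennreal (C * \<bar>t - s\<bar> powr \<theta>)"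
    and "\<And>t. y t = \<phi> t 0 m0"
  shows "\<exists>P C. compact_nhd \<A> (y ` {0..T}) P \<and> mono (C :: real \<Rightarrow> real) \<and>
           (\<forall>f. smooth_fun \<A> f \<longrightarrow>
              (\<forall>s\<in>{0..T}. \<forall>t\<in>{0..T}.
                 \<bar>f (y t) - diff_op \<A> \<kappa> V (rp_extend \<kappa> X s t) f (y s)\<bar>
                   \<le> C (Ck_norm (2 * \<kappa>) P f) * \<bar>t - s\<bar> powr \<theta>))"
proof -
  interpret riemannian_manifold \<A> g
    using assms(6,10) by (simp add: riemannian_manifold_def smooth_manifold_def riemannian_manifold_axioms_def)
  note \<kappa> = assms(1) and V = assms(8) and VL = assms(9)
  have \<alpha>: "0 < \<alpha>" using assms(3) by (smt (verit) divide_nonneg_nonneg of_nat_0_le_iff)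
  have "sup_norm_V g \<kappa> VL < \<infinity>"
    by (rule le_less_trans[OF _ assms(13)]) (simp add: add_increasing2)
  from gnorm_le_tnorm[OF \<kappa> VL this] obtain K where K: "K \<ge> 0"
    "\<And>A p. A \<in> lie_alg \<kappa> \<Longrightarrow> gnorm g p (VL A p) \<le> K * tnorm \<kappa> A" by blast
  obtain a where a: "\<And>s t. s \<in> {0..T} \<Longrightarrow> t \<in> {0..T} \<Longrightarrow> \<exists>\<xi>\<in>lie_alg \<kappa>. rp_extend \<kappa> X s t = texp \<kappa> \<xi> \<and>
    tlog \<kappa> (rp_extend \<kappa> X s t) = \<xi> \<and> hom_bound \<kappa> (\<bar>t - s\<bar> powr \<alpha>) a \<xi>"
    using rough_path_log[OF \<kappa> assms(7)] by blast
  have a0: "a \<ge> 0"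
  proof -
    have "0 \<in> {0..T}" using assms(2) by simp
    from a[OF this this] obtain \<xi> :: "'d tensor" where "hom_bound \<kappa> (\<bar>0 - 0\<bar> powr \<alpha>) a \<xi>" by blast
    then show ?thesis by (rule hom_bound_nonneg)
  qed
  obtain C0 :: real where C0: "\<forall>s\<in>{0..T}. \<forall>t\<in>{0..T}.
      (SUP m. gdist \<A> g (\<phi> t s m) (\<mu> t s m)) \<le> ennreal (C0 * \<bar>t - s\<bar> powr \<theta>)"
    using assms(18) by blast
  \<comment> \<open>The given constant may be negative, in which case the bound in the extended reals is zero.\<close>
  define D where "D = \<bar>C0\<bar>"
  have D: "gdist \<A> g (\<phi> t s m) (\<mu> t s m) \<le> ennreal (D * \<bar>t - s\<bar> powr \<theta>)"
    if "s \<in> {0..T}" "t \<in> {0..T}" for s t m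
  proof -
    have "gdist \<A> g (\<phi> t s m) (\<mu> t s m) \<le> (SUP m. gdist \<A> g (\<phi> t s m) (\<mu> t s m))"
      by (rule SUP_upper) simp
    also have "\<dots> \<le> ennreal (C0 * \<bar>t - s\<bar> powr \<theta>)" using C0 that by blast
    also have "\<dots> \<le> ennreal (D * \<bar>t - s\<bar> powr \<theta>)"
      by (intro ennreal_leI mult_right_mono) (simp_all add: D_def)
    finally show ?thesis .
  qed
  have cont_y: "continuous_on {0..T} y"
  proof -
    have "continuous_on {0..T} (\<lambda>t. (\<lambda>(t, s, m). \<phi> t s m) (t, 0, m0))"
      by (rule continuous_on_compose2[OF assms(15)]) (use assms(2) in \<open>auto intro!: continuous_intros\<close>)
    then show ?thesis using assms(19) by simp
  qed
  define S where "S = y ` {0..T}"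
  have S: "compact S" "S \<noteq> {}"
    unfolding S_def using cont_y assms(2) by (auto intro: compact_continuous_image)
  obtain P \<sigma> \<Lambda> where P: "compact_nhd \<A> S P" and \<sigma>: "\<sigma> > 0" and \<Lambda>: "\<Lambda> \<ge> 0"
    and tube: "\<forall>q\<in>S. \<forall>q' e. gdist \<A> g q q' \<le> ennreal e \<and> 0 \<le> e \<and> e < \<sigma> \<longrightarrow> q' \<in> (\<Union>(c, L)\<in>P. L) \<and>
      (\<forall>f n. smooth_fun \<A> f \<and> n \<ge> 1 \<longrightarrow> \<bar>f q - f q'\<bar> \<le> \<Lambda> * Ck_norm n P f * e)"
    using metric_tube[OF S(1)] by blast
  from word_op_le_Ck_norm[OF V P, of "2 * \<kappa>"] obtain B where B: "B \<ge> 0"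
    "\<forall>f w q. smooth_fun \<A> f \<and> length w \<le> 2 * \<kappa> \<and> q \<in> (\<Union>(c, L)\<in>P. L) \<longrightarrow>
      \<bar>word_op \<A> V w f q\<bar> \<le> B * Ck_norm (2 * \<kappa>) P f" by (elim exE conjE)
  have "S \<subseteq> interior (\<Union>(c, L)\<in>P. L)" using P by (simp add: compact_nhd_def)
  then have SP: "S \<subseteq> (\<Union>(c, L)\<in>P. L)" using interior_subset by (rule order_trans)
  define W where "W = {w :: 'd list. length w \<le> \<kappa>}"
  define e where "e = (\<Sum>k\<le>\<kappa>. (real (\<kappa> + 1) * a) ^ k)"
  have e0: "e \<ge> 0" unfolding e_def using a0 by (intro sum_nonneg) simp
  define k where "k = K * (real (card W) * a)"
  have k0: "k \<ge> 0" unfolding k_def using K a0 by simp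
  \<comment> \<open>Below the threshold \<open>\<eta>\<close> for \<open>\<rho>\<close>, the integral curve, whose speed is at most \<open>k \<rho>\<close>, and its
    comparison with \<open>y t\<close> stay within distance \<open>\<sigma>\<close> of the curve \<open>y\<close>.\<close>
  define \<eta> where "\<eta> = min 1 (\<sigma> / (k + D + 1))"
  have D0: "D \<ge> 0" by (simp add: D_def)
  have \<eta>: "0 < \<eta>" "\<eta> \<le> 1" using \<sigma> k0 D0 by (simp_all add: \<eta>_def)
  define R where "R = max 1 (T powr \<alpha>)"
  \<comment> \<open>The constant for small \<open>\<rho>\<close>, from the distance to the flow and from the expansion of the flow.\<close>
  define C1 where "C1 = \<Lambda> * D + real (card (W \<times> W)) * (a * e * B)"
  \<comment> \<open>The constant for \<open>\<rho> \<ge> \<eta>\<close>, where \<open>R\<close> bounds \<open>\<rho>\<close> and dividing by a power of \<open>\<eta>\<close> restores the rate.\<close>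
  define C2 where "C2 = (B + real (card W) * (e * R ^ \<kappa> * B)) / \<eta> ^ (\<kappa> + 1)"
  have C12: "C1 \<ge> 0" "C2 \<ge> 0"
    unfolding C1_def C2_def using \<Lambda> D0 a0 e0 B \<eta> by (simp_all add: R_def)
  have main: "\<bar>f (y t) - diff_op \<A> \<kappa> V (rp_extend \<kappa> X s t) f (y s)\<bar>
      \<le> max C1 C2 * Ck_norm (2 * \<kappa>) P f * \<bar>t - s\<bar> powr \<theta>"
    if f: "smooth_fun \<A> f" and s: "s \<in> {0..T}" and t: "t \<in> {0..T}" for f s t
  proof -
    define \<rho> where "\<rho> = \<bar>t - s\<bar> powr \<alpha>"
    have \<rho>0: "0 \<le> \<rho>" by (simp add: \<rho>_def)
    have \<rho>\<theta>: "\<bar>t - s\<bar> powr \<theta> = \<rho> ^ (\<kappa> + 1)"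
    proof -
      have "\<bar>t - s\<bar> powr \<theta> = \<rho> powr real (\<kappa> + 1)" by (simp only: assms(5) \<rho>_def powr_powr)
      also have "\<dots> = \<rho> ^ (\<kappa> + 1)"
      proof (cases "\<rho> = 0")
        case False
        then show ?thesis using \<rho>0 by (intro powr_realpow) simp
      qed simp
      finally show ?thesis .
    qed
    define F where "F = Ck_norm (2 * \<kappa>) P f"
    have F0: "F \<ge> 0" unfolding F_def by (rule Ck_norm_nonneg[OF P f S(2)])
    have yS: "y s \<in> S" "y t \<in> S" using s t by (auto simp: S_def)
    obtain \<xi> where \<xi>: "\<xi> \<in> lie_alg \<kappa>" "rp_extend \<kappa> X s t = texp \<kappa> \<xi>"
      "tlog \<kappa> (rp_extend \<kappa> X s t) = \<xi>" "hom_bound \<kappa> \<rho> a \<xi>"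
      using a[OF s t] unfolding \<rho>_def by blast
    have bw: "\<bar>word_op \<A> V w f q\<bar> \<le> B * F" if "length w \<le> 2 * \<kappa>" "q \<in> (\<Union>(c, L)\<in>P. L)" for w q
      unfolding F_def by (rule B(2)[rule_format]) (use f that in blast)
    show ?thesis
    proof (cases "\<rho> < \<eta>")
      case True
      have \<rho>1: "\<rho> \<le> 1" using True \<eta> by simp
      have small: "(k + D) * \<rho> < \<sigma>"
      proof -
        have "(k + D) * \<rho> \<le> (k + D + 1) * \<rho>" using \<rho>0 by (simp add: distrib_right)
        also have "\<dots> < (k + D + 1) * (\<sigma> / (k + D + 1))"
          using True k0 D0 by (intro mult_strict_left_mono) (auto simp: \<eta>_def)
        finally show ?thesis using k0 D0 by simp
      qed
      have gn: "gnorm g p (VL \<xi> p) \<le> k * \<rho>" for p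
      proof -
        \<comment> \<open>The coefficient of degree zero vanishes, and in positive degree \<open>\<rho> \<le> 1\<close> absorbs the higher powers.\<close>
        have "\<bar>\<xi> w\<bar> \<le> a * \<rho>" if "length w \<le> \<kappa>" for w
        proof (cases "w = []")
          case True
          then show ?thesis using lie_alg_Nil[OF \<xi>(1)] a0 \<rho>0 by simp
        next
          case False
          have "\<bar>\<xi> w\<bar> \<le> a * \<rho> ^ length w" using \<xi>(4) that by (simp add: hom_bound_def)
          also have "\<dots> \<le> a * \<rho> ^ 1"
            using a0 \<rho>0 \<rho>1 False by (intro mult_left_mono power_decreasing) (auto simp: Suc_le_eq)
          finally show ?thesis by simp
        qed
        then have "tnorm \<kappa> \<xi> \<le> real (card W) * (a * \<rho>)" unfolding W_def by (rule tnorm_le)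
        then have "K * tnorm \<kappa> \<xi> \<le> K * (real (card W) * (a * \<rho>))" using K(1) by (rule mult_left_mono)
        then show ?thesis using K(2)[OF \<xi>(1), of p] by (simp add: k_def mult.assoc)
      qed
      have smooth: "smooth_vfield \<A> (VL \<xi>)" using VL \<xi>(1) by (simp add: lie_extension_def)
      define \<gamma> where "\<gamma> = (SOME \<gamma>. integral_curve \<A> (VL \<xi>) \<gamma> \<and> \<gamma> 0 = y s)"
      have \<gamma>: "integral_curve \<A> (VL \<xi>) \<gamma>" "\<gamma> 0 = y s"
        using someI_ex[OF complete_if_bounded[OF assms(11) smooth gn, of "y s"]] by (auto simp: \<gamma>_def)
      have \<mu>: "\<mu> t s (y s) = \<gamma> 1" unfolding assms(14) \<xi>(3) vf_exp_def \<gamma>_def ..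
      have inP: "\<gamma> u \<in> (\<Union>(c, L)\<in>P. L)" if u: "u \<in> {0..1}" for u
      proof -
        have "gdist \<A> g (\<gamma> 0) (\<gamma> u) \<le> ennreal (k * \<rho> * \<bar>u - 0\<bar>)"
          using \<gamma>(1) integral_curve_iff by (intro gdist_integral_curve[OF smooth gn]) blast
        moreover have "k * \<rho> * \<bar>u - 0\<bar> < \<sigma>"
        proof -
          have "k * \<rho> * \<bar>u - 0\<bar> \<le> k * \<rho> * 1" using u k0 \<rho>0 by (intro mult_left_mono) auto
          also have "\<dots> \<le> (k + D) * \<rho>" using D0 \<rho>0 by (simp add: distrib_right)
          finally show ?thesis using small by simp
        qed
        moreover have "0 \<le> k * \<rho> * \<bar>u - 0\<bar>" using k0 \<rho>0 by simp
        ultimately have "gdist \<A> g (y s) (\<gamma> u) \<le> ennreal (k * \<rho> * \<bar>u - 0\<bar>) \<and>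
            0 \<le> k * \<rho> * \<bar>u - 0\<bar> \<and> k * \<rho> * \<bar>u - 0\<bar> < \<sigma>" unfolding \<gamma>(2) by (intro conjI)
        from tube[rule_format, OF yS(1) this] show ?thesis by (rule conjunct1)
      qed
      have flow: "\<bar>f (\<gamma> 1) - diff_op \<A> \<kappa> V (texp \<kappa> \<xi>) f (\<gamma> 0)\<bar>
          \<le> real (card (W \<times> W)) * (a * e * (B * F) * \<rho> ^ (\<kappa> + 1))"
        unfolding W_def e_def
        by (rule taylor_along_flow[OF \<kappa> V VL \<xi>(1) \<gamma>(1) f \<rho>0 \<rho>1 \<xi>(4)]) (intro bw inP)
      have yt: "\<phi> t s (y s) = y t"
      proof -
        have "(\<phi> t s \<circ> \<phi> s 0) m0 = \<phi> t 0 m0" using assms(17) s t assms(2) by simp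
        then show ?thesis by (simp add: assms(19))
      qed
      have "gdist \<A> g (y t) (\<gamma> 1) \<le> ennreal (D * \<rho> ^ (\<kappa> + 1))"
        using D[OF s t, of "y s"] unfolding yt \<mu> \<rho>\<theta> .
      moreover have "D * \<rho> ^ (\<kappa> + 1) < \<sigma>"
      proof -
        have "\<rho> ^ (\<kappa> + 1) \<le> \<rho> ^ 1" using \<rho>0 \<rho>1 by (intro power_decreasing) auto
        then have "D * \<rho> ^ (\<kappa> + 1) \<le> D * \<rho>" using D0 by (intro mult_left_mono) auto
        also have "\<dots> \<le> (k + D) * \<rho>" using k0 \<rho>0 by (simp add: distrib_right)
        finally show ?thesis using small by simp
      qed
      moreover have "0 \<le> D * \<rho> ^ (\<kappa> + 1)" using D0 \<rho>0 by simp
      ultimately have "gdist \<A> g (y t) (\<gamma> 1) \<le> ennreal (D * \<rho> ^ (\<kappa> + 1)) \<and>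
          0 \<le> D * \<rho> ^ (\<kappa> + 1) \<and> D * \<rho> ^ (\<kappa> + 1) < \<sigma>" by (intro conjI)
      from tube[rule_format, OF yS(2) this, THEN conjunct2] f \<kappa>
      have close: "\<bar>f (y t) - f (\<gamma> 1)\<bar> \<le> \<Lambda> * F * (D * \<rho> ^ (\<kappa> + 1))"
        unfolding F_def by simp
      have "\<bar>f (y t) - diff_op \<A> \<kappa> V (texp \<kappa> \<xi>) f (\<gamma> 0)\<bar>
          \<le> \<Lambda> * F * (D * \<rho> ^ (\<kappa> + 1)) + real (card (W \<times> W)) * (a * e * (B * F) * \<rho> ^ (\<kappa> + 1))"
        using close flow by linarith
      also have "\<dots> = C1 * (F * \<rho> ^ (\<kappa> + 1))" by (simp add: C1_def algebra_simps)
      also have "\<dots> \<le> max C1 C2 * (F * \<rho> ^ (\<kappa> + 1))"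
        using F0 \<rho>0 by (intro mult_right_mono) auto
      finally show ?thesis using \<gamma>(2) by (simp only: \<xi>(2) \<rho>\<theta> F_def mult.assoc)
    next
      case False
      have \<rho>R: "\<rho> \<le> R"
      proof -
        have "\<rho> \<le> T powr \<alpha>" unfolding \<rho>_def using s t \<alpha> by (intro powr_mono2) auto
        then show ?thesis by (simp add: R_def)
      qed
      have "\<bar>texp \<kappa> \<xi> w * word_op \<A> V w f (y s)\<bar> \<le> e * R ^ \<kappa> * (B * F)" if w: "w \<in> W" for w
      proof -
        have "\<bar>texp \<kappa> \<xi> w\<bar> \<le> e * \<rho> ^ length w"
          using hom_bound_texp[OF \<xi>(4) \<rho>0, of 1] w unfolding hom_bound_def e_def W_def by simp
        also have "\<dots> \<le> e * R ^ \<kappa>"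
        proof -
          have "\<rho> ^ length w \<le> R ^ length w" using \<rho>0 \<rho>R by (rule power_mono[rotated])
          also have "\<dots> \<le> R ^ \<kappa>" using w by (intro power_increasing) (auto simp: W_def R_def)
          finally show ?thesis using e0 by (intro mult_left_mono)
        qed
        finally have "\<bar>texp \<kappa> \<xi> w\<bar> \<le> e * R ^ \<kappa>" .
        moreover have "\<bar>word_op \<A> V w f (y s)\<bar> \<le> B * F"
          using w yS(1) SP by (intro bw) (auto simp: W_def)
        ultimately show ?thesis
          unfolding abs_mult using e0 by (intro mult_mono) (auto simp: R_def)
      qed
      then have "\<bar>diff_op \<A> \<kappa> V (texp \<kappa> \<xi>) f (y s)\<bar> \<le> (\<Sum>w\<in>W. e * R ^ \<kappa> * (B * F))"
        unfolding diff_op_def W_def[symmetric] by (intro order_trans[OF sum_abs] sum_mono)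
      moreover have "\<bar>f (y t)\<bar> \<le> B * F"
        using bw[of "[]" "y t"] yS(2) SP by auto
      ultimately have "\<bar>f (y t) - diff_op \<A> \<kappa> V (texp \<kappa> \<xi>) f (y s)\<bar>
          \<le> B * F + real (card W) * (e * R ^ \<kappa> * (B * F))" by simp
      also have "\<dots> = C2 * \<eta> ^ (\<kappa> + 1) * F"
      proof -
        have ne: "\<eta> ^ (\<kappa> + 1) \<noteq> 0" using \<eta>(1) by simp
        have "C2 * \<eta> ^ (\<kappa> + 1) = B + real (card W) * (e * R ^ \<kappa> * B)"
          by (simp only: C2_def times_divide_eq_left nonzero_mult_div_cancel_right[OF ne])
        then show ?thesis by (simp only: distrib_right mult.assoc)
      qed
      also have "\<dots> = C2 * F * \<eta> ^ (\<kappa> + 1)" by (simp only: mult_ac)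
      also have "\<dots> \<le> C2 * F * \<rho> ^ (\<kappa> + 1)"
        using False \<eta>(1) C12 F0 by (intro mult_left_mono power_mono) auto
      also have "\<dots> \<le> max C1 C2 * F * \<rho> ^ (\<kappa> + 1)"
        using F0 \<rho>0 by (intro mult_right_mono) auto
      finally show ?thesis by (simp only: \<xi>(2) \<rho>\<theta> F_def)
    qed
  qed
  show ?thesis
  proof (intro exI conjI allI impI ballI)
    show "compact_nhd \<A> (y ` {0..T}) P" using P by (simp add: S_def)
    show "mono (\<lambda>r. max C1 C2 * r)" using C12 by (intro monoI mult_left_mono) auto
  qed (rule main)
qed

end
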